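(* Let $(a_n)_{n\in\mathbb{N}}$ and $(b_{n,j})_{n,j\in\mathbb{N}}$ be real numbers with $a_n\ge 0$ for all $n$, $b_{n,j}\ge 0$ for all $n,j$, and $b_{n,j}=0$ whenever $n\ge j$. Let $w$ be a weight such that $w_n\ge n$ for all $n\in\mathbb{N}$ and such that there exists $\kappa\in(0,1)$ with $\sum_{n=1}^{j-1}w_nb_{n,j}\le\kappa w_j$ for all $j=2,3,\ldots$. Further, let $n\in\mathbb{N}$. Then the abstract Cauchy problem $$u'(t)=A^{(w)}u(t)+B^{(w)}u(t),\quad t>0;\qquad u(0)=\mathring{u},$$ has a unique, non-negative solution $u\in C^1((0,\infty),\ell_w^1)\cap C([0,\infty),X_{-n}^{(w)})$ for all $\mathring{u}\in(X_{-n}^{(w)})_+$. This solution is given by $u(t)=S_{-n}^{(w)}(t)\mathring{u}$, $t\ge0$.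
   Context: $\mathbb{N}=\{1,2,\ldots\}$. A weight is a sequence $w=(w_n)_{n=1}^\infty$ of strictly positive reals, and $\ell_w^1$ is the Banach space of sequences $f=(f_n)_{n=1}^\infty$ with $\|f\|_w=\sum_{n=1}^\infty w_n|f_n|<\infty$ (complex version when analyticity is concerned); $(\ell_w^1)_+$ is the set of componentwise non-negative sequences in it. Operators: $A^{(w)}f=(-a_nf_n)_{n=1}^\infty$ with $\mathcal{D}(A^{(w)})=\{f\in\ell_w^1:(a_nf_n)_n\in\ell_w^1\}$; $B^{(w)}f=\bigl(\sum_{j=n+1}^\infty a_jb_{n,j}f_j\bigr)_{n=1}^\infty$ with $\mathcal{D}(B^{(w)})$ the set of $f\in\ell_w^1$ for which this sequence is well defined and lies in $\ell_w^1$. Under the stated hypotheses, $G^{(w)}=A^{(w)}+B^{(w)}$ (domain $\mathcal{D}(A^{(w)})\cap\mathcal{D}(B^{(w)})$) generates an analytic, substochastic $C_0$-semigroup $(S^{(w)}(t))_{t\ge0}$ on $\ell_w^1$ (substochastic: positive, and contractive on the positive cone). Sobolev tower: let $\omega_0$ be the growth bound of $(S^{(w)}(t))_{t\ge0}$, fix $\mu>\omega_0$, and set $\mathcal{G}^{(w)}=G^{(w)}-\mu I$, the (invertible) generator of $\mathscr{S}^{(w)}(t)=e^{-\mu t}S^{(w)}(t)$. Put $X_0^{(w)}=\ell_w^1$, $\|\cdot\|_0=\|\cdot\|_w$, $\mathcal{G}_0^{(w)}=\mathcal{G}^{(w)}$, $X_1^{(w)}=\mathcal{D}(\mathcal{G}^{(w)})$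 with norm $\|f\|_1=\|\mathcal{G}^{(w)}f\|_w$. Recursively for $n\in\mathbb{N}$, $X_{-n}^{(w)}$ is the completion of $X_{-n+1}^{(w)}$ with respect to the norm $\|f\|_{-n}=\|(\mathcal{G}_{-n+1}^{(w)})^{-1}f\|_{-n+1}$, and $\mathcal{G}_{-n}^{(w)}$ is the unique continuous extension of $\mathcal{G}_{-n+1}^{(w)}$ from $\mathcal{D}(\mathcal{G}^{(w)}_{-n+1})=X_{-n+2}^{(w)}$ to $\mathcal{D}(\mathcal{G}_{-n}^{(w)})=X_{-n+1}^{(w)}$, with values in $X_{-n}^{(w)}$. Thus $\ell_w^1$ is continuously and densely embedded in $X_{-n}^{(w)}$. $S_{-n}^{(w)}(t)$ denotes the unique continuous extension of $S^{(w)}(t)$ from $\ell_w^1$ to $X_{-n}^{(w)}$; $(S_{-n}^{(w)}(t))_{t\ge0}$ is an analytic $C_0$-semigroup on $X_{-n}^{(w)}$. $(X_{-n}^{(w)})_+$ denotes the closure of $(\ell_w^1)_+$ in $X_{-n}^{(w)}$. A solution in the class $C^1((0,\infty),\ell_w^1)\cap C([0,\infty),X_{-n}^{(w)})$ is a function in this class with $u(t)\in\mathcal{D}(A^{(w)})\cap\mathcal{D}(B^{(w)})$ for $t>0$, satisfying the differential equation in $\ell_w^1$ for all $t>0$ and $u(0)=\mathring{u}$ in $X_{-n}^{(w)}$; it is non-negative if $u(t)\in(\ell_w^1)_+$ for all $t>0$. *)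

theory Defs
  imports "HOL-Analysis.Analysis" "HOL-Library.Function_Algebras"
begin

section \<open>Normed spaces with an explicit carrier\<close>

text \<open>
  The spaces below depend on parameters (a weight, a level of the Sobolev tower), so they are
  given by a carrier \<open>X\<close> inside an ambient complex vector space (type \<open>'v\<close>, scalar multiplication
  \<open>sc\<close>) and a norm \<open>N\<close> of which only the values on \<open>X\<close> matter. Outside of \<open>X\<close> the distance is
  set to 0 because the locale \<open>Metric_space\<close> requires nonnegativity and symmetry everywhere.
\<close>

definition norm_dist :: "'v::ab_group_add set \<Rightarrow> ('v \<Rightarrow> real) \<Rightarrow> 'v \<Rightarrow> 'v \<Rightarrow> real" where
  "norm_dist X N x y = (if x \<in> X \<and> y \<in> X then N (x - y) else 0)"

definition norm_topology :: "'v::ab_group_add set \<Rightarrow> ('v \<Rightarrow> real) \<Rightarrow> 'v topology" where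
  "norm_topology X N = Metric_space.mtopology X (norm_dist X N)"

definition normed_space_on ::
  "(complex \<Rightarrow> 'v::ab_group_add \<Rightarrow> 'v) \<Rightarrow> 'v set \<Rightarrow> ('v \<Rightarrow> real) \<Rightarrow> bool" where
  "normed_space_on sc X N \<longleftrightarrow>
     module.subspace sc X \<and>
     (\<forall>x\<in>X. 0 \<le> N x \<and> (N x = 0 \<longleftrightarrow> x = 0)) \<and>
     (\<forall>x\<in>X. \<forall>y\<in>X. N (x + y) \<le> N x + N y) \<and>
     (\<forall>c. \<forall>x\<in>X. N (sc c x) = cmod c * N x)"

definition banach_space_on ::
  "(complex \<Rightarrow> 'v::ab_group_add \<Rightarrow> 'v) \<Rightarrow> 'v set \<Rightarrow> ('v \<Rightarrow> real) \<Rightarrow> bool" where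
  "banach_space_on sc X N \<longleftrightarrow>
     normed_space_on sc X N \<and> Metric_space.mcomplete X (norm_dist X N)"

definition is_completion ::
  "(complex \<Rightarrow> 'v::ab_group_add \<Rightarrow> 'v) \<Rightarrow> 'v set \<Rightarrow> ('v \<Rightarrow> real) \<Rightarrow> 'v set \<Rightarrow> ('v \<Rightarrow> real) \<Rightarrow> bool"
  where
  "is_completion sc Y M X N \<longleftrightarrow>
     Y \<subseteq> X \<and> (\<forall>y\<in>Y. N y = M y) \<and> banach_space_on sc X N \<and> norm_topology X N closure_of Y = X"

definition linear_map_on ::
  "(complex \<Rightarrow> 'u::ab_group_add \<Rightarrow> 'u) \<Rightarrow> (complex \<Rightarrow> 'v::ab_group_add \<Rightarrow> 'v) \<Rightarrow>
   'u set \<Rightarrow> ('u \<Rightarrow> 'v) \<Rightarrow> bool" where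
  "linear_map_on sc sc' X T \<longleftrightarrow>
     (\<forall>x\<in>X. \<forall>y\<in>X. T (x + y) = T x + T y) \<and> (\<forall>c. \<forall>x\<in>X. T (sc c x) = sc' c (T x))"

definition has_norm_derivative ::
  "(complex \<Rightarrow> 'v::ab_group_add \<Rightarrow> 'v) \<Rightarrow> ('v \<Rightarrow> real) \<Rightarrow> (real \<Rightarrow> 'v) \<Rightarrow> 'v \<Rightarrow> real \<Rightarrow> real set \<Rightarrow> bool"
  where
  "has_norm_derivative sc N f D t J \<longleftrightarrow>
     ((\<lambda>s. N (sc (complex_of_real (inverse (s - t))) (f s - f t) - D)) \<longlongrightarrow> 0) (at t within J)"

definition C1_on ::
  "(complex \<Rightarrow> 'v::ab_group_add \<Rightarrow> 'v) \<Rightarrow> 'v set \<Rightarrow> ('v \<Rightarrow> real) \<Rightarrow> real set \<Rightarrow> (real \<Rightarrow> 'v) \<Rightarrow> bool"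
  where
  "C1_on sc X N J f \<longleftrightarrow>
     (\<forall>t\<in>J. f t \<in> X) \<and>
     (\<exists>f'. continuous_map (top_of_set J) (norm_topology X N) f' \<and>
           (\<forall>t\<in>J. has_norm_derivative sc N f (f' t) t J))"


section \<open>Operator semigroups\<close>

definition C0_semigroup ::
  "(complex \<Rightarrow> 'v::ab_group_add \<Rightarrow> 'v) \<Rightarrow> 'v set \<Rightarrow> ('v \<Rightarrow> real) \<Rightarrow> (real \<Rightarrow> 'v \<Rightarrow> 'v) \<Rightarrow> bool" where
  "C0_semigroup sc X N S \<longleftrightarrow>
     (\<forall>t\<ge>0. S t ` X \<subseteq> X \<and> linear_map_on sc sc X (S t) \<and> (\<exists>C. \<forall>x\<in>X. N (S t x) \<le> C * N x)) \<and>
     (\<forall>x\<in>X. S 0 x = x) \<and>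
     (\<forall>s\<ge>0. \<forall>t\<ge>0. \<forall>x\<in>X. S (s + t) x = S s (S t x)) \<and>
     (\<forall>x\<in>X. ((\<lambda>t. N (S t x - x)) \<longlongrightarrow> 0) (at_right 0))"

definition is_generator ::
  "(complex \<Rightarrow> 'v::ab_group_add \<Rightarrow> 'v) \<Rightarrow> 'v set \<Rightarrow> ('v \<Rightarrow> real) \<Rightarrow> (real \<Rightarrow> 'v \<Rightarrow> 'v) \<Rightarrow>
   'v set \<Rightarrow> ('v \<Rightarrow> 'v) \<Rightarrow> bool" where
  "is_generator sc X N S D G \<longleftrightarrow>
     (\<forall>x\<in>X. \<forall>y\<in>X. has_norm_derivative sc N (\<lambda>t. S t x) y 0 {0..} \<longleftrightarrow> x \<in> D \<and> y = G x)"

definition growth_bound :: "'v set \<Rightarrow> ('v \<Rightarrow> real) \<Rightarrow> (real \<Rightarrow> 'v \<Rightarrow> 'v) \<Rightarrow> ereal" where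
  "growth_bound X N S =
     Inf {ereal \<omega> | \<omega>. \<exists>M. \<forall>t\<ge>0. \<forall>x\<in>X. N (S t x) \<le> M * exp (\<omega> * t) * N x}"


section \<open>The weighted sequence space and the fragmentation operators\<close>

text \<open>
  A sequence indexed by \<open>{1, 2, ...}\<close> is a function on \<^typ>\<open>nat\<close> that vanishes at 0.
\<close>

definition seq_scale :: "complex \<Rightarrow> (nat \<Rightarrow> complex) \<Rightarrow> nat \<Rightarrow> complex" where
  "seq_scale c f = (\<lambda>n. c * f n)"

definition l1 :: "(nat \<Rightarrow> real) \<Rightarrow> (nat \<Rightarrow> complex) set" where
  "l1 w = {f. f 0 = 0 \<and> summable (\<lambda>n. w n * cmod (f n))}"

definition l1_norm :: "(nat \<Rightarrow> real) \<Rightarrow> (nat \<Rightarrow> complex) \<Rightarrow> real" where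
  "l1_norm w f = (\<Sum>n. w n * cmod (f n))"

definition l1_cone :: "(nat \<Rightarrow> real) \<Rightarrow> (nat \<Rightarrow> complex) set" where
  "l1_cone w = {f \<in> l1 w. \<forall>n. f n \<in> \<real>\<^sub>\<ge>\<^sub>0}"

definition A_op :: "(nat \<Rightarrow> real) \<Rightarrow> (nat \<Rightarrow> complex) \<Rightarrow> nat \<Rightarrow> complex" where
  "A_op a f = (\<lambda>n. - (complex_of_real (a n) * f n))"

definition A_dom :: "(nat \<Rightarrow> real) \<Rightarrow> (nat \<Rightarrow> real) \<Rightarrow> (nat \<Rightarrow> complex) set" where
  "A_dom w a = {f \<in> l1 w. (\<lambda>n. complex_of_real (a n) * f n) \<in> l1 w}"

definition B_term ::
  "(nat \<Rightarrow> real) \<Rightarrow> (nat \<Rightarrow> nat \<Rightarrow> real) \<Rightarrow> (nat \<Rightarrow> complex) \<Rightarrow> nat \<Rightarrow> nat \<Rightarrow> complex" where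
  "B_term a b f n j = complex_of_real (a j * b n j) * f j"

definition B_op ::
  "(nat \<Rightarrow> real) \<Rightarrow> (nat \<Rightarrow> nat \<Rightarrow> real) \<Rightarrow> (nat \<Rightarrow> complex) \<Rightarrow> nat \<Rightarrow> complex" where
  "B_op a b f = (\<lambda>n. if n = 0 then 0 else (\<Sum>i. B_term a b f n (n + 1 + i)))"

definition B_dom ::
  "(nat \<Rightarrow> real) \<Rightarrow> (nat \<Rightarrow> real) \<Rightarrow> (nat \<Rightarrow> nat \<Rightarrow> real) \<Rightarrow> (nat \<Rightarrow> complex) set" where
  "B_dom w a b =
     {f \<in> l1 w. (\<forall>n\<ge>1. summable (\<lambda>i. B_term a b f n (n + 1 + i))) \<and> B_op a b f \<in> l1 w}"

definition G_op ::
  "(nat \<Rightarrow> real) \<Rightarrow> (nat \<Rightarrow> nat \<Rightarrow> real) \<Rightarrow> (nat \<Rightarrow> complex) \<Rightarrow> nat \<Rightarrow> complex" where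
  "G_op a b f = A_op a f + B_op a b f"

definition G_dom ::
  "(nat \<Rightarrow> real) \<Rightarrow> (nat \<Rightarrow> real) \<Rightarrow> (nat \<Rightarrow> nat \<Rightarrow> real) \<Rightarrow> (nat \<Rightarrow> complex) set" where
  "G_dom w a b = A_dom w a \<inter> B_dom w a b"

text \<open>
  A \<open>C\<^sub>0\<close>-semigroup is determined by its generator, so the choice below only affects the irrelevant
  values at negative times and outside of the space.
\<close>

definition frag_semigroup ::
  "(nat \<Rightarrow> real) \<Rightarrow> (nat \<Rightarrow> real) \<Rightarrow> (nat \<Rightarrow> nat \<Rightarrow> real) \<Rightarrow>
   real \<Rightarrow> (nat \<Rightarrow> complex) \<Rightarrow> nat \<Rightarrow> complex" where
  "frag_semigroup w a b =
     (SOME S. C0_semigroup seq_scale (l1 w) (l1_norm w) S \<and>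
              is_generator seq_scale (l1 w) (l1_norm w) S (G_dom w a b) (G_op a b))"


section \<open>The Sobolev tower\<close>

text \<open>
  \<open>X k\<close>, \<open>N k\<close>, \<open>\<G> k\<close> stand for the space, the norm and the operator of index \<open>-k\<close>. Completions are
  unique only up to isometric isomorphism, so an arbitrary realisation is considered, in which the
  embeddings between consecutive spaces are inclusions of subspaces of one ambient vector space;
  \<open>\<iota>\<close> identifies the weighted sequence space with \<open>X 0\<close>.
\<close>

definition tower_dom :: "'v set \<Rightarrow> (nat \<Rightarrow> 'v set) \<Rightarrow> nat \<Rightarrow> 'v set" where
  "tower_dom D X k = (case k of 0 \<Rightarrow> D | Suc m \<Rightarrow> X m)"

locale sobolev_tower =
  fixes w a :: "nat \<Rightarrow> real" and b :: "nat \<Rightarrow> nat \<Rightarrow> real" and \<mu> :: real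
    and sc :: "complex \<Rightarrow> 'v::ab_group_add \<Rightarrow> 'v"
    and \<iota> :: "(nat \<Rightarrow> complex) \<Rightarrow> 'v"
    and X :: "nat \<Rightarrow> 'v set" and N :: "nat \<Rightarrow> 'v \<Rightarrow> real" and \<G> :: "nat \<Rightarrow> 'v \<Rightarrow> 'v"
  assumes ambient: "vector_space sc"
    and embed: "linear_map_on seq_scale sc (l1 w) \<iota>" "inj_on \<iota> (l1 w)"
    and X_0: "X 0 = \<iota> ` l1 w"
    and N_0: "\<And>f. f \<in> l1 w \<Longrightarrow> N 0 (\<iota> f) = l1_norm w f"
    and \<G>_0: "\<And>f. f \<in> G_dom w a b \<Longrightarrow> \<G> 0 (\<iota> f) = \<iota> (G_op a b f - seq_scale (complex_of_real \<mu>) f)"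
    and completion: "\<And>k. is_completion sc (X k)
          (\<lambda>x. N k (the_inv_into (tower_dom (\<iota> ` G_dom w a b) X k) (\<G> k) x)) (X (Suc k)) (N (Suc k))"
    and \<G>_continuous: "\<And>k. continuous_map (norm_topology (X k) (N k))
          (norm_topology (X (Suc k)) (N (Suc k))) (\<G> (Suc k))"
    and \<G>_extends: "\<And>k x. x \<in> tower_dom (\<iota> ` G_dom w a b) X k \<Longrightarrow> \<G> (Suc k) x = \<G> k x"

text \<open>
  The continuous extension of \<open>S t\<close> from the sequence space to a space \<open>(Y, M)\<close> in which the
  image of \<open>\<iota>\<close> is dense.
\<close>

definition extended_semigroup ::
  "(nat \<Rightarrow> real) \<Rightarrow> ((nat \<Rightarrow> complex) \<Rightarrow> 'v::ab_group_add) \<Rightarrow> 'v set \<Rightarrow> ('v \<Rightarrow> real) \<Rightarrow>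
   (real \<Rightarrow> (nat \<Rightarrow> complex) \<Rightarrow> nat \<Rightarrow> complex) \<Rightarrow> real \<Rightarrow> 'v \<Rightarrow> 'v" where
  "extended_semigroup w \<iota> Y M S t =
     (SOME T. continuous_map (norm_topology Y M) (norm_topology Y M) T \<and>
              (\<forall>f\<in>l1 w. T (\<iota> f) = \<iota> (S t f)))"

definition extended_cone ::
  "(nat \<Rightarrow> real) \<Rightarrow> ((nat \<Rightarrow> complex) \<Rightarrow> 'v::ab_group_add) \<Rightarrow> 'v set \<Rightarrow> ('v \<Rightarrow> real) \<Rightarrow> 'v set" where
  "extended_cone w \<iota> Y M = norm_topology Y M closure_of (\<iota> ` l1_cone w)"


section \<open>Solutions of the abstract Cauchy problem\<close>

text \<open>
  \<open>u\<close> takes values in \<open>Y\<close>; \<open>f\<close> is its restriction to positive times, read as a function with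
  values in the weighted sequence space.
\<close>

definition acp_solution ::
  "(nat \<Rightarrow> real) \<Rightarrow> (nat \<Rightarrow> real) \<Rightarrow> (nat \<Rightarrow> nat \<Rightarrow> real) \<Rightarrow>
   ((nat \<Rightarrow> complex) \<Rightarrow> 'v::ab_group_add) \<Rightarrow> 'v set \<Rightarrow> ('v \<Rightarrow> real) \<Rightarrow> 'v \<Rightarrow> (real \<Rightarrow> 'v) \<Rightarrow> bool" where
  "acp_solution w a b \<iota> Y M u0 u \<longleftrightarrow>
     continuous_map (top_of_set {0..}) (norm_topology Y M) u \<and> u 0 = u0 \<and>
     (\<exists>f. (\<forall>t>0. u t = \<iota> (f t)) \<and>
          C1_on seq_scale (l1 w) (l1_norm w) {0<..} f \<and>
          (\<forall>t>0. f t \<in> A_dom w a \<inter> B_dom w a b \<and>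
                 has_norm_derivative seq_scale (l1_norm w) f
                   (A_op a (f t) + B_op a b (f t)) t {0<..}))"

definition nonneg_solution ::
  "(nat \<Rightarrow> real) \<Rightarrow> ((nat \<Rightarrow> complex) \<Rightarrow> 'v) \<Rightarrow> (real \<Rightarrow> 'v) \<Rightarrow> bool" where
  "nonneg_solution w \<iota> u \<longleftrightarrow> (\<forall>t>0. u t \<in> \<iota> ` l1_cone w)"

end

theory Submission
  imports Defs
begin

text \<open>
  After absorbing the weight, the generator is \<open>G x = K (L x) - L x\<close>, where \<open>L\<close> is multiplication by
  the rates and \<open>K\<close> is a bounded operator of norm at most \<open>\<kappa> < 1\<close>; hence \<open>G\<close> and \<open>L\<close> have equivalent
  graph norms. As \<open>G\<close> is upper triangular, the matrix of the semigroup \<open>S\<close> solves a triangular linear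
  system column by column; its entries are nonnegative and its column sums are at most 1. Instead of
  analyticity, only the bound \<open>norm (G (S t x)) \<le> C / t * norm x\<close> is needed, and it follows from
  contractivity and the dissipation of mass.

  With \<open>H = G - \<mu>\<close>, each operator of the tower is an isometry from one level onto the next one, so that
  \<open>H ^^ n\<close> extends to an isometry from the sequence space onto level \<open>n\<close>. If it maps \<open>g\<close> to the
  initial value, the solution is \<open>u t = (H ^^ n) (S t g)\<close> for \<open>t > 0\<close>; regularity and positivity are
  consequences of the boundedness of \<open>H ^^ n \<circ> S t\<close>. For uniqueness, a solution is a classical one on
  \<open>[\<epsilon>, \<infinity>)\<close>, and \<open>\<epsilon>\<close> tends to 0 at level \<open>n\<close>.
\<close>

section \<open>The space of absolutely summable sequences\<close>

text \<open>The type \<open>ell1\<close> makes limits, derivatives, integrals and fixed points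
  available through type classes. Any realisation of level \<open>n\<close> turns out to be an
  isometric copy of this one type, and the extended semigroup is \<open>S\<close> itself transported
  by that copy. Thus no equation has to be solved in a completion; the only question is when the
  element named by \<open>x\<close> is an actual sequence, and then it is \<open>(H ^^ n) x\<close>.
  The obstacle is that the gain term is in general as unbounded as the loss term. Triangularity
  takes the place of perturbation theory: the matrix entries solve finite linear systems, and in a
  space of summable sequences uniformly bounded columns already define a bounded operator. The
  generator is determined from \<open>S\<close> afterwards. The constant in the smoothing bound
  comes from the mean value theorem: at some time \<open>r < t\<close> the loss of a column has norm
  at most \<open>1 / ((1 - \<kappa>) * t)\<close>, and contractivity carries this from
  \<open>r\<close> to \<open>t\<close>, up to the constants that compare \<open>frag_gen\<close>
  with \<open>loss\<close>.\<close>

typedef ell1 = "{f :: nat \<Rightarrow> complex. summable (\<lambda>i. cmod (f i))}"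
  morphisms coord Ell1
  by (rule exI[of _ "\<lambda>_. 0"]) simp

setup_lifting type_definition_ell1

lemma summable_cmod_add:
  assumes "summable (\<lambda>i. cmod (f i))" "summable (\<lambda>i. cmod (g i))"
  shows "summable (\<lambda>i. cmod (f i + g i))"
  by (rule summable_comparison_test'[OF summable_add[OF assms], where N = 0])
     (simp add: norm_triangle_ineq)

lemma summable_coord: "summable (\<lambda>i. cmod (coord x i))"
  using coord[of x] by simp

lemma coord_Ell1: "summable (\<lambda>i. cmod (f i)) \<Longrightarrow> coord (Ell1 f) = f"
  by (simp add: Ell1_inverse)

lemma ell1_eqI: "(\<And>i. coord x i = coord y i) \<Longrightarrow> x = y"
  by (simp add: coord_inject[symmetric] fun_eq_iff)

instantiation ell1 :: real_normed_vector
begin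

lift_definition zero_ell1 :: ell1 is "\<lambda>_. 0" by simp
lift_definition plus_ell1 :: "ell1 \<Rightarrow> ell1 \<Rightarrow> ell1" is "\<lambda>f g i. f i + g i"
  by (rule summable_cmod_add)
lift_definition uminus_ell1 :: "ell1 \<Rightarrow> ell1" is "\<lambda>f i. - f i" by simp
lift_definition minus_ell1 :: "ell1 \<Rightarrow> ell1 \<Rightarrow> ell1" is "\<lambda>f g i. f i - g i"
  using summable_cmod_add[of _ "\<lambda>i. - _ i"] by simp
lift_definition scaleR_ell1 :: "real \<Rightarrow> ell1 \<Rightarrow> ell1" is "\<lambda>r f i. r *\<^sub>R f i"
  by (simp add: summable_mult)
lift_definition norm_ell1 :: "ell1 \<Rightarrow> real" is "\<lambda>f. \<Sum>i. cmod (f i)" .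

definition sgn_ell1 :: "ell1 \<Rightarrow> ell1" where "sgn_ell1 x = inverse (norm x) *\<^sub>R x"
definition dist_ell1 :: "ell1 \<Rightarrow> ell1 \<Rightarrow> real" where "dist_ell1 x y = norm (x - y)"
definition uniformity_ell1 :: "(ell1 \<times> ell1) filter"
  where "uniformity_ell1 = (INF e\<in>{0<..}. principal {(x, y). dist x y < e})"
definition open_ell1 :: "ell1 set \<Rightarrow> bool"
  where "open_ell1 U = (\<forall>x\<in>U. \<forall>\<^sub>F (x', y) in uniformity. x' = x \<longrightarrow> y \<in> U)"

instance
proof
  fix x y z :: ell1 and r s :: real
  show "x + y + z = x + (y + z)" "x + y = y + x" "0 + x = x" "- x + x = 0" "x - y = x + - y"
    "r *\<^sub>R (x + y) = r *\<^sub>R x + r *\<^sub>R y" "(r + s) *\<^sub>R x = r *\<^sub>R x + s *\<^sub>R x"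
    "r *\<^sub>R s *\<^sub>R x = (r * s) *\<^sub>R x" "1 *\<^sub>R x = x"
    by (transfer; simp add: fun_eq_iff algebra_simps)+
  show "(norm x = 0) = (x = 0)"
  proof
    assume "norm x = 0"
    then have "\<forall>i. cmod (coord x i) = 0"
      using suminf_eq_zero_iff[OF summable_coord[of x]] by (simp add: norm_ell1.rep_eq)
    then show "x = 0" by (intro ell1_eqI) (simp add: zero_ell1.rep_eq)
  qed (simp add: norm_ell1.rep_eq zero_ell1.rep_eq)
  show "norm (x + y) \<le> norm x + norm y"
  proof -
    have "norm (x + y) \<le> (\<Sum>i. cmod (coord x i) + cmod (coord y i))"
      unfolding norm_ell1.rep_eq plus_ell1.rep_eq
      by (intro suminf_le norm_triangle_ineq summable_add summable_coord
          summable_coord[of "x + y", unfolded plus_ell1.rep_eq])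
    also have "\<dots> = norm x + norm y"
      unfolding norm_ell1.rep_eq by (intro suminf_add[symmetric] summable_coord)
    finally show ?thesis .
  qed
  show "norm (r *\<^sub>R x) = \<bar>r\<bar> * norm x"
    by (simp add: norm_ell1.rep_eq scaleR_ell1.rep_eq suminf_mult summable_coord)
qed (simp_all add: sgn_ell1_def dist_ell1_def uniformity_ell1_def open_ell1_def)

end

lemmas coord_simps [simp] = zero_ell1.rep_eq plus_ell1.rep_eq minus_ell1.rep_eq
  uminus_ell1.rep_eq scaleR_ell1.rep_eq

lemma norm_ell1_eq: "norm x = (\<Sum>i. cmod (coord x i))"
  by (rule norm_ell1.rep_eq)

lemma norm_coord_le: "cmod (coord x i) \<le> norm x"
  unfolding norm_ell1_eq using sum_le_suminf[OF summable_coord, of "{i}" x] by simp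

lemma norm_ell1_leI:
  assumes "\<And>n. (\<Sum>i<n. cmod (f i)) \<le> C"
  shows "summable (\<lambda>i. cmod (f i))" "norm (Ell1 f) \<le> C"
proof -
  show *: "summable (\<lambda>i. cmod (f i))"
    by (rule bounded_imp_summable[of _ C])
       (use assms[of "Suc _"] in \<open>auto simp: lessThan_Suc_atMost\<close>)
  show "norm (Ell1 f) \<le> C"
    unfolding norm_ell1_eq coord_Ell1[OF *] by (rule suminf_le_const[OF * assms])
qed

lemma bounded_linear_coord: "bounded_linear (\<lambda>x. coord x i)"
  by (rule bounded_linear_intro[of _ 1]) (auto simp: norm_coord_le)

lemma coord_sum: "coord (\<Sum>k\<in>I. f k) i = (\<Sum>k\<in>I. coord (f k) i)"
  by (rule bounded_linear.linear[OF bounded_linear_coord, THEN linear_sum])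

text \<open>A Cauchy sequence converges coordinatewise. Finite partial sums of the coordinate
  differences pass to the limit with a bound independent of the number of terms, which yields both
  summability of the limit and convergence in norm.\<close>

instance ell1 :: banach
proof
  fix X :: "nat \<Rightarrow> ell1"
  assume X: "Cauchy X"
  have "convergent (\<lambda>n. coord (X n) i)" for i
    using bounded_linear.Cauchy[OF bounded_linear_coord X] by (simp add: Cauchy_convergent_iff)
  then obtain f where f: "\<And>i. (\<lambda>n. coord (X n) i) \<longlonglongrightarrow> f i"
    unfolding convergent_def by metis
  have close: "\<exists>M. \<forall>m\<ge>M. \<forall>k. (\<Sum>i<k. cmod (coord (X m) i - f i)) \<le> e" if "e > 0" for e
  proof -
    obtain M where M: "\<And>m n. m \<ge> M \<Longrightarrow> n \<ge> M \<Longrightarrow> norm (X m - X n) < e"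
      using CauchyD[OF X \<open>e > 0\<close>] by blast
    have "(\<Sum>i<k. cmod (coord (X m) i - f i)) \<le> e" if "m \<ge> M" for m k
    proof (rule LIMSEQ_le_const2)
      show "(\<lambda>n. \<Sum>i<k. cmod (coord (X m) i - coord (X n) i))
          \<longlonglongrightarrow> (\<Sum>i<k. cmod (coord (X m) i - f i))"
        by (intro tendsto_intros f)
      have "(\<Sum>i<k. cmod (coord (X m) i - coord (X n) i)) \<le> norm (X m - X n)" for n
        unfolding norm_ell1_eq
        using sum_le_suminf[OF summable_coord[of "X m - X n"], of "{..<k}"] by simp
      then show "\<exists>N. \<forall>n\<ge>N. (\<Sum>i<k. cmod (coord (X m) i - coord (X n) i)) \<le> e"
        using M[OF that] by (meson less_imp_le order_trans)
    qed
    then show ?thesis by blast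
  qed
  obtain M where M: "\<And>k. (\<Sum>i<k. cmod (coord (X M) i - f i)) \<le> 1"
    using close[of 1] by auto
  \<comment> \<open>The limit is \<open>X M\<close> minus the summable difference
    \<open>X M - f\<close>, hence itself summable.\<close>
  have "summable (\<lambda>i. cmod (coord (X M - Ell1 (\<lambda>i. coord (X M) i - f i)) i))"
    by (rule summable_coord)
  then have f_summable: "summable (\<lambda>i. cmod (f i))"
    using coord_Ell1[OF norm_ell1_leI(1)[OF M]] by simp
  have "X \<longlonglongrightarrow> Ell1 f"
  proof (rule LIMSEQ_I)
    fix e :: real assume "e > 0"
    then obtain M where M: "\<And>m k. m \<ge> M \<Longrightarrow> (\<Sum>i<k. cmod (coord (X m) i - f i)) \<le> e / 2"
      using close[of "e / 2"] by auto
    have "norm (X m - Ell1 f) < e" if "m \<ge> M" for m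
    proof -
      have "X m - Ell1 f = Ell1 (\<lambda>i. coord (X m) i - f i)"
        by (rule ell1_eqI) (simp add: coord_Ell1[OF f_summable] coord_Ell1[OF norm_ell1_leI(1)[OF M[OF that]]])
      then show ?thesis
        using norm_ell1_leI(2)[OF M[OF that]] \<open>e > 0\<close> by simp
    qed
    then show "\<exists>M. \<forall>m\<ge>M. norm (X m - Ell1 f) < e" by blast
  qed
  then show "convergent X" by (rule convergentI)
qed

section \<open>Complex scaling, unit vectors and operators prescribed by their columns\<close>

lift_definition scaleC :: "complex \<Rightarrow> ell1 \<Rightarrow> ell1" is "\<lambda>c f i. c * f i"
  by (simp add: norm_mult summable_mult)

lift_definition unit :: "nat \<Rightarrow> ell1" is "\<lambda>j i. if i = j then 1 else 0"
  by (rule summable_finite[of "{_}"]) auto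

lemmas coord_scaleC [simp] = scaleC.rep_eq
lemmas coord_unit = unit.rep_eq

lemma norm_scaleC [simp]: "norm (scaleC c x) = cmod c * norm x"
  by (simp add: norm_ell1_eq norm_mult suminf_mult summable_coord)

lemma scaleC_of_real: "scaleC (complex_of_real r) x = r *\<^sub>R x"
  by (rule ell1_eqI) (simp add: scaleR_conv_of_real)

lemma bounded_linear_scaleC: "bounded_linear (scaleC c)"
  by (rule bounded_linear_intro[of _ "cmod c"]) (auto intro!: ell1_eqI simp: algebra_simps)

lemma norm_sum_unit:
  assumes "finite I"
  shows "norm (\<Sum>i\<in>I. f i *\<^sub>R unit i) = (\<Sum>i\<in>I. \<bar>f i\<bar>)"
proof -
  have c: "coord (\<Sum>i\<in>I. f i *\<^sub>R unit i) k = (if k \<in> I then of_real (f k) else 0)" for k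
    using assms
    by (simp add: coord_sum coord_unit scaleR_conv_of_real if_distrib[of "\<lambda>x. _ * x"] cong: if_cong)
  show ?thesis unfolding norm_ell1_eq c
    by (subst suminf_finite[OF assms]) auto
qed

lemma norm_unit [simp]: "norm (unit j) = 1"
  using norm_sum_unit[of "{j}" "\<lambda>_. 1"] by simp

text \<open>The remainder after \<open>n\<close> terms has the tail of a convergent series as its
  norm. By this basis property, operators can be compared on unit vectors alone.\<close>

lemma unit_expansion: "(\<lambda>j. scaleC (coord x j) (unit j)) sums x"
proof -
  have "(\<lambda>n. norm (x - (\<Sum>j<n. scaleC (coord x j) (unit j)))) \<longlonglongrightarrow> 0"
  proof -
    have c: "coord (x - (\<Sum>j<n. scaleC (coord x j) (unit j))) i = (if i < n then 0 else coord x i)" for n i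
      by (simp add: coord_sum coord_unit if_distrib[of "\<lambda>x. _ * x"] cong: if_cong)
    have "norm (x - (\<Sum>j<n. scaleC (coord x j) (unit j))) = (\<Sum>i. cmod (coord x (i + n)))" for n
    proof -
      have "norm (x - (\<Sum>j<n. scaleC (coord x j) (unit j))) = (\<Sum>i. cmod (if i < n then 0 else coord x i))"
        unfolding norm_ell1_eq c ..
      also have "\<dots> = (\<Sum>i. cmod (if i + n < n then 0 else coord x (i + n)))
          + (\<Sum>i<n. cmod (if i < n then 0 else coord x i))"
        by (rule suminf_split_initial_segment)
           (use summable_coord[of "x - (\<Sum>j<n. scaleC (coord x j) (unit j))"] in \<open>unfold c\<close>)
      finally show ?thesis by simp
    qed
    then show ?thesis
      using suminf_exist_split2[OF summable_coord[of x]] by simp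
  qed
  then show ?thesis
    unfolding sums_def by (subst LIM_zero_iff[symmetric], subst tendsto_norm_zero_iff[symmetric])
      (simp add: norm_minus_commute)
qed

text \<open>\<open>bounded_linear\<close> is real-linear only; homogeneity under
  \<open>scaleC\<close> lets an operator pass through the expansion with complex
  coefficients.\<close>

definition clin :: "(ell1 \<Rightarrow> ell1) \<Rightarrow> bool" where
  "clin F \<longleftrightarrow> bounded_linear F \<and> (\<forall>c x. F (scaleC c x) = scaleC c (F x))"

lemma clin_sums:
  assumes "clin F"
  shows "(\<lambda>j. scaleC (coord x j) (F (unit j))) sums F x"
  using bounded_linear.sums[of F, OF _ unit_expansion[of x]] assms by (simp add: clin_def)

lemma clin_eqI:
  assumes "clin F" "clin H" "\<And>j. F (unit j) = H (unit j)"
  shows "F x = H x"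
  using clin_sums[OF assms(1), of x] clin_sums[OF assms(2), of x] assms(3)
  by (simp add: sums_unique2)

lemma clin_comp: "clin F \<Longrightarrow> clin H \<Longrightarrow> clin (\<lambda>x. F (H x))"
  by (auto simp: clin_def intro: bounded_linear_compose)

text \<open>The matrix with columns \<open>c j\<close>. In this norm a uniform bound on the columns
  bounds the operator, so \<open>gain\<close> and the semigroup can both be given by
  columns.\<close>

definition of_columns :: "(nat \<Rightarrow> ell1) \<Rightarrow> ell1 \<Rightarrow> ell1" where
  "of_columns c x = (\<Sum>j. scaleC (coord x j) (c j))"

context
  fixes c :: "nat \<Rightarrow> ell1" and C :: real
  assumes c_bound: "\<And>j. norm (c j) \<le> C"
begin

lemma summable_of_columns: "summable (\<lambda>j. norm (scaleC (coord x j) (c j)))"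
  by (rule summable_comparison_test'[of "\<lambda>j. cmod (coord x j) * C"])
     (auto intro!: summable_mult2 summable_coord mult_left_mono c_bound)

lemma of_columns_sums: "(\<lambda>j. scaleC (coord x j) (c j)) sums of_columns c x"
  unfolding of_columns_def
  by (rule summable_sums[OF summable_norm_cancel[OF summable_of_columns]])

lemma norm_of_columns: "norm (of_columns c x) \<le> C * norm x"
proof -
  have "norm (of_columns c x) \<le> (\<Sum>j. norm (scaleC (coord x j) (c j)))"
    unfolding of_columns_def by (rule summable_norm[OF summable_of_columns])
  also have "\<dots> \<le> (\<Sum>j. cmod (coord x j) * C)"
    by (intro suminf_le summable_of_columns summable_mult2 summable_coord)
       (auto intro!: mult_left_mono c_bound)
  also have "\<dots> = C * norm x"
    using suminf_mult[OF summable_coord[of x], of C] by (simp add: norm_ell1_eq mult.commute)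
  finally show ?thesis .
qed

lemma clin_of_columns: "clin (of_columns c)"
proof -
  have add: "of_columns c (x + y) = of_columns c x + of_columns c y" for x y
  proof -
    have "scaleC (coord (x + y) j) (c j) = scaleC (coord x j) (c j) + scaleC (coord y j) (c j)" for j
      by (rule ell1_eqI) (simp add: algebra_simps)
    then show ?thesis
      using sums_add[OF of_columns_sums[of x] of_columns_sums[of y]] of_columns_sums[of "x + y"]
      by (simp add: sums_unique2)
  qed
  have scale: "of_columns c (scaleC z x) = scaleC z (of_columns c x)" for z x
  proof -
    have "scaleC (coord (scaleC z x) j) (c j) = scaleC z (scaleC (coord x j) (c j))" for j
      by (rule ell1_eqI) (simp add: algebra_simps)
    then show ?thesis
      using bounded_linear.sums[OF bounded_linear_scaleC of_columns_sums[of x], of z]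
        of_columns_sums[of "scaleC z x"]
      by (simp add: sums_unique2)
  qed
  have "bounded_linear (of_columns c)"
    by (rule bounded_linear_intro[of _ C])
       (auto simp: add scale norm_of_columns mult.commute simp flip: scaleC_of_real)
  then show ?thesis by (simp add: clin_def scale)
qed

lemma coord_of_columns: "(\<lambda>j. coord x j * coord (c j) i) sums coord (of_columns c x) i"
  using bounded_linear.sums[OF bounded_linear_coord of_columns_sums[of x], of i] by simp

lemma of_columns_unit: "of_columns c (unit j) = c j"
proof (rule sums_unique2[OF of_columns_sums])
  have "scaleC (coord (unit j) k) (c k) = (if k = j then c j else 0)" for k
    by (rule ell1_eqI) (simp add: coord_unit)
  then show "(\<lambda>k. scaleC (coord (unit j) k) (c k)) sums c j"
    using sums_single[of j "\<lambda>_. c j"] by simp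
qed

end


section \<open>Strongly continuous semigroups\<close>

text \<open>The quotient is the form of the limit in \<open>has_norm_derivative\<close>, hence the
  bridge from the generator to the calculus of derivatives.\<close>

lemma has_vector_derivative_iff_quotient:
  fixes f :: "real \<Rightarrow> 'a::real_normed_vector"
  shows "(f has_vector_derivative y) (at t within S) \<longleftrightarrow>
    ((\<lambda>s. inverse (s - t) *\<^sub>R (f s - f t)) \<longlongrightarrow> y) (at t within S)"
proof -
  have eq: "norm ((1 / norm (s - t)) *\<^sub>R (f s - (f t + (s - t) *\<^sub>R y)))
      = norm (inverse (s - t) *\<^sub>R (f s - f t) - y)" if "s \<noteq> t" for s
  proof -
    have "inverse (s - t) *\<^sub>R (f s - f t) - y = inverse (s - t) *\<^sub>R (f s - (f t + (s - t) *\<^sub>R y))"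
      using that by (simp add: scaleR_diff_right scaleR_add_right)
    then show ?thesis by (simp add: divide_inverse)
  qed
  have "(f has_vector_derivative y) (at t within S) \<longleftrightarrow>
      ((\<lambda>s. norm ((1 / norm (s - t)) *\<^sub>R (f s - (f t + (s - t) *\<^sub>R y)))) \<longlongrightarrow> 0) (at t within S)"
    unfolding has_vector_derivative_def has_derivative_within tendsto_norm_zero_iff
    by (simp add: bounded_linear_scaleR_left)
  also have "\<dots> \<longleftrightarrow> ((\<lambda>s. norm (inverse (s - t) *\<^sub>R (f s - f t) - y)) \<longlongrightarrow> 0) (at t within S)"
    by (rule tendsto_cong, unfold eventually_at_filter) (intro always_eventually allI impI eq)
  also have "\<dots> \<longleftrightarrow> ((\<lambda>s. inverse (s - t) *\<^sub>R (f s - f t)) \<longlongrightarrow> y) (at t within S)"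
    by (simp add: tendsto_norm_zero_iff LIM_zero_iff)
  finally show ?thesis .
qed

lemma integral_has_vector_derivative_atLeast:
  fixes f :: "real \<Rightarrow> 'a::banach"
  assumes "continuous_on {0..} f" "t \<ge> 0"
  shows "((\<lambda>u. integral {0..u} f) has_vector_derivative f t) (at t within {0..})"
proof -
  have "((\<lambda>u. integral {0..u} f) has_vector_derivative f t) (at t within {0..t + 1})"
    using assms by (intro integral_has_vector_derivative continuous_on_subset[OF assms(1)]) auto
  moreover have "at t within {0..t + 1} = at t within {0..}"
    by (rule at_within_nhd[of _ "{..<t + 1}"]) auto
  ultimately show ?thesis by simp
qed

text \<open>Because the last axiom is an equivalence, \<open>D\<close> is exactly the set of vectors
  whose orbit has a right derivative at 0. Negative times and the values of \<open>G\<close> outside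
  of \<open>D\<close> are arbitrary.\<close>

locale c0_semigroup =
  fixes T :: "real \<Rightarrow> 'e::banach \<Rightarrow> 'e" and D :: "'e set" and G :: "'e \<Rightarrow> 'e"
  assumes bounded_linear_T: "\<And>t. 0 \<le> t \<Longrightarrow> bounded_linear (T t)"
    and T_0 [simp]: "T 0 x = x"
    and T_add: "\<And>s t. 0 \<le> s \<Longrightarrow> 0 \<le> t \<Longrightarrow> T (s + t) x = T s (T t x)"
    and right_continuous: "((\<lambda>t. T t x) \<longlongrightarrow> x) (at_right 0)"
    and generator: "((\<lambda>t. T t x) has_vector_derivative y) (at 0 within {0..}) \<longleftrightarrow> x \<in> D \<and> y = G x"
begin

lemmas T_linear_simps = bounded_linear.linear[OF bounded_linear_T, THEN linear_add]
  bounded_linear.linear[OF bounded_linear_T, THEN linear_diff]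
  bounded_linear.linear[OF bounded_linear_T, THEN linear_scale]
  bounded_linear.linear[OF bounded_linear_T, THEN linear_0]

lemma domainI:
  assumes "((\<lambda>t. T t x) has_vector_derivative y) (at 0 within {0..})"
  shows "x \<in> D" "G x = y"
  using assms by (simp_all add: generator)

section \<open>Local boundedness and joint continuity\<close>

text \<open>Continuity at 0 puts every vector into some \<open>F k\<close>. By Baire's theorem one
  of these closed sets contains a ball, and linearity spreads the bound on the ball to all
  vectors.\<close>

lemma bounded_near_0: "\<exists>\<delta>>0. \<exists>C. \<forall>t\<in>{0..\<delta>}. \<forall>x. norm (T t x) \<le> C * norm x"
proof -
  \<comment> \<open>The index \<open>k\<close> shortens the time interval and raises the bound at
    once, so that a countable family suffices.\<close>
  define F where "F k = (\<Inter>t\<in>{0..inverse (real (Suc k))}. {x. norm (T t x) \<le> real k})" for k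
  have closed_F: "closed (F k)" for k
    unfolding F_def
    by (intro closed_INT ballI closed_Collect_le continuous_intros
        bounded_linear.continuous_on[OF bounded_linear_T]) auto
  have "\<exists>k. x \<in> F k" for x
  proof -
    have "eventually (\<lambda>t. norm (T t x) < norm x + 1) (at_right 0)"
      by (rule order_tendstoD[OF tendsto_norm[OF right_continuous]]) simp
    then obtain \<epsilon> where \<epsilon>: "\<epsilon> > 0" "\<And>t. 0 < t \<Longrightarrow> t < \<epsilon> \<Longrightarrow> norm (T t x) < norm x + 1"
      unfolding eventually_at_right_field by auto
    obtain k1 where k1: "inverse (real (Suc k1)) < \<epsilon>" using reals_Archimedean[OF \<epsilon>(1)] by blast
    obtain k2 where k2: "norm x + 1 \<le> real k2" using real_arch_simple by blast
    define k where "k = max k1 k2"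
    have "inverse (real (Suc k)) \<le> inverse (real (Suc k1))"
      unfolding k_def by (intro le_imp_inverse_le) auto
    then have "norm (T t x) \<le> real k" if "0 \<le> t" "t \<le> inverse (real (Suc k))" for t
    proof (cases "t = 0")
      case True
      then show ?thesis using k2 by (simp add: k_def)
    next
      case False
      then have "norm (T t x) < norm x + 1"
        using that k1 \<open>inverse (real (Suc k)) \<le> inverse (real (Suc k1))\<close> by (intro \<epsilon>(2)) linarith+
      then show ?thesis using k2 by (simp add: k_def)
    qed
    then have "x \<in> F k" unfolding F_def by auto
    then show ?thesis ..
  qed
  then have union: "\<Union>(range F) = UNIV" by blast
  have "\<exists>k. interior (F k) \<noteq> {}"
  proof (rule ccontr)
    assume *: "\<not> (\<exists>k. interior (F k) \<noteq> {})"
    have "euclidean interior_of \<Union>(range F) = {}"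
      using * closed_F by (intro Baire_category_alt) (auto simp: completely_metrizable_space_euclidean)
    then show False by (simp add: union)
  qed
  then obtain k x0 r where r: "r > 0" "ball x0 r \<subseteq> F k"
    by (meson ex_in_conv mem_interior)
  \<comment> \<open>The vector \<open>z\<close> below has norm \<open>r / 2\<close> and is the
    difference of two points of \<open>F k\<close>, which costs \<open>2 * k\<close>; the ratio is
    \<open>4 * k / r\<close>.\<close>
  have "norm (T t y) \<le> 4 * real k / r * norm y" if t: "t \<in> {0..inverse (real (Suc k))}" for t y
  proof (cases "y = 0")
    case True
    then show ?thesis using t by (simp add: T_linear_simps)
  next
    case False
    define z where "z = (r / 2 / norm y) *\<^sub>R y"
    have "norm z = r / 2" using False r(1) by (simp add: z_def)
    then have "x0 + z \<in> ball x0 r" "x0 \<in> ball x0 r" using r(1) by (auto simp: dist_norm)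
    then have "x0 + z \<in> F k" "x0 \<in> F k" using r(2) by blast+
    then have "norm (T t (x0 + z)) \<le> real k" "norm (T t x0) \<le> real k"
      using t unfolding F_def by auto
    moreover have "norm (T t z) \<le> norm (T t (x0 + z)) + norm (T t x0)"
      using t norm_triangle_ineq4[of "T t (x0 + z)" "T t x0"] by (simp add: T_linear_simps)
    ultimately have "norm (T t z) \<le> 2 * real k" by simp
    moreover have "norm (T t z) = r / 2 / norm y * norm (T t y)"
      using t r(1) by (simp add: z_def T_linear_simps)
    ultimately show ?thesis using False r(1) by (simp add: field_simps)
  qed
  then show ?thesis by (metis inverse_positive_iff_positive of_nat_0_less_iff zero_less_Suc)
qed

lemma locally_bounded: "\<exists>C. \<forall>t\<in>{0..\<tau>}. \<forall>x. norm (T t x) \<le> C * norm x"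
proof -
  obtain \<delta> C0 where \<delta>: "\<delta> > 0" "\<And>t x. t \<in> {0..\<delta>} \<Longrightarrow> norm (T t x) \<le> C0 * norm x"
    using bounded_near_0 by metis
  \<comment> \<open>At least 1, so that the bounds \<open>C ^ n\<close> for \<open>n\<close> steps
    of length \<open>\<delta>\<close> increase with \<open>n\<close>.\<close>
  define C where "C = max C0 1"
  have C: "norm (T t x) \<le> C * norm x" if "t \<in> {0..\<delta>}" for t x
    using \<delta>(2)[OF that, of x] by (rule order_trans) (simp add: C_def mult_right_mono)
  have C1: "C \<ge> 1" by (simp add: C_def)
  have step: "\<forall>t\<in>{0..real n * \<delta>}. \<forall>x. norm (T t x) \<le> C ^ n * norm x" for n
  proof (induction n)
    case 0
    then show ?case by simp
  next
    case (Suc n)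
    have "norm (T t x) \<le> C ^ Suc n * norm x" if t: "0 \<le> t" "t \<le> real (Suc n) * \<delta>" for t x
    proof (cases "t \<le> \<delta>")
      case True
      have "norm (T t x) \<le> C * norm x" using C True t by simp
      also have "\<dots> \<le> C ^ Suc n * norm x"
        using C1 by (intro mult_right_mono) (simp_all add: one_le_power)
      finally show ?thesis .
    next
      case False
      then have "t - \<delta> \<in> {0..real n * \<delta>}" using t by (simp add: algebra_simps)
      then have "norm (T (t - \<delta>) x) \<le> C ^ n * norm x" using Suc by blast
      moreover have "T t x = T \<delta> (T (t - \<delta>) x)"
        using False \<delta>(1) T_add[of \<delta> "t - \<delta>" x] by simp
      moreover have "norm (T \<delta> (T (t - \<delta>) x)) \<le> C * norm (T (t - \<delta>) x)"
        using C \<delta>(1) by simp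
      moreover have "C * norm (T (t - \<delta>) x) \<le> C * (C ^ n * norm x)"
        using Suc t False C1 \<open>norm (T (t - \<delta>) x) \<le> C ^ n * norm x\<close> by (intro mult_left_mono) auto
      ultimately show ?thesis by (simp add: mult.assoc)
    qed
    then show ?case by auto
  qed
  obtain n where "\<tau> / \<delta> \<le> real n" using real_arch_simple by blast
  then have "\<tau> \<le> real n * \<delta>" using \<delta>(1) by (simp add: field_simps)
  then show ?thesis using step[of n] by (intro exI[of _ "C ^ n"]) auto
qed

lemma continuous_at_0:
  assumes "(f \<longlongrightarrow> 0) F" "eventually (\<lambda>s. 0 \<le> f s) F"
  shows "((\<lambda>s. T (f s) x) \<longlongrightarrow> x) F"
proof (rule tendstoI)
  fix e :: real assume "e > 0"
  then have "eventually (\<lambda>t. dist (T t x) x < e) (at_right 0)"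
    by (rule tendstoD[OF right_continuous])
  then obtain \<delta> where \<delta>: "\<delta> > 0" "\<And>t. 0 < t \<Longrightarrow> t < \<delta> \<Longrightarrow> dist (T t x) x < e"
    unfolding eventually_at_right_field by auto
  have "eventually (\<lambda>s. f s < \<delta>) F" using order_tendstoD(2)[OF assms(1) \<delta>(1)] .
  with assms(2) show "eventually (\<lambda>s. dist (T (f s) x) x < e) F"
  proof eventually_elim
    case (elim s)
    then show ?case using \<delta>(2)[of "f s"] \<open>e > 0\<close> by (cases "f s = 0") auto
  qed
qed

text \<open>The smaller of the two times is factored out, so continuity from the right at 0 controls
  both directions.\<close>

lemma T_diff_bound:
  assumes C: "\<forall>t\<in>{0..\<tau>}. \<forall>x. norm (T t x) \<le> C * norm x" and "s \<in> {0..\<tau>}" "r \<in> {0..\<tau>}"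
  shows "norm (T s x - T r x) \<le> C * norm (T \<bar>s - r\<bar> x - x)"
proof -
  have *: "norm (T s x - T r x) \<le> C * norm (T (s - r) x - x)" if "r \<le> s" "s \<in> {0..\<tau>}" "r \<in> {0..\<tau>}" for s r
  proof -
    have "T s x - T r x = T r (T (s - r) x - x)"
      using that T_add[of r "s - r" x] by (simp add: T_linear_simps)
    then show ?thesis using C that by simp
  qed
  show ?thesis
    using *[of r s] *[of s r] assms(2,3) by (cases "r \<le> s") (auto simp: norm_minus_commute)
qed

text \<open>Time and vector vary together, as product rules for orbits require: local boundedness
  absorbs the error in the vector, \<open>T_diff_bound\<close> the error in time.\<close>

lemma tendsto_T:
  assumes f: "(f \<longlongrightarrow> r) F" "eventually (\<lambda>s. 0 \<le> f s) F" "0 \<le> r" and g: "(g \<longlongrightarrow> z) F"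
  shows "((\<lambda>s. T (f s) (g s)) \<longlongrightarrow> T r z) F"
proof -
  obtain C where C: "\<forall>t\<in>{0..r + 1}. \<forall>x. norm (T t x) \<le> C * norm x"
    using locally_bounded by blast
  have "((\<lambda>s. T (f s) (g s) - T r z) \<longlongrightarrow> 0) F"
  proof (rule Lim_null_comparison)
    have "eventually (\<lambda>s. f s < r + 1) F" using order_tendstoD(2)[OF f(1)] by simp
    with f(2) show "eventually (\<lambda>s. norm (T (f s) (g s) - T r z) \<le>
        C * norm (g s - z) + C * norm (T \<bar>f s - r\<bar> z - z)) F"
    proof eventually_elim
      case (elim s)
      have "T (f s) (g s) - T r z = T (f s) (g s - z) + (T (f s) z - T r z)"
        using elim by (simp add: T_linear_simps)
      then have "norm (T (f s) (g s) - T r z) \<le> norm (T (f s) (g s - z)) + norm (T (f s) z - T r z)"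
        by (simp only: norm_triangle_ineq)
      then show ?case
        using C[rule_format, of "f s" "g s - z"] elim T_diff_bound[OF C, of "f s" r z] f(3) by simp
    qed
    have "((\<lambda>s. \<bar>f s - r\<bar>) \<longlongrightarrow> 0) F"
      using tendsto_rabs_zero[OF LIM_zero[OF f(1)]] .
    then have "((\<lambda>s. T \<bar>f s - r\<bar> z) \<longlongrightarrow> z) F" by (rule continuous_at_0) simp
    then have "((\<lambda>s. C * norm (g s - z) + C * norm (T \<bar>f s - r\<bar> z - z)) \<longlongrightarrow>
        C * norm (z - z) + C * norm (z - z)) F"
      by (intro tendsto_intros g)
    then show "((\<lambda>s. C * norm (g s - z) + C * norm (T \<bar>f s - r\<bar> z - z)) \<longlongrightarrow> 0) F" by simp
  qed
  then show ?thesis by (rule LIM_zero_cancel)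
qed

lemma continuous_on_orbit: "continuous_on {0..} (\<lambda>t. T t x)"
  unfolding continuous_on_def
  by (auto intro!: tendsto_T tendsto_ident_at tendsto_const simp: eventually_at_filter)

section \<open>Orbits and their generator\<close>

lemma orbit_in_domain:
  assumes "x \<in> D" "0 \<le> t"
  shows "T t x \<in> D" "G (T t x) = T t (G x)"
proof -
  have "((\<lambda>h. T h x) has_vector_derivative G x) (at 0 within {0..})"
    using assms(1) generator by blast
  then have "((\<lambda>h. T t (T h x)) has_vector_derivative T t (G x)) (at 0 within {0..})"
    by (rule bounded_linear.has_vector_derivative[OF bounded_linear_T[OF assms(2)]])
  then have "((\<lambda>h. T h (T t x)) has_vector_derivative T t (G x)) (at 0 within {0..})"
    by (rule has_vector_derivative_transform[rotated 2])
       (use assms(2) in \<open>auto simp: T_add[symmetric] add.commute\<close>)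
  then show "T t x \<in> D" "G (T t x) = T t (G x)" using domainI by blast+
qed

text \<open>Left and right quotients are both \<open>T (min s t) (q \<bar>s - t\<bar>)\<close>,
  where \<open>q\<close> is the quotient at 0. Joint continuity then settles both sides
  together.\<close>

lemma orbit_derivative:
  assumes "x \<in> D" "0 \<le> t"
  shows "((\<lambda>t. T t x) has_vector_derivative T t (G x)) (at t within {0..})"
proof -
  define q where "q h = inverse h *\<^sub>R (T h x - x)" for h
  have q: "(q \<longlongrightarrow> G x) (at 0 within {0..})"
    using generator[of x "G x"] assms(1) unfolding has_vector_derivative_iff_quotient q_def by simp
  have "filterlim (\<lambda>s. \<bar>s - t\<bar>) (at 0 within {0..}) (at t within {0..})"
    unfolding filterlim_at
    by (auto simp: eventually_at_filter intro!: tendsto_eq_intros)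
  then have "((\<lambda>s. q \<bar>s - t\<bar>) \<longlongrightarrow> G x) (at t within {0..})"
    by (rule filterlim_compose[OF q])
  then have "((\<lambda>s. T (min s t) (q \<bar>s - t\<bar>)) \<longlongrightarrow> T t (G x)) (at t within {0..})"
    using assms(2) by (intro tendsto_T) (auto simp: eventually_at_filter intro!: tendsto_eq_intros)
  moreover have "eventually (\<lambda>s. T (min s t) (q \<bar>s - t\<bar>) = inverse (s - t) *\<^sub>R (T s x - T t x)) (at t within {0..})"
    unfolding eventually_at_filter
  proof (rule always_eventually, safe)
    fix s :: real assume s: "s \<ge> 0"
    show "T (min s t) (q \<bar>s - t\<bar>) = inverse (s - t) *\<^sub>R (T s x - T t x)"
    proof (cases "t \<le> s")
      case True
      then show ?thesis
        using assms(2) T_add[of t "s - t" x] by (simp add: q_def T_linear_simps)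
    next
      case False
      then have "T s (q (t - s)) = inverse (t - s) *\<^sub>R (T t x - T s x)"
        using s T_add[of s "t - s" x] by (simp add: q_def T_linear_simps)
      also have "\<dots> = inverse (s - t) *\<^sub>R (T s x - T t x)"
        by (metis inverse_minus_eq minus_diff_eq scaleR_left.minus scaleR_right.minus minus_minus)
      finally show ?thesis using False by (simp add: min_def)
    qed
  qed
  ultimately show ?thesis
    unfolding has_vector_derivative_iff_quotient by (simp add: tendsto_cong)
qed

lemma domain_add: "x \<in> D \<Longrightarrow> y \<in> D \<Longrightarrow> x + y \<in> D \<and> G (x + y) = G x + G y"
proof -
  assume "x \<in> D" "y \<in> D"
  then have "((\<lambda>t. T t x + T t y) has_vector_derivative G x + G y) (at 0 within {0..})"
    by (intro has_vector_derivative_add) (simp_all add: generator)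
  then have "((\<lambda>t. T t (x + y)) has_vector_derivative G x + G y) (at 0 within {0..})"
    by (rule has_vector_derivative_transform[rotated 2]) (auto simp: T_linear_simps)
  then show ?thesis using domainI by blast
qed

lemma domain_scale: "x \<in> D \<Longrightarrow> c *\<^sub>R x \<in> D \<and> G (c *\<^sub>R x) = c *\<^sub>R G x"
proof -
  assume "x \<in> D"
  then have "((\<lambda>t. c *\<^sub>R T t x) has_vector_derivative c *\<^sub>R G x) (at 0 within {0..})"
    by (intro bounded_linear.has_vector_derivative[OF bounded_linear_scaleR_right]) (simp_all add: generator)
  then have "((\<lambda>t. T t (c *\<^sub>R x)) has_vector_derivative c *\<^sub>R G x) (at 0 within {0..})"
    by (rule has_vector_derivative_transform[rotated 2]) (auto simp: T_linear_simps)
  then show ?thesis using domainI by blast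
qed

lemma domain_diff: "x \<in> D \<Longrightarrow> y \<in> D \<Longrightarrow> x - y \<in> D \<and> G (x - y) = G x - G y"
  using domain_add[of x "- 1 *\<^sub>R y"] domain_scale[of y "- 1"] by simp

lemma domain_0: "0 \<in> D \<and> G 0 = 0"
  using generator[of 0 0] has_vector_derivative_transform[OF _ _ has_vector_derivative_const, of 0 "{0..}" "\<lambda>t. T t 0" 0]
  by (auto simp: T_linear_simps)

text \<open>\<open>T h\<close> shifts the window of integration, so
  \<open>T h (\<Phi> t) = \<Phi> (t + h) - \<Phi> h\<close>, which is differentiable in
  \<open>h\<close> whatever \<open>x\<close> is. This is the source of surjectivity of the shifted
  generator.\<close>

lemma integral_in_domain:
  assumes "0 \<le> t"
  shows "integral {0..t} (\<lambda>s. T s x) \<in> D" "G (integral {0..t} (\<lambda>s. T s x)) = T t x - x"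
proof -
  define \<Phi> where "\<Phi> u = integral {0..u} (\<lambda>s. T s x)" for u
  have \<Phi>': "(\<Phi> has_vector_derivative T u x) (at u within {0..})" if "u \<ge> 0" for u
    unfolding \<Phi>_def by (rule integral_has_vector_derivative_atLeast[OF continuous_on_orbit that])
  have shift: "((\<lambda>s. \<Phi> (h + s)) has_vector_derivative T (h + u) x) (at u within {0..})"
    if "h \<ge> 0" "u \<ge> 0" for h u
  proof -
    have "(\<Phi> has_vector_derivative T (h + u) x) (at (h + u) within (\<lambda>s. h + s) ` {0..})"
      using that by (intro has_vector_derivative_within_subset[OF \<Phi>']) auto
    moreover have "((\<lambda>s. h + s) has_vector_derivative 1) (at u within {0..})"
      by (auto intro!: derivative_eq_intros)
    ultimately have "(\<Phi> \<circ> (\<lambda>s. h + s) has_vector_derivative 1 *\<^sub>R T (h + u) x) (at u within {0..})"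
      by (intro vector_diff_chain_within)
    then show ?thesis by (simp add: o_def)
  qed
  have eq: "T h (\<Phi> t) = \<Phi> (t + h) - \<Phi> h" if "h \<ge> 0" for h
  proof -
    have "((\<lambda>s. T (h + s) x) has_integral (\<Phi> (h + t) - \<Phi> (h + 0))) {0..t}"
      using assms that
      by (intro fundamental_theorem_of_calculus)
         (auto intro: has_vector_derivative_within_subset[OF shift])
    moreover have "((\<lambda>s. T s x) has_integral \<Phi> t) {0..t}"
      unfolding \<Phi>_def
      by (intro integrable_integral integrable_continuous_real continuous_on_subset[OF continuous_on_orbit]) auto
    then have "((\<lambda>s. T h (T s x)) has_integral T h (\<Phi> t)) {0..t}"
      using has_integral_linear[OF _ bounded_linear_T[OF that]] by (simp add: o_def)
    then have "((\<lambda>s. T (h + s) x) has_integral T h (\<Phi> t)) {0..t}"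
      by (rule has_integral_eq[rotated]) (use that in \<open>simp add: T_add\<close>)
    ultimately show ?thesis by (auto dest: has_integral_unique simp: add.commute)
  qed
  have "((\<lambda>h. \<Phi> (t + h) - \<Phi> h) has_vector_derivative T t x - T 0 x) (at 0 within {0..})"
    using shift[OF assms, of 0] \<Phi>'[of 0] by (intro has_vector_derivative_diff) auto
  then have "((\<lambda>h. T h (\<Phi> t)) has_vector_derivative T t x - x) (at 0 within {0..})"
    using has_vector_derivative_transform[of 0 "{0..}" "\<lambda>h. T h (\<Phi> t)"] eq by simp
  then show "integral {0..t} (\<lambda>s. T s x) \<in> D" "G (integral {0..t} (\<lambda>s. T s x)) = T t x - x"
    using domainI unfolding \<Phi>_def by blast+
qed

text \<open>The integrated identity, which expresses \<open>T t x - x\<close> by the orbit of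
  \<open>G x\<close>, survives the limit thanks to local boundedness; differentiating it at 0
  recovers the generator.\<close>

lemma generator_closed:
  assumes "\<And>m. x m \<in> D" "x \<longlonglongrightarrow> z" "(\<lambda>m. G (x m)) \<longlonglongrightarrow> y"
  shows "z \<in> D" "G z = y"
proof -
  have eq: "T t z = z + integral {0..t} (\<lambda>s. T s y)" if t: "t \<ge> 0" for t
  proof -
    obtain C where C: "\<forall>s\<in>{0..t}. \<forall>x. norm (T s x) \<le> C * norm x"
      using locally_bounded by blast
    have orbit: "continuous_on {0..t} (\<lambda>s. T s v)" for v
      by (rule continuous_on_subset[OF continuous_on_orbit]) auto
    have int: "T t (x m) - x m = integral {0..t} (\<lambda>s. T s (G (x m)))" for m
    proof -
      have "((\<lambda>s. T s (G (x m))) has_integral (T t (x m) - T 0 (x m))) {0..t}"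
        using t assms(1)[of m]
        by (intro fundamental_theorem_of_calculus)
           (auto intro: has_vector_derivative_within_subset[OF orbit_derivative])
      then show ?thesis by (simp add: integral_unique)
    qed
    have "(\<lambda>m. integral {0..t} (\<lambda>s. T s (G (x m))) - integral {0..t} (\<lambda>s. T s y)) \<longlonglongrightarrow> 0"
    proof (rule Lim_null_comparison[OF always_eventually])
      show "\<forall>m. norm (integral {0..t} (\<lambda>s. T s (G (x m))) - integral {0..t} (\<lambda>s. T s y))
          \<le> C * norm (G (x m) - y) * (t - 0)"
      proof
        fix m
        have "integral {0..t} (\<lambda>s. T s (G (x m))) - integral {0..t} (\<lambda>s. T s y)
            = integral {0..t} (\<lambda>s. T s (G (x m) - y))"
          using integral_diff[OF integrable_continuous_real[OF orbit] integrable_continuous_real[OF orbit]]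
          by (subst Henstock_Kurzweil_Integration.integral_cong[where g = "\<lambda>s. T s (G (x m)) - T s y"])
             (auto simp: T_linear_simps)
        then show "norm (integral {0..t} (\<lambda>s. T s (G (x m))) - integral {0..t} (\<lambda>s. T s y))
            \<le> C * norm (G (x m) - y) * (t - 0)"
          using C t integral_bound[OF t orbit, of "G (x m) - y" "C * norm (G (x m) - y)"] by simp
      qed
      have "(\<lambda>m. C * norm (G (x m) - y) * (t - 0)) \<longlonglongrightarrow> C * norm (y - y) * (t - 0)"
        by (intro tendsto_intros assms)
      then show "(\<lambda>m. C * norm (G (x m) - y) * (t - 0)) \<longlonglongrightarrow> 0" by simp
    qed
    then have "(\<lambda>m. T t (x m) - x m) \<longlonglongrightarrow> integral {0..t} (\<lambda>s. T s y)"
      unfolding int by (rule LIM_zero_cancel)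
    moreover have "(\<lambda>m. T t (x m) - x m) \<longlonglongrightarrow> T t z - z"
      by (intro tendsto_diff assms bounded_linear.tendsto[OF bounded_linear_T[OF t]])
    ultimately have "integral {0..t} (\<lambda>s. T s y) = T t z - z" by (rule LIMSEQ_unique)
    then show ?thesis by simp
  qed
  have "((\<lambda>t. z + integral {0..t} (\<lambda>s. T s y)) has_vector_derivative 0 + T 0 y) (at 0 within {0..})"
    by (intro has_vector_derivative_add has_vector_derivative_const
        integral_has_vector_derivative_atLeast continuous_on_orbit) simp
  then have "((\<lambda>t. T t z) has_vector_derivative y) (at 0 within {0..})"
    using has_vector_derivative_transform[of 0 "{0..}" "\<lambda>t. T t z"] eq by simp
  then show "z \<in> D" "G z = y" using domainI by blast+
qed

text \<open>For a classical solution \<open>y\<close>, the function \<open>s \<mapsto> T (t - s) (y s)\<close> is constant.\<close>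

lemma classical_solution_unique:
  assumes y: "\<And>s. 0 \<le> s \<Longrightarrow> y s \<in> D"
    "\<And>s. 0 \<le> s \<Longrightarrow> (y has_vector_derivative G (y s)) (at s within {0..})"
    and t: "0 \<le> t"
  shows "y t = T t (y 0)"
proof -
  have "((\<lambda>s. T (t - s) (y s)) has_vector_derivative 0) (at s within {0..t})" if s: "s \<in> {0..t}" for s
  proof -
    have q: "((\<lambda>r. inverse (r - s) *\<^sub>R (y r - y s)) \<longlongrightarrow> G (y s)) (at s within {0..t})"
      using has_vector_derivative_within_subset[OF y(2), of s "{0..t}"] s
      unfolding has_vector_derivative_iff_quotient by auto
    \<comment> \<open>The increment of \<open>y\<close> is taken under the moving operator
      \<open>T (t - r)\<close>; its limit cancels that of the increment in time, computed
      next.\<close>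
    have 1: "((\<lambda>r. T (t - r) (inverse (r - s) *\<^sub>R (y r - y s))) \<longlongrightarrow> T (t - s) (G (y s))) (at s within {0..t})"
      using s by (intro tendsto_T q tendsto_intros) (auto simp: eventually_at_filter)
    have "((\<lambda>r. T r (y s)) has_vector_derivative T (t - s) (G (y s))) (at (t - s) within (\<lambda>r. t - r) ` {0..t})"
      using s by (intro has_vector_derivative_within_subset[OF orbit_derivative] y) auto
    moreover have "((\<lambda>r. t - r) has_vector_derivative - 1) (at s within {0..t})"
      by (auto intro!: derivative_eq_intros)
    ultimately have "((\<lambda>r. T r (y s)) \<circ> (\<lambda>r. t - r) has_vector_derivative - 1 *\<^sub>R T (t - s) (G (y s))) (at s within {0..t})"
      by (intro vector_diff_chain_within)
    then have 2: "((\<lambda>r. inverse (r - s) *\<^sub>R (T (t - r) (y s) - T (t - s) (y s))) \<longlongrightarrow> - T (t - s) (G (y s))) (at s within {0..t})"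
      unfolding has_vector_derivative_iff_quotient by (simp add: o_def)
    have "((\<lambda>r. T (t - r) (inverse (r - s) *\<^sub>R (y r - y s))
          + inverse (r - s) *\<^sub>R (T (t - r) (y s) - T (t - s) (y s))) \<longlongrightarrow> 0) (at s within {0..t})"
      using tendsto_add[OF 1 2] by simp
    then show ?thesis
      unfolding has_vector_derivative_iff_quotient
      by (rule Lim_transform_eventually)
         (auto simp: eventually_at_filter T_linear_simps algebra_simps)
  qed
  then obtain c where "\<And>s. s \<in> {0..t} \<Longrightarrow> T (t - s) (y s) = c"
    using has_vector_derivative_zero_constant[of "{0..t}" "\<lambda>s. T (t - s) (y s)"] by auto
  from this[of 0] this[of t] show ?thesis using t by simp
qed

section \<open>Rescaling and invertibility of the shifted generator\<close>

text \<open>Multiplying orbits by \<open>exp (- \<mu> * t)\<close> shifts the generator by the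
  product rule. The domain stays the same because multiplying back by \<open>exp (\<mu> * t)\<close>
  restores the original orbit.\<close>

lemma scaled: "c0_semigroup (\<lambda>t x. exp (- \<mu> * t) *\<^sub>R T t x) D (\<lambda>x. G x - \<mu> *\<^sub>R x)"
proof (rule c0_semigroup.intro)
  fix x y
  show "((\<lambda>t. exp (- \<mu> * t) *\<^sub>R T t x) has_vector_derivative y) (at 0 within {0..}) \<longleftrightarrow>
      x \<in> D \<and> y = G x - \<mu> *\<^sub>R x"
  proof
    assume l: "((\<lambda>t. exp (- \<mu> * t) *\<^sub>R T t x) has_vector_derivative y) (at 0 within {0..})"
    have "((\<lambda>t. exp (\<mu> * t) *\<^sub>R exp (- \<mu> * t) *\<^sub>R T t x) has_vector_derivative
        exp (\<mu> * 0) *\<^sub>R y + \<mu> *\<^sub>R exp (- \<mu> * 0) *\<^sub>R T 0 x) (at 0 within {0..})"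
      by (intro has_vector_derivative_scaleR l) (auto intro!: derivative_eq_intros)
    then have "((\<lambda>t. T t x) has_vector_derivative y + \<mu> *\<^sub>R x) (at 0 within {0..})"
      by (simp flip: exp_add)
    then show "x \<in> D \<and> y = G x - \<mu> *\<^sub>R x" unfolding generator by (auto simp: algebra_simps)
  next
    assume r: "x \<in> D \<and> y = G x - \<mu> *\<^sub>R x"
    then have l: "((\<lambda>t. T t x) has_vector_derivative G x) (at 0 within {0..})"
      by (simp add: generator)
    have "((\<lambda>t. exp (- \<mu> * t) *\<^sub>R T t x) has_vector_derivative
        exp (- \<mu> * 0) *\<^sub>R G x + (- \<mu>) *\<^sub>R T 0 x) (at 0 within {0..})"
      by (intro has_vector_derivative_scaleR l) (auto intro!: derivative_eq_intros)
    then show "((\<lambda>t. exp (- \<mu> * t) *\<^sub>R T t x) has_vector_derivative y) (at 0 within {0..})"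
      using r by simp
  qed
  have "((\<lambda>t. exp (- \<mu> * t) *\<^sub>R T t x) \<longlongrightarrow> exp (- \<mu> * 0) *\<^sub>R x) (at_right 0)"
    by (intro tendsto_intros right_continuous)
  then show "((\<lambda>t. exp (- \<mu> * t) *\<^sub>R T t x) \<longlongrightarrow> x) (at_right 0)" by simp
  show "exp (- \<mu> * (s + t)) *\<^sub>R T (s + t) x
      = exp (- \<mu> * s) *\<^sub>R T s (exp (- \<mu> * t) *\<^sub>R T t x)" if "0 \<le> s" "0 \<le> t" for s t
  proof -
    have "exp (- \<mu> * (s + t)) = exp (- \<mu> * s) * exp (- \<mu> * t)"
      by (simp add: algebra_simps flip: exp_add)
    then show ?thesis using that T_add[OF that, of x] by (simp only: T_linear_simps scaleR_scaleR)
  qed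
qed (simp_all add: bounded_linear_compose[OF bounded_linear_scaleR_right bounded_linear_T])

text \<open>In place of a Laplace transform, a single time \<open>t\<close> at which
  \<open>T t\<close> has norm at most 1/2 suffices. A vector in the kernel of \<open>G\<close> is
  fixed by \<open>T t\<close>, hence 0. Conversely, \<open>G\<close> maps the integral of the orbit
  of \<open>y\<close> to \<open>T t y - y\<close>, and every \<open>v\<close> has this form by the
  contraction principle.\<close>

lemma generator_bij_of_decay:
  assumes decay: "\<And>t x. 0 \<le> t \<Longrightarrow> norm (T t x) \<le> M * exp (- \<delta> * t) * norm x" and "\<delta> > 0"
  shows "bij_betw G D UNIV"
proof -
  have "((\<lambda>t. M * exp (- \<delta> * t)) \<longlongrightarrow> M * 0) at_top"
    using \<open>\<delta> > 0\<close>
    by (intro tendsto_mult tendsto_const filterlim_compose[OF exp_at_bot])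
       (rule filterlim_tendsto_neg_mult_at_bot[OF tendsto_const _ filterlim_ident], simp)
  then have "eventually (\<lambda>t. M * exp (- \<delta> * t) < 1 / 2) at_top"
    by (rule order_tendstoD) simp
  then obtain t0 where "\<And>t. t \<ge> t0 \<Longrightarrow> M * exp (- \<delta> * t) < 1 / 2"
    by (auto simp: eventually_at_top_linorder)
  then obtain t where t: "t \<ge> 0" "M * exp (- \<delta> * t) < 1 / 2"
    by (metis max.cobounded1 max.cobounded2)
  have half: "norm (T t x) \<le> 1 / 2 * norm x" for x
    using decay[OF t(1), of x] mult_right_mono[of "M * exp (- \<delta> * t)" "1 / 2" "norm x"] t(2) by simp
  have "inj_on G D"
  proof (rule inj_onI)
    fix x x' assume "x \<in> D" "x' \<in> D" "G x = G x'"
    then have "x - x' \<in> D" "G (x - x') = 0" using domain_diff by auto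
    then have "T t (x - x') = x - x'"
      using classical_solution_unique[of "\<lambda>_. x - x'" t] t(1) by simp
    then show "x = x'" using half[of "x - x'"] by simp
  qed
  moreover have "\<exists>x\<in>D. G x = v" for v
  proof -
    have "dist (T t y - v) (T t y' - v) \<le> 1 / 2 * dist y y'" for y y'
      using half[of "y - y'"] t(1) by (simp add: dist_norm T_linear_simps)
    then obtain y where "T t y - v = y"
      using banach_fix_type[of "1 / 2" "\<lambda>y. T t y - v"] by auto
    then have "T t y - y = v" by (simp add: algebra_simps)
    then show ?thesis using integral_in_domain[OF t(1), of y] by blast
  qed
  ultimately show ?thesis by (auto simp: bij_betw_def image_iff) metis
qed

lemma generator_shift_bij:
  assumes growth: "\<And>t x. 0 \<le> t \<Longrightarrow> norm (T t x) \<le> M * exp (\<omega> * t) * norm x" and "\<omega> < \<mu>"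
  shows "bij_betw (\<lambda>x. G x - \<mu> *\<^sub>R x) D UNIV"
proof (rule c0_semigroup.generator_bij_of_decay[OF scaled])
  fix t x assume "0 \<le> (t::real)"
  then have "norm (exp (- \<mu> * t) *\<^sub>R T t x) \<le> exp (- \<mu> * t) * (M * exp (\<omega> * t) * norm x)"
    using growth[of t x] by (simp add: mult_left_mono)
  also have "\<dots> = M * exp (- (\<mu> - \<omega>) * t) * norm x"
    by (simp add: algebra_simps exp_diff exp_minus exp_add divide_simps)
  finally show "norm (exp (- \<mu> * t) *\<^sub>R T t x) \<le> M * exp (- (\<mu> - \<omega>) * t) * norm x" .
qed (use assms in simp)

end

text \<open>An orbit of \<open>T\<close> that starts in \<open>D\<close> is a classical solution for
  \<open>T'\<close>; density of \<open>D\<close> and boundedness do the rest. This later identifies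
  the semigroup hidden behind the choice operator.\<close>

lemma c0_semigroup_unique:
  assumes "c0_semigroup T D G" "c0_semigroup T' D G"
    and dense: "\<And>x. \<exists>d. (\<forall>m. d m \<in> D) \<and> d \<longlonglongrightarrow> x" and "0 \<le> t"
  shows "T t x = T' t x"
proof -
  interpret T: c0_semigroup T D G by fact
  interpret T': c0_semigroup T' D G by fact
  obtain d where d: "\<And>m. d m \<in> D" "d \<longlonglongrightarrow> x" using dense by metis
  have "T t (d m) = T' t (d m)" for m
    using T'.classical_solution_unique[of "\<lambda>t. T t (d m)" t] d(1) \<open>0 \<le> t\<close>
      T.orbit_derivative T.orbit_in_domain by simp
  then have "(\<lambda>m. T t (d m)) \<longlonglongrightarrow> T' t x"
    using bounded_linear.tendsto[OF T'.bounded_linear_T[OF \<open>0 \<le> t\<close>] d(2)] by simp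
  moreover have "(\<lambda>m. T t (d m)) \<longlonglongrightarrow> T t x"
    by (rule bounded_linear.tendsto[OF T.bounded_linear_T[OF \<open>0 \<le> t\<close>] d(2)])
  ultimately show ?thesis by (rule LIMSEQ_unique[symmetric])
qed

section \<open>Powers of the shifted generator and smoothing\<close>

text \<open>The domain of \<open>H ^^ n\<close>: since \<open>H\<close> is a total function, the
  requirement that all intermediate values lie in \<open>D\<close> has to be recorded
  separately.\<close>

primrec iterated_domain :: "'e set \<Rightarrow> ('e \<Rightarrow> 'e) \<Rightarrow> nat \<Rightarrow> 'e set" where
  "iterated_domain D H 0 = UNIV"
| "iterated_domain D H (Suc n) = {x \<in> D. H x \<in> iterated_domain D H n}"

text \<open>The recursion strips the innermost application of \<open>H\<close>; the derivative of
  \<open>H ^^ n\<close> along an orbit needs the outermost one.\<close>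

lemma iterated_domain_Suc_iff:
  "x \<in> iterated_domain D H (Suc n) \<longleftrightarrow> x \<in> iterated_domain D H n \<and> (H ^^ n) x \<in> D"
proof (induction n arbitrary: x)
  case (Suc n)
  have "x \<in> iterated_domain D H (Suc (Suc n)) \<longleftrightarrow> x \<in> D \<and> H x \<in> iterated_domain D H (Suc n)"
    by simp
  then show ?case unfolding Suc[of "H x"] by (auto simp: funpow_swap1)
qed simp

lemma iterated_surj:
  assumes "bij_betw H D UNIV"
  shows "\<exists>x\<in>iterated_domain D H n. (H ^^ n) x = y"
proof (induction n)
  case (Suc n)
  then obtain x where x: "x \<in> iterated_domain D H n" "(H ^^ n) x = y" by blast
  obtain z where "z \<in> D" "H z = x" using assms by (metis bij_betw_def UNIV_I imageE)
  with x show ?case by (intro bexI[of _ z]) (auto simp: funpow_swap1)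
qed simp

text \<open>What is kept of analyticity: for each positive time \<open>G \<circ> T t\<close> is
  everywhere defined and bounded, with no rate prescribed as \<open>t\<close> tends to 0.\<close>

locale smoothing_semigroup = c0_semigroup +
  assumes smoothing: "\<And>t x. 0 < t \<Longrightarrow> T t x \<in> D"
    and smoothing_bounded: "\<And>t. 0 < t \<Longrightarrow> \<exists>C. \<forall>x. norm (G (T t x)) \<le> C * norm x"
begin

context
  fixes \<mu> :: real and H
  defines "H \<equiv> \<lambda>x. G x - \<mu> *\<^sub>R x"
begin

lemma iterated_domain_invariant:
  assumes "0 \<le> t" "x \<in> iterated_domain D H n"
  shows "T t x \<in> iterated_domain D H n" "(H ^^ n) (T t x) = T t ((H ^^ n) x)"
proof -
  have H: "H (T t x) = T t (H x)" if "x \<in> D" for x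
    using that assms(1) by (simp add: H_def orbit_in_domain T_linear_simps)
  have "T t x \<in> iterated_domain D H n \<and> (H ^^ n) (T t x) = T t ((H ^^ n) x)"
    using assms(2)
    by (induction n arbitrary: x)
       (auto simp: H orbit_in_domain(1) assms(1) funpow_swap1 simp del: funpow.simps(2) simp: funpow_Suc_right)
  then show "T t x \<in> iterated_domain D H n" "(H ^^ n) (T t x) = T t ((H ^^ n) x)" by auto
qed

lemma bounded_linear_HT:
  assumes "0 < t"
  shows "bounded_linear (\<lambda>x. H (T t x))"
proof -
  obtain C where C: "\<And>x. norm (G (T t x)) \<le> C * norm x"
    using smoothing_bounded[OF assms] by blast
  have "bounded_linear (\<lambda>x. G (T t x))"
    by (rule bounded_linear_intro[of _ C])
       (use assms C in \<open>auto simp: T_linear_simps domain_add domain_scale smoothing mult.commute\<close>)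
  then show ?thesis
    unfolding H_def using assms
    by (intro bounded_linear_sub bounded_linear_compose[OF bounded_linear_scaleR_right] bounded_linear_T)
       auto
qed

text \<open>Half of the time pays for one factor:
  \<open>H (T t x) = T (t / 2) (H (T (t / 2) x))\<close>, where the inner map is bounded and the
  outer one falls to the induction hypothesis at time \<open>t / 2\<close>.\<close>

lemma iterated_smoothing:
  assumes "0 < t"
  shows "T t x \<in> iterated_domain D H n" "bounded_linear (\<lambda>x. (H ^^ n) (T t x))"
proof -
  have "(\<forall>x. T t x \<in> iterated_domain D H n) \<and> bounded_linear (\<lambda>x. (H ^^ n) (T t x))"
    using assms
  proof (induction n arbitrary: t)
    case 0
    then show ?case by (simp add: bounded_linear_T)
  next
    case (Suc n)
    have t2: "0 < t / 2" using Suc.prems by simp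
    have split: "T t x = T (t / 2) (T (t / 2) x)" for x
      using T_add[of "t / 2" "t / 2" x] Suc.prems by simp
    have H: "H (T t x) = T (t / 2) (H (T (t / 2) x))" for x
      unfolding split using orbit_in_domain[OF smoothing[OF t2], of "t / 2" x] t2
      by (simp add: H_def T_linear_simps)
    have "bounded_linear (\<lambda>x. (H ^^ n) (T (t / 2) (H (T (t / 2) x))))"
      by (rule bounded_linear_compose[OF Suc.IH[OF t2, THEN conjunct2] bounded_linear_HT[OF t2]])
    moreover have "T t x \<in> iterated_domain D H (Suc n)" for x
      using smoothing[OF Suc.prems] Suc.IH[OF t2] by (simp add: H)
    ultimately show ?case by (simp add: funpow_swap1 H)
  qed
  then show "T t x \<in> iterated_domain D H n" "bounded_linear (\<lambda>x. (H ^^ n) (T t x))" by auto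
qed

text \<open>The orbit is restarted at \<open>t / 2\<close>. There the iterate \<open>z\<close>
  already lies in the domain, and from then on the function is the orbit of \<open>z\<close> delayed
  by \<open>t / 2\<close>, which \<open>orbit_derivative\<close> covers.\<close>

lemma iterated_orbit_derivative:
  assumes "0 < t"
  shows "(H ^^ n) (T t g) \<in> D"
    "((\<lambda>t. (H ^^ n) (T t g)) has_vector_derivative G ((H ^^ n) (T t g))) (at t within {0<..})"
proof -
  show "(H ^^ n) (T t g) \<in> D"
    using iterated_smoothing(1)[OF assms, of g "Suc n"] unfolding iterated_domain_Suc_iff by simp
  define z where "z = (H ^^ n) (T (t / 2) g)"
  have z: "z \<in> D"
    using iterated_smoothing(1)[of "t / 2" g "Suc n"] assms
    unfolding z_def iterated_domain_Suc_iff by simp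
  have eq: "(H ^^ n) (T s g) = T (s - t / 2) z" if "s \<ge> t / 2" for s
    using iterated_domain_invariant(2)[of "s - t / 2" "T (t / 2) g" n] that assms
      iterated_smoothing(1)[of "t / 2" g n] T_add[of "s - t / 2" "t / 2" g]
    by (simp add: z_def)
  have "((\<lambda>s. T s z) has_vector_derivative G (T (t - t / 2) z)) (at (t - t / 2) within (\<lambda>s. s - t / 2) ` {t / 2<..})"
    using orbit_derivative[OF z, of "t - t / 2"] orbit_in_domain[OF z, of "t - t / 2"] assms
    by (auto intro: has_vector_derivative_within_subset)
  moreover have "((\<lambda>s. s - t / 2) has_vector_derivative 1) (at t within {t / 2<..})"
    by (auto intro!: derivative_eq_intros)
  ultimately have "((\<lambda>s. T s z) \<circ> (\<lambda>s. s - t / 2) has_vector_derivative 1 *\<^sub>R G (T (t - t / 2) z)) (at t within {t / 2<..})"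
    by (intro vector_diff_chain_within)
  then have "((\<lambda>s. T (s - t / 2) z) has_vector_derivative G ((H ^^ n) (T t g))) (at t within {t / 2<..})"
    using eq[of t] assms by (simp add: o_def)
  then have "((\<lambda>s. (H ^^ n) (T s g)) has_vector_derivative G ((H ^^ n) (T t g))) (at t within {t / 2<..})"
    by (rule has_vector_derivative_transform[rotated 2]) (use assms eq in auto)
  moreover have "at t within {t / 2<..} = at t within {0<..}"
    by (rule at_within_nhd[of _ "{t / 2<..}"]) (use assms in auto)
  ultimately show "((\<lambda>t. (H ^^ n) (T t g)) has_vector_derivative G ((H ^^ n) (T t g))) (at t within {0<..})"
    by simp
qed

text \<open>The derivative is built from functions of the same kind, because
  \<open>G \<circ> H ^^ n\<close> is \<open>H ^^ Suc n\<close> plus \<open>\<mu>\<close> times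
  \<open>H ^^ n\<close>; its continuity is differentiability one power higher.\<close>

lemma continuous_on_iterated_orbit:
  "continuous_on {0<..} (\<lambda>t. (H ^^ n) (T t g))"
  "continuous_on {0<..} (\<lambda>t. G ((H ^^ n) (T t g)))"
proof -
  show *: "continuous_on {0<..} (\<lambda>t. (H ^^ n) (T t g))" for n
    unfolding continuous_on_eq_continuous_within
    using has_vector_derivative_continuous[OF iterated_orbit_derivative(2)] by auto
  have "G ((H ^^ n) x) = (H ^^ Suc n) x + \<mu> *\<^sub>R (H ^^ n) x" for x
    by (simp add: H_def)
  then show "continuous_on {0<..} (\<lambda>t. G ((H ^^ n) (T t g)))"
    by (simp only:) (intro continuous_on_add continuous_on_scaleR continuous_on_const *)
qed

text \<open>Evaluating the orbit of \<open>x\<close> at small positive times approximates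
  \<open>x\<close>. For \<open>n = 1\<close> this is density of the domain itself.\<close>

lemma iterated_domain_dense: "\<exists>d. (\<forall>m. d m \<in> iterated_domain D H n) \<and> d \<longlonglongrightarrow> x"
proof (intro exI conjI allI)
  show "T (inverse (real (Suc m))) x \<in> iterated_domain D H n" for m
    by (rule iterated_smoothing) simp
  show "(\<lambda>m. T (inverse (real (Suc m))) x) \<longlonglongrightarrow> x"
    by (rule continuous_at_0[OF LIMSEQ_inverse_real_of_nat]) simp
qed

end

end


section \<open>The fragmentation semigroup\<close>

text \<open>Needed because \<open>S\<close> is built before its generator is known. The right
  derivative at 0, wherever it exists, is unique since the filter is proper, and so defines
  one.\<close>

lemma c0_semigroup_exists_generator:
  fixes T :: "real \<Rightarrow> 'e::banach \<Rightarrow> 'e"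
  assumes "\<And>t. 0 \<le> t \<Longrightarrow> bounded_linear (T t)" "\<And>x. T 0 x = x"
    "\<And>s t x. 0 \<le> s \<Longrightarrow> 0 \<le> t \<Longrightarrow> T (s + t) x = T s (T t x)"
    "\<And>x. ((\<lambda>t. T t x) \<longlongrightarrow> x) (at_right 0)"
  shows "\<exists>D G. c0_semigroup T D G"
proof (intro exI)
  let ?F = "at (0::real) within {0..}"
  have bot: "?F \<noteq> bot"
    by (simp add: at_within_Ici_at_right)
  show "c0_semigroup T {x. (\<lambda>t. T t x) differentiable ?F} (\<lambda>x. vector_derivative (\<lambda>t. T t x) ?F)"
  proof (rule c0_semigroup.intro; (fact assms)?)
    fix x y
    show "((\<lambda>t. T t x) has_vector_derivative y) ?F \<longleftrightarrow>
        x \<in> {x. (\<lambda>t. T t x) differentiable ?F} \<and> y = vector_derivative (\<lambda>t. T t x) ?F"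
      using vector_derivative_within[OF bot] vector_derivative_works[of "\<lambda>t. T t x" ?F]
        differentiableI_vector by (metis mem_Collect_eq)
  qed
qed

text \<open>
  The weight is absorbed into the coefficients: \<open>\<alpha>\<close> are the fragmentation rates and \<open>\<beta> i j\<close> is
  the weighted share of fragments \<open>i\<close> of a particle \<open>j\<close>.
\<close>

locale fragmentation =
  fixes \<alpha> :: "nat \<Rightarrow> real" and \<beta> :: "nat \<Rightarrow> nat \<Rightarrow> real" and \<kappa> :: real
  assumes \<alpha>_nonneg: "0 \<le> \<alpha> i" and \<beta>_nonneg: "0 \<le> \<beta> i j" and \<beta>_zero: "j \<le> i \<Longrightarrow> \<beta> i j = 0"
    and \<kappa>: "0 \<le> \<kappa>" "\<kappa> < 1" and column_mass: "(\<Sum>i<j. \<beta> i j) \<le> \<kappa>"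
begin

section \<open>The gain and loss operators\<close>

definition gain_column :: "nat \<Rightarrow> ell1" where
  "gain_column j = (\<Sum>i<j. \<beta> i j *\<^sub>R unit i)"

definition gain :: "ell1 \<Rightarrow> ell1" where
  "gain = of_columns gain_column"

definition loss_domain :: "ell1 set" where
  "loss_domain = {x. summable (\<lambda>i. cmod (of_real (\<alpha> i) * coord x i))}"

text \<open>\<open>Ell1\<close> is unspecified on sequences that are not summable, so the value is
  meaningful on \<open>loss_domain\<close> only.\<close>

definition loss :: "ell1 \<Rightarrow> ell1" where
  "loss x = Ell1 (\<lambda>i. of_real (\<alpha> i) * coord x i)"

definition frag_gen :: "ell1 \<Rightarrow> ell1" where
  "frag_gen x = gain (loss x) - loss x"

lemma norm_gain_column: "norm (gain_column j) \<le> \<kappa>"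
  using column_mass[of j] \<beta>_nonneg by (simp add: gain_column_def norm_sum_unit)

lemma coord_gain_column: "coord (gain_column j) i = of_real (\<beta> i j)"
  using \<beta>_zero[of j i]
  by (simp add: gain_column_def coord_sum coord_unit scaleR_conv_of_real if_distrib[of "\<lambda>x. _ * x"]
      cong: if_cong)

lemma clin_gain: "clin gain" and norm_gain: "norm (gain x) \<le> \<kappa> * norm x"
  and gain_unit: "gain (unit j) = gain_column j"
  unfolding gain_def
  by (rule clin_of_columns norm_of_columns of_columns_unit norm_gain_column)+

lemmas gain_linear = clin_gain[unfolded clin_def, THEN conjunct1]
lemmas gain_linear_simps = gain_linear[THEN bounded_linear.linear, THEN linear_add]
  gain_linear[THEN bounded_linear.linear, THEN linear_diff]
  gain_linear[THEN bounded_linear.linear, THEN linear_scale]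
  gain_linear[THEN bounded_linear.linear, THEN linear_sum]

lemma coord_loss: "x \<in> loss_domain \<Longrightarrow> coord (loss x) i = of_real (\<alpha> i) * coord x i"
  by (simp add: loss_def loss_domain_def coord_Ell1)

lemma loss_domainI:
  assumes "\<And>i. coord z i = of_real (\<alpha> i) * coord x i"
  shows "x \<in> loss_domain" "loss x = z"
proof -
  show "x \<in> loss_domain"
    using summable_coord[of z] by (simp add: loss_domain_def assms)
  then show "loss x = z" by (intro ell1_eqI) (simp add: coord_loss assms)
qed

lemma loss_diff:
  assumes "x \<in> loss_domain" "y \<in> loss_domain"
  shows "x - y \<in> loss_domain" "loss (x - y) = loss x - loss y"
  by (rule loss_domainI[of "loss x - loss y"]; simp add: assms coord_loss algebra_simps)+

lemma loss_sum_unit: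
  assumes "finite I"
  shows "(\<Sum>i\<in>I. f i *\<^sub>R unit i) \<in> loss_domain"
    "loss (\<Sum>i\<in>I. f i *\<^sub>R unit i) = (\<Sum>i\<in>I. (\<alpha> i * f i) *\<^sub>R unit i)"
  by (rule loss_domainI[of "\<Sum>i\<in>I. (\<alpha> i * f i) *\<^sub>R unit i"];
      use assms in \<open>simp add: coord_sum coord_unit scaleR_conv_of_real if_distrib[of "\<lambda>x. _ * x"] cong: if_cong\<close>)+

text \<open>Triangularity keeps the span of the unit vectors up to \<open>j\<close> invariant; the
  coefficients are the right-hand side of the system solved by column \<open>j\<close> of the
  semigroup.\<close>

lemma frag_gen_sum_unit:
  "frag_gen (\<Sum>k\<le>j. c k *\<^sub>R unit k)
    = (\<Sum>i\<le>j. (- \<alpha> i * c i + (\<Sum>k\<le>j. \<alpha> k * \<beta> i k * c k)) *\<^sub>R unit i)"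
proof (rule ell1_eqI)
  fix i
  define q where "q i = (\<Sum>k\<le>j. \<alpha> k * \<beta> i k * c k)" for i
  have "coord (frag_gen (\<Sum>k\<le>j. c k *\<^sub>R unit k)) i
      = of_real (q i) - of_real (if i \<le> j then \<alpha> i * c i else 0)"
    by (simp add: q_def frag_gen_def loss_sum_unit gain_linear_simps gain_unit coord_sum coord_gain_column
        coord_unit scaleR_conv_of_real if_distrib[of "\<lambda>x. _ * x"] mult_ac cong: if_cong)
  moreover have "q i = 0" if "i > j"
    unfolding q_def by (rule sum.neutral) (use that \<beta>_zero in auto)
  ultimately show "coord (frag_gen (\<Sum>k\<le>j. c k *\<^sub>R unit k)) i
      = coord (\<Sum>i\<le>j. (- \<alpha> i * c i + (\<Sum>k\<le>j. \<alpha> k * \<beta> i k * c k)) *\<^sub>R unit i) i"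
    unfolding q_def[symmetric] by (auto simp: coord_sum coord_unit scaleR_conv_of_real if_distrib[of "\<lambda>x. _ * x"] cong: if_cong)
qed

text \<open>\<open>gain\<close> returns at most the share \<open>\<kappa>\<close> of the loss, so it
  cannot cancel the rest. Through this estimate, bounds and Cauchy sequences pass from
  \<open>frag_gen\<close> to \<open>loss\<close>.\<close>

lemma norm_loss_le: "(1 - \<kappa>) * norm (loss x) \<le> norm (frag_gen x)"
proof -
  have "norm (loss x) \<le> norm (frag_gen x) + norm (gain (loss x))"
    using norm_triangle_ineq2[of "loss x" "gain (loss x)"]
    by (simp add: frag_gen_def norm_minus_commute)
  then show ?thesis using norm_gain[of "loss x"] by (simp add: algebra_simps)
qed

lemma norm_frag_gen_le: "norm (frag_gen x) \<le> (1 + \<kappa>) * norm (loss x)"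
  using norm_triangle_ineq4[of "gain (loss x)" "loss x"] norm_gain[of "loss x"]
  by (simp add: frag_gen_def algebra_simps)

lemma frag_gen_diff:
  assumes "x \<in> loss_domain" "y \<in> loss_domain"
  shows "frag_gen (x - y) = frag_gen x - frag_gen y"
  using assms by (simp add: frag_gen_def loss_diff gain_linear_simps)

text \<open>Convergence of \<open>frag_gen (x m)\<close> makes \<open>loss (x m)\<close> a Cauchy
  sequence by \<open>norm_loss_le\<close>. Its limit is identified coordinatewise, where
  multiplication by a rate is continuous.\<close>

lemma frag_gen_closed:
  assumes x: "\<And>m. x m \<in> loss_domain" "x \<longlonglongrightarrow> z" "(\<lambda>m. frag_gen (x m)) \<longlonglongrightarrow> y"
  shows "z \<in> loss_domain" "frag_gen z = y"
proof -
  have "Cauchy (\<lambda>m. loss (x m))"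
  proof (rule CauchyI)
    fix e :: real assume "e > 0"
    have "Cauchy (\<lambda>m. frag_gen (x m))" using x(3) by (rule LIMSEQ_imp_Cauchy)
    then obtain M where M: "\<forall>m\<ge>M. \<forall>n\<ge>M. norm (frag_gen (x m) - frag_gen (x n)) < (1 - \<kappa>) * e"
      using CauchyD[of "\<lambda>m. frag_gen (x m)" "(1 - \<kappa>) * e"] \<open>e > 0\<close> \<kappa> by auto
    have "norm (loss (x m) - loss (x n)) < e" if "m \<ge> M" "n \<ge> M" for m n
    proof -
      have "(1 - \<kappa>) * norm (loss (x m) - loss (x n)) < (1 - \<kappa>) * e"
        using norm_loss_le[of "x m - x n"] M[rule_format, OF that]
        by (simp add: loss_diff x frag_gen_diff)
      then show ?thesis using \<kappa> by simp
    qed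
    then show "\<exists>M. \<forall>m\<ge>M. \<forall>n\<ge>M. norm (loss (x m) - loss (x n)) < e" by blast
  qed
  then obtain l where l: "(\<lambda>m. loss (x m)) \<longlonglongrightarrow> l"
    using Cauchy_convergent convergentD by blast
  have "coord l i = of_real (\<alpha> i) * coord z i" for i
  proof (rule LIMSEQ_unique)
    show "(\<lambda>m. coord (loss (x m)) i) \<longlonglongrightarrow> coord l i"
      by (rule bounded_linear.tendsto[OF bounded_linear_coord l])
    show "(\<lambda>m. coord (loss (x m)) i) \<longlonglongrightarrow> of_real (\<alpha> i) * coord z i"
      unfolding coord_loss[OF x(1)]
      by (intro tendsto_intros bounded_linear.tendsto[OF bounded_linear_coord] x(2))
  qed
  note z = loss_domainI[OF this]
  show "z \<in> loss_domain" by (rule z)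
  have "(\<lambda>m. frag_gen (x m)) \<longlonglongrightarrow> frag_gen z"
    unfolding frag_gen_def z(2) by (intro tendsto_intros l bounded_linear.tendsto[OF gain_linear])
  then show "frag_gen z = y" using x(3) by (rule LIMSEQ_unique)
qed

text \<open>
  The matrix entries of the semigroup, obtained by solving the triangular system
  \<open>s' i j = - \<alpha> i * s i j + (\<Sum>k = i+1..j. \<alpha> k * \<beta> i k * s k j)\<close> by variation of constants.
\<close>

function s :: "nat \<Rightarrow> nat \<Rightarrow> real \<Rightarrow> real" where
  "s i j t = exp (- (\<alpha> i * t)) * ((if i = j then 1 else 0) +
     (if i < j then integral {0..t} (\<lambda>r. exp (\<alpha> i * r) * (\<Sum>k\<in>{i<..j}. \<alpha> k * \<beta> i k * s k j r)) else 0))"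
  by pat_completeness auto
termination
  \<comment> \<open>Entry \<open>(i, j)\<close> refers only to rows \<open>k\<close> with
    \<open>i < k \<le> j\<close>, which are closer to the diagonal.\<close>
  by (relation "Wellfounded.measure (\<lambda>(i, j, t). j - i)") auto

declare s.simps [simp del]

lemma s_eq:
  "s i j t = exp (- (\<alpha> i * t)) * ((if i = j then 1 else 0) +
     integral {0..t} (\<lambda>r. exp (\<alpha> i * r) * (\<Sum>k\<in>{i<..j}. \<alpha> k * \<beta> i k * s k j r)))"
  by (subst s.simps) auto

lemma s_0: "s i j 0 = (if i = j then 1 else 0)"
  by (subst s_eq) simp

lemma s_above: "j < i \<Longrightarrow> s i j t = 0"
  by (subst s.simps) simp

text \<open>Both ends of the range can be extended: \<open>\<beta> i k\<close> vanishes for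
  \<open>k \<le> i\<close>, and \<open>s k j\<close> for \<open>k > j\<close>. A common range allows
  sums over different rows and columns to be exchanged.\<close>

lemma sum_rates:
  assumes "j \<le> m"
  shows "(\<Sum>k\<in>{i<..j}. \<alpha> k * \<beta> i k * s k j t) = (\<Sum>k\<le>m. \<alpha> k * \<beta> i k * s k j t)"
  by (rule sum.mono_neutral_left) (use assms \<beta>_zero s_above in \<open>auto simp: not_le not_less\<close>)

text \<open>Induction on the distance to the diagonal: the integrand contains only rows closer to
  it, which are already continuous. The bound \<open>m\<close> is free because
  \<open>S_column\<close> treats all columns \<open>k \<le> j\<close> with one range.\<close>

lemma s_derivative:
  assumes "0 \<le> t" "j \<le> m"
  shows "(s i j has_real_derivative - \<alpha> i * s i j t + (\<Sum>k\<le>m. \<alpha> k * \<beta> i k * s k j t)) (at t within {0..})"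
  using assms(1)
proof (induction "j - i" arbitrary: i t rule: less_induct)
  case less
  define g where "g r = exp (\<alpha> i * r) * (\<Sum>k\<in>{i<..j}. \<alpha> k * \<beta> i k * s k j r)" for r
  have "continuous_on {0..} (s k j)" if "k \<in> {i<..j}" for k
    unfolding continuous_on_eq_continuous_within
    using that by (intro ballI DERIV_continuous[OF less(1)]) auto
  then have "continuous_on {0..} g" unfolding g_def by (intro continuous_intros) auto
  then have I: "((\<lambda>u. integral {0..u} g) has_real_derivative g t) (at t within {0..})"
    using integral_has_vector_derivative_atLeast[of g t] less(2)
    by (simp add: has_real_derivative_iff_has_vector_derivative)
  have eq: "s i j = (\<lambda>t. exp (- (\<alpha> i * t)) * ((if i = j then 1 else 0) + integral {0..t} g))"
    unfolding g_def by (rule ext, rule s_eq)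
  have "((\<lambda>t. exp (- (\<alpha> i * t)) * ((if i = j then 1 else 0) + integral {0..t} g)) has_real_derivative
      - \<alpha> i * (exp (- (\<alpha> i * t)) * ((if i = j then 1 else 0) + integral {0..t} g))
      + exp (- (\<alpha> i * t)) * g t) (at t within {0..})"
    by (rule derivative_eq_intros I refl | simp add: algebra_simps)+
  moreover have "exp (- (\<alpha> i * t)) * g t = (\<Sum>k\<le>m. \<alpha> k * \<beta> i k * s k j t)"
    by (simp add: g_def exp_minus sum_rates[OF assms(2)])
  ultimately show ?case by (simp add: eq)
qed

lemma s_continuous: "continuous_on {0..} (s i j)"
  unfolding continuous_on_eq_continuous_within
  by (intro ballI DERIV_continuous[OF s_derivative]) auto

text \<open>Variation of constants has a positive kernel, and the inflow into row \<open>i\<close>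
  comes from rows nearer to the diagonal, nonnegative by induction.\<close>

lemma s_nonneg: "0 \<le> t \<Longrightarrow> 0 \<le> s i j t"
proof (induction "j - i" arbitrary: i t rule: less_induct)
  case less
  have "0 \<le> integral {0..t} (\<lambda>r. exp (\<alpha> i * r) * (\<Sum>k\<in>{i<..j}. \<alpha> k * \<beta> i k * s k j r))"
  proof (rule Henstock_Kurzweil_Integration.integral_nonneg)
    show "(\<lambda>r. exp (\<alpha> i * r) * (\<Sum>k\<in>{i<..j}. \<alpha> k * \<beta> i k * s k j r)) integrable_on {0..t}"
      by (intro integrable_continuous_real continuous_intros continuous_on_subset[OF s_continuous]) auto
    show "0 \<le> exp (\<alpha> i * r) * (\<Sum>k\<in>{i<..j}. \<alpha> k * \<beta> i k * s k j r)" if "r \<in> {0..t}" for r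
      using that less(1) by (intro mult_nonneg_nonneg sum_nonneg \<alpha>_nonneg \<beta>_nonneg) auto
  qed
  then show ?case by (subst s_eq) simp
qed

text \<open>Back substitution from row \<open>j\<close>: the rows \<open>k > i\<close> already
  vanish and the coefficients with \<open>k \<le> i\<close> are 0, so row \<open>i\<close> solves a
  scalar equation with integrating factor \<open>exp (\<alpha> i * t)\<close>.\<close>

lemma triangular_system_unique:
  assumes y': "\<And>i t. i \<le> j \<Longrightarrow> 0 \<le> t \<Longrightarrow>
      (y i has_real_derivative - \<alpha> i * y i t + (\<Sum>k\<le>j. \<alpha> k * \<beta> i k * y k t)) (at t within {0..})"
    and y0: "\<And>i. i \<le> j \<Longrightarrow> y i 0 = 0" and "i \<le> j" "0 \<le> t"
  shows "y i t = 0"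
  using assms(3,4)
proof (induction "j - i" arbitrary: i t rule: less_induct)
  case less
  have "((\<lambda>t. exp (\<alpha> i * t) * y i t) has_vector_derivative 0) (at t within {0..})" if "0 \<le> t" for t
  proof -
    have "\<alpha> k * \<beta> i k * y k t = 0" if "k \<le> j" for k
      using less(1)[of k t] \<beta>_zero[of k i] that \<open>0 \<le> t\<close> less(2) by (cases "k \<le> i") auto
    then have "(\<Sum>k\<le>j. \<alpha> k * \<beta> i k * y k t) = 0" by (intro sum.neutral) blast
    then have "(y i has_real_derivative - \<alpha> i * y i t) (at t within {0..})"
      using y'[OF less(2) that] by simp
    then have "((\<lambda>t. exp (\<alpha> i * t) * y i t) has_real_derivative
        \<alpha> i * exp (\<alpha> i * t) * y i t + exp (\<alpha> i * t) * (- \<alpha> i * y i t)) (at t within {0..})"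
      by (auto intro!: derivative_eq_intros simp: algebra_simps)
    then show ?thesis by (simp add: has_real_derivative_iff_has_vector_derivative)
  qed
  then obtain c where c: "\<And>t. t \<ge> 0 \<Longrightarrow> exp (\<alpha> i * t) * y i t = c"
    using has_vector_derivative_zero_constant[of "{0..}" "\<lambda>t. exp (\<alpha> i * t) * y i t"] by auto
  from c[of 0] c[OF less(3)] y0[OF less(2)] show ?case by simp
qed

section \<open>Columns and the semigroup assembled from them\<close>

definition column :: "nat \<Rightarrow> real \<Rightarrow> ell1" where
  "column j t = (\<Sum>i\<le>j. s i j t *\<^sub>R unit i)"

lemma coord_column: "coord (column j t) i = of_real (s i j t)"
  using s_above[of j i t]
  by (simp add: column_def coord_sum coord_unit scaleR_conv_of_real if_distrib[of "\<lambda>x. _ * x"] cong: if_cong)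

lemma column_0: "column j 0 = unit j"
  by (rule ell1_eqI) (simp add: coord_column s_0 coord_unit)

lemma column_loss:
  "column j t \<in> loss_domain" "loss (column j t) = (\<Sum>i\<le>j. (\<alpha> i * s i j t) *\<^sub>R unit i)"
  unfolding column_def by (rule loss_sum_unit; simp)+

lemma column_derivative:
  assumes "0 \<le> t"
  shows "(column j has_vector_derivative frag_gen (column j t)) (at t within {0..})"
proof -
  have "(column j has_vector_derivative
      (\<Sum>i\<le>j. (- \<alpha> i * s i j t + (\<Sum>k\<le>j. \<alpha> k * \<beta> i k * s k j t)) *\<^sub>R unit i)) (at t within {0..})"
    unfolding column_def[abs_def]
    by (intro has_vector_derivative_sum
        bounded_linear.has_vector_derivative[OF bounded_linear_scaleR_left]
        s_derivative[unfolded has_real_derivative_iff_has_vector_derivative] assms order_refl)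
  then show ?thesis by (simp add: column_def frag_gen_sum_unit)
qed

lemma norm_column: "0 \<le> t \<Longrightarrow> norm (column j t) = (\<Sum>i\<le>j. s i j t)"
  by (simp add: column_def norm_sum_unit s_nonneg)

lemma norm_loss_column: "0 \<le> t \<Longrightarrow> norm (loss (column j t)) = (\<Sum>i\<le>j. \<alpha> i * s i j t)"
  by (simp add: column_loss norm_sum_unit s_nonneg \<alpha>_nonneg)

text \<open>When the system is summed over all rows, the loss of row \<open>k\<close> reappears as
  gain with total weight at most \<open>\<kappa>\<close>. The mean value theorem supplies one time
  \<open>r\<close> at which the loss is controlled, in place of an integral over the whole
  interval.\<close>

lemma norm_column_decrease:
  assumes "0 < t"
  shows "\<exists>r\<in>{0<..<t}. norm (column j t) \<le> 1 - t * ((1 - \<kappa>) * norm (loss (column j r)))"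
proof -
  let ?m = "\<lambda>t. \<Sum>i\<le>j. s i j t"
  define m' where "m' t = (\<Sum>i\<le>j. - \<alpha> i * s i j t + (\<Sum>k\<le>j. \<alpha> k * \<beta> i k * s k j t))" for t
  have "\<exists>r\<in>{0<..<t}. ?m t - ?m 0 = (t - 0) * m' r"
  proof (rule mvt_simple[OF assms, of ?m "\<lambda>r h. h * m' r"])
    fix r assume "0 \<le> r" "r \<le> t"
    then have "(?m has_real_derivative m' r) (at r within {0..})"
      unfolding m'_def by (intro DERIV_sum s_derivative) auto
    then show "(?m has_derivative (\<lambda>h. h * m' r)) (at r within {0..t})"
      unfolding has_field_derivative_def
      by (rule has_derivative_subset[THEN has_derivative_eq_rhs]) (auto simp: mult.commute)
  qed
  then obtain r where r: "0 < r" "r < t" "?m t - ?m 0 = t * m' r" by auto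
  have "m' r \<le> - ((1 - \<kappa>) * norm (loss (column j r)))"
  proof -
    have "(\<Sum>i\<le>j. \<Sum>k\<le>j. \<alpha> k * \<beta> i k * s k j r) = (\<Sum>k\<le>j. \<alpha> k * s k j r * (\<Sum>i\<le>j. \<beta> i k))"
      by (subst sum.swap) (simp add: sum_distrib_left mult_ac)
    also have "\<dots> \<le> (\<Sum>k\<le>j. \<alpha> k * s k j r * \<kappa>)"
    proof (intro sum_mono mult_left_mono mult_nonneg_nonneg \<alpha>_nonneg s_nonneg)
      fix k assume "k \<in> {..j}"
      then have "(\<Sum>i\<le>j. \<beta> i k) = (\<Sum>i<k. \<beta> i k)"
        by (intro sum.mono_neutral_right) (auto simp: \<beta>_zero)
      then show "(\<Sum>i\<le>j. \<beta> i k) \<le> \<kappa>" using column_mass by simp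
    qed (use r in simp)
    also have "\<dots> = \<kappa> * norm (loss (column j r))"
      using r by (simp add: norm_loss_column sum_distrib_left mult_ac)
    finally have "(\<Sum>i\<le>j. \<Sum>k\<le>j. \<alpha> k * \<beta> i k * s k j r) \<le> \<kappa> * norm (loss (column j r))" .
    moreover have "m' r = (\<Sum>i\<le>j. \<Sum>k\<le>j. \<alpha> k * \<beta> i k * s k j r) - norm (loss (column j r))"
      using r unfolding m'_def by (simp add: norm_loss_column sum_subtractf)
    ultimately show ?thesis by (simp add: algebra_simps)
  qed
  then have "t * m' r \<le> t * - ((1 - \<kappa>) * norm (loss (column j r)))"
    using assms by (intro mult_left_mono) auto
  moreover have "?m 0 = 1" by (simp add: s_0)
  ultimately have "norm (column j t) \<le> 1 - t * ((1 - \<kappa>) * norm (loss (column j r)))"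
    using r assms by (simp add: norm_column)
  then show ?thesis using r by auto
qed

lemma norm_column_le: "0 \<le> t \<Longrightarrow> norm (column j t) \<le> 1"
proof (cases "t = 0")
  case False
  assume "0 \<le> t"
  with False obtain r where "norm (column j t) \<le> 1 - t * ((1 - \<kappa>) * norm (loss (column j r)))"
    using norm_column_decrease[of t j] by auto
  also have "\<dots> \<le> 1" using \<open>0 \<le> t\<close> \<kappa> by simp
  finally show ?thesis .
qed (simp add: column_0)

definition S :: "real \<Rightarrow> ell1 \<Rightarrow> ell1" where
  "S t = of_columns (\<lambda>j. column j t)"

context
  fixes t :: real
  assumes t: "0 \<le> t"
begin

lemma clin_S: "clin (S t)"
  unfolding S_def by (rule clin_of_columns[OF norm_column_le[OF t]])

lemma norm_S: "norm (S t x) \<le> norm x"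
  unfolding S_def using norm_of_columns[OF norm_column_le[OF t]] by simp

lemma S_unit: "S t (unit j) = column j t"
  unfolding S_def by (rule of_columns_unit[OF norm_column_le[OF t]])

lemma coord_S: "(\<lambda>j. coord x j * of_real (s i j t)) sums coord (S t x) i"
  using coord_of_columns[OF norm_column_le[OF t], where x = x and i = i] by (simp add: S_def coord_column)

end

lemma bounded_linear_S: "0 \<le> t \<Longrightarrow> bounded_linear (S t)"
  using clin_S by (simp add: clin_def)

text \<open>The semigroup law on unit vectors. For fixed \<open>t\<close>, both sides as functions
  of \<open>r\<close> solve the triangular system with the same initial value, so their difference
  \<open>y\<close> vanishes.\<close>

lemma S_column:
  assumes "0 \<le> r" "0 \<le> t"
  shows "S r (column j t) = column j (t + r)"
proof (rule ell1_eqI)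
  fix i
  define y where "y i r = (\<Sum>k\<le>j. s k j t * s i k r) - s i j (t + r)" for i r
  have eq: "coord (S r (column j t)) i = of_real (\<Sum>k\<le>j. s k j t * s i k r)"
    using assms(1)
    by (simp add: column_def[of j t] bounded_linear_S[THEN bounded_linear.linear, THEN linear_sum]
        bounded_linear_S[THEN bounded_linear.linear, THEN linear_scale] S_unit coord_sum coord_column scaleR_conv_of_real)
  have "y i r = 0" if "i \<le> j"
  proof (rule triangular_system_unique[of j y, OF _ _ that assms(1)])
    fix i r assume ir: "i \<le> j" "0 \<le> (r::real)"
    have "(s i j has_real_derivative - \<alpha> i * s i j (t + r) + (\<Sum>k\<le>j. \<alpha> k * \<beta> i k * s k j (t + r)))
        (at (t + r) within (\<lambda>r. t + r) ` {0..})"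
      by (rule DERIV_subset[OF s_derivative]) (use assms ir in auto)
    then have "(s i j \<circ> (\<lambda>r. t + r) has_real_derivative
        (- \<alpha> i * s i j (t + r) + (\<Sum>k\<le>j. \<alpha> k * \<beta> i k * s k j (t + r))) * 1) (at r within {0..})"
      by (rule DERIV_image_chain) (auto intro!: derivative_eq_intros)
    then have 1: "((\<lambda>r. s i j (t + r)) has_real_derivative
        - \<alpha> i * s i j (t + r) + (\<Sum>k\<le>j. \<alpha> k * \<beta> i k * s k j (t + r))) (at r within {0..})"
      by (simp add: o_def)
    have 2: "((\<lambda>r. \<Sum>k\<le>j. s k j t * s i k r) has_real_derivative
        (\<Sum>k\<le>j. s k j t * (- \<alpha> i * s i k r + (\<Sum>l\<le>j. \<alpha> l * \<beta> i l * s l k r)))) (at r within {0..})"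
      using ir by (intro DERIV_sum DERIV_cmult s_derivative) auto
    have "(\<Sum>k\<le>j. s k j t * (\<Sum>l\<le>j. \<alpha> l * \<beta> i l * s l k r))
        = (\<Sum>l\<le>j. \<alpha> l * \<beta> i l * (\<Sum>k\<le>j. s k j t * s l k r))"
      unfolding sum_distrib_left by (subst sum.swap) (simp add: mult_ac)
    then show "(y i has_real_derivative - \<alpha> i * y i r + (\<Sum>k\<le>j. \<alpha> k * \<beta> i k * y k r)) (at r within {0..})"
      unfolding y_def[abs_def]
      by (intro DERIV_diff[OF 2 1, THEN DERIV_cong])
         (simp add: algebra_simps sum.distrib sum_subtractf sum_distrib_left sum_negf)
  qed (simp add: y_def s_0 if_distrib[of "\<lambda>x. _ * x"] cong: if_cong)
  moreover have "(\<Sum>k\<le>j. s k j t * s i k r) = 0" "s i j (t + r) = 0" if "i > j"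
    using that by (auto intro!: sum.neutral simp: s_above)
  ultimately show "coord (S r (column j t)) i = coord (column j (t + r)) i"
    unfolding eq coord_column y_def by (metis eq_iff_diff_eq_0 not_le)
qed

lemma S_add:
  assumes "0 \<le> r" "0 \<le> t"
  shows "S (r + t) x = S r (S t x)"
  by (rule clin_eqI[OF clin_S clin_comp[OF clin_S clin_S]])
     (use assms in \<open>simp_all add: S_unit S_column add.commute\<close>)

lemma S_0: "S 0 x = x"
  by (rule clin_eqI[OF clin_S]) (simp_all add: S_unit column_0 clin_def)

text \<open>Contractivity reduces the claim to a truncation \<open>p n\<close> of \<open>x\<close>,
  on which \<open>S t\<close> acts by finitely many columns, each continuous in time.\<close>

lemma S_right_continuous: "((\<lambda>t. S t x) \<longlongrightarrow> x) (at_right 0)"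
proof (rule tendstoI)
  fix e :: real assume "e > 0"
  define p where "p n = (\<Sum>j<n. scaleC (coord x j) (unit j))" for n
  have "p \<longlonglongrightarrow> x" using unit_expansion[of x] unfolding sums_def p_def .
  then obtain n where n: "norm (p n - x) < e / 3"
    using LIMSEQ_D[of p x "e / 3"] \<open>e > 0\<close> by auto
  have S_p: "S t (p n) = (\<Sum>j<n. scaleC (coord x j) (column j t))" if "0 \<le> t" for t
    using that clin_S[OF that]
    by (simp add: p_def bounded_linear_S[THEN bounded_linear.linear, THEN linear_sum] clin_def S_unit)
  have "(column j \<longlongrightarrow> unit j) (at_right 0)" for j
    using has_vector_derivative_continuous[OF column_derivative[OF order_refl], of j]
    unfolding continuous_within at_within_Ici_at_right column_0 .
  then have "((\<lambda>t. \<Sum>j<n. scaleC (coord x j) (column j t)) \<longlongrightarrow> p n) (at_right 0)"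
    unfolding p_def by (intro tendsto_sum bounded_linear.tendsto[OF bounded_linear_scaleC])
  then have "eventually (\<lambda>t. dist (\<Sum>j<n. scaleC (coord x j) (column j t)) (p n) < e / 3) (at_right 0)"
    using \<open>e > 0\<close> by (intro tendstoD) auto
  then have "eventually (\<lambda>t. norm (S t (p n) - p n) < e / 3) (at_right 0)"
    using eventually_at_right_less[of "0::real"]
    by eventually_elim (simp add: S_p dist_norm)
  then show "eventually (\<lambda>t. dist (S t x) x < e) (at_right 0)"
    using eventually_at_right_less[of "0::real"]
  proof eventually_elim
    case (elim t)
    have eq: "S t x - x = (S t (p n) - p n) + (p n - x) - S t (p n - x)"
      using elim(2) by (simp add: bounded_linear_S[THEN bounded_linear.linear, THEN linear_diff])
    have "norm (S t x - x) \<le> norm (S t (p n) - p n) + norm (p n - x) + norm (S t (p n - x))"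
      unfolding eq using norm_triangle_ineq4[of "(S t (p n) - p n) + (p n - x)" "S t (p n - x)"]
        norm_triangle_ineq[of "S t (p n) - p n" "p n - x"] by linarith
    then show ?case using elim n norm_S[of t "p n - x"] by (simp add: dist_norm)
  qed
qed

text \<open>
  On a column \<open>u\<close>, the norm of \<open>frag_gen (u t)\<close> is non-increasing because the semigroup is
  contractive, while \<open>loss u\<close> is integrable in time because the mass \<open>norm (u t)\<close> decreases at
  least at the rate \<open>(1 - \<kappa>) * norm (loss (u t))\<close>. A non-increasing integrable function is bounded by
  a multiple of \<open>1 / t\<close>.
\<close>

lemma smoothing_semigroup_S: "smoothing_semigroup S loss_domain frag_gen"
proof -
  \<comment> \<open>The generator of \<open>S\<close> is at first known only abstractly. It agrees
    with \<open>frag_gen\<close> on columns; closedness of \<open>GL\<close> and closedness of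
    \<open>frag_gen\<close> then give one inclusion of the domains each.\<close>
  obtain DL GL where "c0_semigroup S DL GL"
    using c0_semigroup_exists_generator[of S] bounded_linear_S S_0 S_add S_right_continuous by metis
  then interpret L: c0_semigroup S DL GL .
  have column_DL: "column j t \<in> DL" "GL (column j t) = frag_gen (column j t)" if "0 \<le> t" for j t
  proof -
    have "(column j has_vector_derivative frag_gen (column j t)) (at (t + 0) within (\<lambda>h. t + h) ` {0..})"
      using column_derivative[OF that] that by (auto intro: has_vector_derivative_within_subset)
    moreover have "((\<lambda>h. t + h) has_vector_derivative 1) (at 0 within {0..})"
      by (auto intro!: derivative_eq_intros)
    ultimately have "(column j \<circ> (\<lambda>h. t + h) has_vector_derivative 1 *\<^sub>R frag_gen (column j t)) (at 0 within {0..})"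
      by (intro vector_diff_chain_within) auto
    then have "(column j \<circ> (\<lambda>h. t + h) has_vector_derivative frag_gen (column j t)) (at 0 within {0..})"
      by simp
    then have "((\<lambda>h. S h (column j t)) has_vector_derivative frag_gen (column j t)) (at 0 within {0..})"
      by (rule has_vector_derivative_transform[rotated 2]) (use that in \<open>simp_all add: S_column\<close>)
    then show "column j t \<in> DL" "GL (column j t) = frag_gen (column j t)" by (rule L.domainI)+
  qed
  define d where "d = (1 - \<kappa>) * (1 - \<kappa>)"
  have d: "0 < d" using \<kappa> by (simp add: d_def)
  \<comment> \<open>Comparing \<open>loss\<close> with \<open>frag_gen\<close> at both times gives
    the factor \<open>(1 + \<kappa>) / (1 - \<kappa>)\<close>; a further
    \<open>1 / (1 - \<kappa>)\<close> comes from the loss at time \<open>r\<close>.\<close>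
  define C where "C = (1 + \<kappa>) / d"
  have C: "norm (loss (column j t)) \<le> C / t" if "0 < t" for j t
  proof -
    obtain r where r: "0 < r" "r < t" "norm (column j t) \<le> 1 - t * ((1 - \<kappa>) * norm (loss (column j r)))"
      using norm_column_decrease[OF \<open>0 < t\<close>, of j] unfolding Bex_def greaterThanLessThan_iff by blast
    have "column j t = S (t - r) (column j r)" using r by (simp add: S_column)
    then have "frag_gen (column j t) = S (t - r) (frag_gen (column j r))"
      using L.orbit_in_domain(2)[OF column_DL(1), of r "t - r" j] column_DL(2)[of r j]
        column_DL(2)[of t j] r by simp
    then have "norm (frag_gen (column j t)) \<le> norm (frag_gen (column j r))"
      using norm_S[of "t - r"] r by simp
    also have "\<dots> \<le> (1 + \<kappa>) * norm (loss (column j r))" by (rule norm_frag_gen_le)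
    finally have "(1 - \<kappa>) * norm (loss (column j t)) \<le> (1 + \<kappa>) * norm (loss (column j r))"
      using norm_loss_le[of "column j t"] by linarith
    then have "t * (1 - \<kappa>) * ((1 - \<kappa>) * norm (loss (column j t)))
        \<le> t * (1 - \<kappa>) * ((1 + \<kappa>) * norm (loss (column j r)))"
      using that \<kappa> by (intro mult_left_mono) auto
    also have "\<dots> = (1 + \<kappa>) * (t * ((1 - \<kappa>) * norm (loss (column j r))))" by simp
    also have "\<dots> \<le> (1 + \<kappa>) * 1"
      using r(3) norm_ge_zero[of "column j t"] \<kappa>
      by (intro mult_left_mono) linarith+
    finally have "norm (loss (column j t)) * (d * t) \<le> 1 + \<kappa>"
      by (simp add: d_def mult_ac)
    then have "norm (loss (column j t)) \<le> (1 + \<kappa>) / (d * t)"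
      using that d by (simp add: pos_le_divide_eq)
    then show ?thesis by (simp add: C_def)
  qed
  have smooth: "S t x \<in> loss_domain \<and> norm (frag_gen (S t x)) \<le> (1 + \<kappa>) * (C / t) * norm x"
    if t: "0 < t" for t x
  proof -
    note bound = C[OF t]
    \<comment> \<open>The columns of \<open>loss \<circ> S t\<close> are bounded by
      \<open>C / t\<close>, so they define an operator on the whole space; its coordinates show that
      it is the loss of \<open>S t x\<close>.\<close>
    define z where "z = of_columns (\<lambda>j. loss (column j t)) x"
    have "coord z i = of_real (\<alpha> i) * coord (S t x) i" for i
    proof (rule sums_unique2)
      show "(\<lambda>j. coord x j * coord (loss (column j t)) i) sums coord z i"
        unfolding z_def by (rule coord_of_columns[OF bound])
      have "(\<lambda>j. of_real (\<alpha> i) * (coord x j * of_real (s i j t))) sums (of_real (\<alpha> i) * coord (S t x) i)"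
        using t by (intro sums_mult coord_S) simp
      then show "(\<lambda>j. coord x j * coord (loss (column j t)) i) sums (of_real (\<alpha> i) * coord (S t x) i)"
        by (simp add: coord_loss column_loss(1) coord_column mult_ac)
    qed
    note S = loss_domainI[OF this]
    have "norm (frag_gen (S t x)) \<le> (1 + \<kappa>) * norm z"
      using norm_frag_gen_le[of "S t x"] S(2) by simp
    also have "\<dots> \<le> (1 + \<kappa>) * (C / t * norm x)"
      unfolding z_def using \<kappa> by (intro mult_left_mono norm_of_columns bound) auto
    finally show ?thesis using S(1) by (simp add: mult.assoc)
  qed
  have frag_gen_L: "x \<in> DL \<and> GL x = frag_gen x" if x: "x \<in> loss_domain" for x
  proof -
    define p where "p n = (\<Sum>j<n. scaleC (coord x j) (unit j))" for n
    have p: "p \<longlonglongrightarrow> x" using unit_expansion[of x] unfolding sums_def p_def .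
    have unit_L: "scaleC c (unit j) \<in> DL \<and> GL (scaleC c (unit j)) = scaleC c (frag_gen (unit j))" for c j
    proof -
      have "((\<lambda>t. S t (unit j)) has_vector_derivative frag_gen (unit j)) (at 0 within {0..})"
        using column_DL[of 0 j] L.generator by (simp add: column_0)
      then have "((\<lambda>t. scaleC c (S t (unit j))) has_vector_derivative scaleC c (frag_gen (unit j))) (at 0 within {0..})"
        by (rule bounded_linear.has_vector_derivative[OF bounded_linear_scaleC])
      then have "((\<lambda>t. S t (scaleC c (unit j))) has_vector_derivative scaleC c (frag_gen (unit j))) (at 0 within {0..})"
        by (rule has_vector_derivative_transform[rotated 2]) (use clin_S in \<open>simp_all add: clin_def\<close>)
      then show ?thesis using L.domainI by blast
    qed
    have p_L: "p n \<in> DL \<and> GL (p n) = (\<Sum>j<n. scaleC (coord x j) (frag_gen (unit j)))" for n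
      unfolding p_def by (induction n) (auto simp: L.domain_0 L.domain_add unit_L)
    have "scaleC (coord x j) (frag_gen (unit j))
        = gain (scaleC (coord (loss x) j) (unit j)) - scaleC (coord (loss x) j) (unit j)" for j
    proof -
      have "loss (unit j) = scaleC (of_real (\<alpha> j)) (unit j)"
        by (rule loss_domainI) (simp add: coord_unit)
      then show ?thesis
        using clin_gain bounded_linear_scaleC[THEN bounded_linear.linear, THEN linear_diff]
        by (simp add: frag_gen_def clin_def coord_loss[OF x] scaleC.rep_eq)
           (auto intro!: ell1_eqI simp: algebra_simps)
    qed
    \<comment> \<open>Both terms of \<open>frag_gen x\<close> are expanded along
      \<open>loss x\<close>, an element of \<open>ell1\<close> whose coordinates are known because
      \<open>x\<close> lies in \<open>loss_domain\<close>.\<close>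
    then have "(\<lambda>j. scaleC (coord x j) (frag_gen (unit j))) sums frag_gen x"
      unfolding frag_gen_def[of x]
      by (simp only:) (intro sums_diff bounded_linear.sums[OF gain_linear] unit_expansion)
    then have "(\<lambda>n. GL (p n)) \<longlonglongrightarrow> frag_gen x" unfolding sums_def by (simp add: p_L)
    then show ?thesis using L.generator_closed[of p x "frag_gen x"] p p_L by blast
  qed
  have L_frag_gen: "x \<in> loss_domain \<and> frag_gen x = GL x" if x: "x \<in> DL" for x
  proof -
    \<comment> \<open>The semigroup moves \<open>x\<close> into \<open>loss_domain\<close> at
      arbitrarily small times, and \<open>frag_gen (y m)\<close> is a value of the orbit of
      \<open>GL x\<close>, which converges.\<close>
    define y where "y m = S (inverse (real (Suc m))) x" for m
    have y: "y m \<in> loss_domain" for m unfolding y_def using smooth by simp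
    have "frag_gen (y m) = S (inverse (real (Suc m))) (GL x)" for m
      using frag_gen_L[OF y[of m]] L.orbit_in_domain(2)[OF x, of "inverse (real (Suc m))"] by (simp add: y_def)
    moreover have "(\<lambda>m. S (inverse (real (Suc m))) v) \<longlonglongrightarrow> v" for v
      by (rule L.continuous_at_0[OF LIMSEQ_inverse_real_of_nat]) simp
    ultimately show ?thesis
      using frag_gen_closed[of y x "GL x"] y unfolding y_def by simp
  qed
  have "x \<in> DL \<and> y = GL x \<longleftrightarrow> x \<in> loss_domain \<and> y = frag_gen x" for x y
    using frag_gen_L L_frag_gen by metis
  then have "c0_semigroup S loss_domain frag_gen"
    by (intro c0_semigroup.intro) (simp_all add: bounded_linear_S S_0 S_add S_right_continuous L.generator)
  then show ?thesis
    by (rule smoothing_semigroup.intro) (unfold_locales; use smooth in blast)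
qed

lemma S_nonneg:
  assumes "0 \<le> t" "\<And>j. coord x j \<in> \<real>\<^sub>\<ge>\<^sub>0"
  shows "coord (S t x) i \<in> \<real>\<^sub>\<ge>\<^sub>0"
proof -
  have x: "coord x j = of_real (Re (coord x j))" "0 \<le> Re (coord x j)" for j
    using assms(2)[of j] by (auto simp: complex_nonneg_Reals_iff complex_eq_iff)
  have "(\<lambda>j. complex_of_real (Re (coord x j) * s i j t)) sums coord (S t x) i"
    using coord_S[OF assms(1), of x i] by (subst (asm) x(1)) simp
  note sums = this
  have "(\<lambda>j. Re (coord x j) * s i j t) sums Re (coord (S t x) i)"
    using sums_Re[OF sums] by simp
  then have "0 \<le> Re (coord (S t x) i)"
    by (rule sums_le[OF _ sums_zero, rotated]) (simp add: x(2) s_nonneg[OF assms(1)])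
  moreover have "(\<lambda>j. 0) sums Im (coord (S t x) i)"
    using sums_Im[OF sums] by simp
  then have "Im (coord (S t x) i) = 0" by (rule sums_unique2[OF _ sums_zero])
  ultimately show ?thesis by (simp add: complex_nonneg_Reals_iff)
qed

end


section \<open>Isometric copies of normed spaces\<close>

text \<open>Carrier, differences and norm are what the metric topology depends on. Each level of the
  tower will be such a copy, so its topological statements can be pulled back to a Banach
  type.\<close>

definition isometric_copy :: "('e::real_normed_vector \<Rightarrow> 'v::ab_group_add) \<Rightarrow> 'v set \<Rightarrow> ('v \<Rightarrow> real) \<Rightarrow> bool" where
  "isometric_copy \<Psi> X N \<longleftrightarrow>
     range \<Psi> = X \<and> (\<forall>x y. \<Psi> (x - y) = \<Psi> x - \<Psi> y) \<and> (\<forall>x. N (\<Psi> x) = norm x)"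

lemma isometric_copyD:
  assumes "isometric_copy \<Psi> X N"
  shows "range \<Psi> = X" "\<Psi> (x - y) = \<Psi> x - \<Psi> y" "N (\<Psi> x) = norm x" "N (\<Psi> x - \<Psi> y) = norm (x - y)"
    "inj \<Psi>"
proof -
  show *: "range \<Psi> = X" "\<Psi> (x - y) = \<Psi> x - \<Psi> y" "N (\<Psi> x) = norm x" for x y
    using assms by (auto simp: isometric_copy_def)
  show **: "N (\<Psi> x - \<Psi> y) = norm (x - y)" for x y
    by (simp add: *(3) flip: *(2))
  show "inj \<Psi>"
  proof (rule injI)
    fix x y assume "\<Psi> x = \<Psi> y"
    then have "N (\<Psi> x - \<Psi> y) = N (\<Psi> y - \<Psi> y)" by simp
    then show "x = y" unfolding ** by simp
  qed
qed

lemma isometric_copy_Metric_space: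
  assumes "isometric_copy \<Psi> X N"
  shows "Metric_space X (norm_dist X N)"
proof -
  note I = isometric_copyD[OF assms]
  have rep: "\<exists>z. x = \<Psi> z" if "x \<in> X" for x using that I(1) by blast
  have d: "norm_dist X N (\<Psi> x) (\<Psi> y) = norm (x - y)" for x y
    using I by (auto simp: norm_dist_def)
  show ?thesis
  proof
    fix x y
    show "0 \<le> norm_dist X N x y" "norm_dist X N x y = norm_dist X N y x"
      unfolding norm_dist_def using I(4) rep norm_minus_commute by (metis norm_ge_zero order_refl)+
  next
    fix x y z assume "x \<in> X" "y \<in> X"
    then obtain x' y' where "x = \<Psi> x'" "y = \<Psi> y'" using rep by metis
    then show "norm_dist X N x y = 0 \<longleftrightarrow> x = y" using I(5) by (auto simp: d dest: injD)
    assume "z \<in> X"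
    then obtain z' where "z = \<Psi> z'" using rep by metis
    then show "norm_dist X N x z \<le> norm_dist X N x y + norm_dist X N y z"
      using \<open>x = \<Psi> x'\<close> \<open>y = \<Psi> y'\<close> norm_triangle_ineq[of "x' - y'" "y' - z'"] by (simp add: d)
  qed
qed

text \<open>Serves a level of the tower before it is recognised as a copy of \<open>ell1\<close>;
  symmetry of the distance comes from scaling by \<open>- 1\<close>.\<close>

lemma normed_space_on_Metric_space:
  assumes "normed_space_on sc X N" and "vector_space sc"
  shows "Metric_space X (norm_dist X N)"
proof -
  interpret vector_space sc by fact
  have sub: "subspace X" and pos: "\<And>x. x \<in> X \<Longrightarrow> 0 \<le> N x" "\<And>x. x \<in> X \<Longrightarrow> N x = 0 \<longleftrightarrow> x = 0"
    and tri: "\<And>x y. x \<in> X \<Longrightarrow> y \<in> X \<Longrightarrow> N (x + y) \<le> N x + N y"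
    and scale: "\<And>c x. x \<in> X \<Longrightarrow> N (sc c x) = cmod c * N x"
    using assms(1) by (auto simp: normed_space_on_def)
  have diff: "x - y \<in> X" if "x \<in> X" "y \<in> X" for x y using sub that by (rule subspace_diff)
  have comm: "N (x - y) = N (y - x)" if "x \<in> X" "y \<in> X" for x y
    using scale[OF diff[OF that], of "- 1"] by simp
  show ?thesis
  proof
    fix x y
    show "0 \<le> norm_dist X N x y" "norm_dist X N x y = norm_dist X N y x"
      using pos(1)[OF diff] comm by (auto simp: norm_dist_def)
  next
    fix x y z assume X: "x \<in> X" "y \<in> X"
    then show "norm_dist X N x y = 0 \<longleftrightarrow> x = y" using pos(2)[OF diff[OF X]] by (simp add: norm_dist_def)
    assume "z \<in> X"
    then show "norm_dist X N x z \<le> norm_dist X N x y + norm_dist X N y z"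
      using X tri[OF diff diff, of x y y z] by (simp add: norm_dist_def)
  qed
qed

context
  fixes X :: "'v::ab_group_add set" and N :: "'v \<Rightarrow> real"
  assumes metric: "Metric_space X (norm_dist X N)"
begin

interpretation Metric_space X "norm_dist X N" by (rule metric)

lemma topspace_norm_topology: "topspace (norm_topology X N) = X"
  by (simp add: norm_topology_def)

lemma Hausdorff_norm_topology: "Hausdorff_space (norm_topology X N)"
  by (simp add: norm_topology_def Hausdorff_space_mtopology)

lemma continuous_map_norm_topology_iff:
  fixes f :: "'a::metric_space \<Rightarrow> 'v"
  shows "continuous_map euclidean (norm_topology X N) f \<longleftrightarrow>
    (\<forall>x. f x \<in> X) \<and> (\<forall>x. \<forall>\<epsilon>>0. \<exists>\<delta>>0. \<forall>y. dist x y < \<delta> \<longrightarrow> N (f x - f y) < \<epsilon>)"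
  using Met_TC.metric_continuous_map[OF metric, of f]
  by (auto simp: norm_topology_def norm_dist_def image_subset_iff)

lemma closure_of_norm_topology:
  assumes "x \<in> norm_topology X N closure_of A" "0 < \<epsilon>"
  shows "\<exists>y\<in>A. y \<in> X \<and> N (x - y) < \<epsilon>"
  using assms by (auto simp: norm_topology_def metric_closure_of norm_dist_def split: if_splits)

end

lemma isometric_copy_homeomorphic:
  assumes "isometric_copy \<Psi> X N"
  shows "homeomorphic_map euclidean (norm_topology X N) \<Psi>"
    "continuous_map (norm_topology X N) euclidean (inv \<Psi>)"
proof -
  note I = isometric_copyD[OF assms]
  interpret M: Metric_space X "norm_dist X N" by (rule isometric_copy_Metric_space[OF assms])
  have "continuous_map euclidean (norm_topology X N) \<Psi>"
    unfolding continuous_map_norm_topology_iff[OF M.Metric_space_axioms] I(4)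
    using I(1) by (auto simp: dist_norm)
  moreover
  have inv_dist: "dist (inv \<Psi> x) (inv \<Psi> y) = norm_dist X N x y" if "x \<in> X" "y \<in> X" for x y
  proof -
    obtain x' y' where "x = \<Psi> x'" "y = \<Psi> y'" using \<open>x \<in> X\<close> \<open>y \<in> X\<close> I(1) by blast
    then show ?thesis using that I(4,5) by (simp add: norm_dist_def dist_norm)
  qed
  show *: "continuous_map (norm_topology X N) euclidean (inv \<Psi>)"
    using M.metric_continuous_map[OF Met_TC.Metric_space_axioms, of "inv \<Psi>"] inv_dist
    by (auto simp: norm_topology_def)
  ultimately have "homeomorphic_maps euclidean (norm_topology X N) \<Psi> (inv \<Psi>)"
    unfolding homeomorphic_maps_def
    using I by (auto simp: topspace_norm_topology[OF M.Metric_space_axioms] f_inv_into_f)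
  then show "homeomorphic_map euclidean (norm_topology X N) \<Psi>"
    by (rule homeomorphic_maps_imp_map)
qed

lemma continuous_map_isometric_copy:
  assumes "isometric_copy \<Psi> X N"
  shows "continuous_map (top_of_set J) (norm_topology X N) (\<lambda>t. \<Psi> (g t)) \<longleftrightarrow> continuous_on J g"
proof
  assume "continuous_map (top_of_set J) (norm_topology X N) (\<lambda>t. \<Psi> (g t))"
  then have "continuous_map (top_of_set J) euclidean (inv \<Psi> \<circ> (\<lambda>t. \<Psi> (g t)))"
    by (rule continuous_map_compose) (rule isometric_copy_homeomorphic[OF assms])
  then show "continuous_on J g" using isometric_copyD(5)[OF assms] by (simp add: o_def)
next
  assume "continuous_on J g"
  then have "continuous_map (top_of_set J) euclidean g" by simp
  then have "continuous_map (top_of_set J) (norm_topology X N) (\<Psi> \<circ> g)"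
    by (rule continuous_map_compose)
       (rule homeomorphic_imp_continuous_map[OF isometric_copy_homeomorphic(1)[OF assms]])
  then show "continuous_map (top_of_set J) (norm_topology X N) (\<lambda>t. \<Psi> (g t))" by (simp add: o_def)
qed

section \<open>The weighted sequence space as a copy of \<open>ell1\<close>\<close>

locale weight =
  fixes w :: "nat \<Rightarrow> real"
  assumes weight_pos: "1 \<le> i \<Longrightarrow> 0 < w i"
begin

text \<open>Multiplying by the weight makes this isometric. Size 1 becomes index 0; the slot 0 of a
  sequence, always 0, is dropped.\<close>

definition to_ell1 :: "(nat \<Rightarrow> complex) \<Rightarrow> ell1" where
  "to_ell1 f = Ell1 (\<lambda>i. of_real (w (Suc i)) * f (Suc i))"

definition of_ell1 :: "ell1 \<Rightarrow> nat \<Rightarrow> complex" where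
  "of_ell1 x = (\<lambda>n. case n of 0 \<Rightarrow> 0 | Suc i \<Rightarrow> coord x i / of_real (w (Suc i)))"

lemma w_Suc: "0 < w (Suc i)"
  by (rule weight_pos) simp

lemma of_ell1_simps [simp]: "of_ell1 x 0 = 0" "of_ell1 x (Suc i) = coord x i / of_real (w (Suc i))"
  by (simp_all add: of_ell1_def)

lemma l1_iff: "f \<in> l1 w \<longleftrightarrow> f 0 = 0 \<and> summable (\<lambda>i. cmod (of_real (w (Suc i)) * f (Suc i)))"
  using summable_Suc_iff[of "\<lambda>n. w n * cmod (f n)"] less_imp_le[OF w_Suc]
  by (simp add: l1_def norm_mult abs_of_nonneg)

lemma coord_to_ell1: "f \<in> l1 w \<Longrightarrow> coord (to_ell1 f) i = of_real (w (Suc i)) * f (Suc i)"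
  by (simp add: to_ell1_def l1_iff coord_Ell1)

lemma of_ell1_l1 [simp]: "of_ell1 x \<in> l1 w"
  using summable_coord[of x] w_Suc by (simp add: l1_iff less_imp_neq[symmetric])

lemma to_of_ell1 [simp]: "to_ell1 (of_ell1 x) = x"
  using w_Suc by (intro ell1_eqI) (simp add: coord_to_ell1 less_imp_neq[symmetric])

lemma of_to_ell1 [simp]: "f \<in> l1 w \<Longrightarrow> of_ell1 (to_ell1 f) = f"
proof
  fix n assume "f \<in> l1 w"
  then show "of_ell1 (to_ell1 f) n = f n"
    using w_Suc by (cases n) (simp_all add: coord_to_ell1 less_imp_neq[symmetric] l1_iff)
qed

lemma norm_to_ell1: "f \<in> l1 w \<Longrightarrow> norm (to_ell1 f) = l1_norm w f"
proof -
  assume f: "f \<in> l1 w"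
  then have "summable (\<lambda>n. w n * cmod (f n))" "f 0 = 0" by (simp_all add: l1_def)
  then have "l1_norm w f = (\<Sum>i. w (Suc i) * cmod (f (Suc i)))"
    using suminf_split_head[of "\<lambda>n. w n * cmod (f n)"] by (simp add: l1_norm_def)
  then show ?thesis
    using f less_imp_le[OF w_Suc] by (simp add: norm_ell1_eq coord_to_ell1 norm_mult abs_of_nonneg)
qed

lemma of_ell1_add: "of_ell1 (x + y) = of_ell1 x + of_ell1 y"
  and of_ell1_diff: "of_ell1 (x - y) = of_ell1 x - of_ell1 y"
  and of_ell1_scaleC: "of_ell1 (scaleC c x) = seq_scale c (of_ell1 x)"
  by (rule ext; simp add: of_ell1_def seq_scale_def add_divide_distrib diff_divide_distrib split: nat.split)+

lemma l1_norm_of_ell1: "l1_norm w (of_ell1 x) = norm x"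
  using norm_to_ell1[of "of_ell1 x"] by simp

lemma to_ell1_eq_iff: "f \<in> l1 w \<Longrightarrow> to_ell1 f = x \<longleftrightarrow> f = of_ell1 x"
  by auto

lemma l1_scale:
  assumes "f \<in> l1 w"
  shows "seq_scale c f \<in> l1 w" "to_ell1 (seq_scale c f) = scaleC c (to_ell1 f)"
  using of_ell1_l1[of "scaleC c (to_ell1 f)"] to_of_ell1[of "scaleC c (to_ell1 f)"] assms
  by (simp_all add: of_ell1_scaleC)

lemma l1_closed:
  assumes "f \<in> l1 w" "g \<in> l1 w"
  shows "f + g \<in> l1 w" "f - g \<in> l1 w"
    "to_ell1 (f + g) = to_ell1 f + to_ell1 g" "to_ell1 (f - g) = to_ell1 f - to_ell1 g"
  using of_ell1_l1[of "to_ell1 f + to_ell1 g"] to_of_ell1[of "to_ell1 f + to_ell1 g"]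
    of_ell1_l1[of "to_ell1 f - to_ell1 g"] to_of_ell1[of "to_ell1 f - to_ell1 g"] assms
  by (simp_all add: of_ell1_add of_ell1_diff)

lemma isometric_copy_l1: "isometric_copy of_ell1 (l1 w) (l1_norm w)"
proof -
  have "range of_ell1 = l1 w" using of_to_ell1 of_ell1_l1 by (metis (no_types) image_iff rangeI subsetI subset_antisym)
  then show ?thesis by (simp add: isometric_copy_def of_ell1_diff l1_norm_of_ell1)
qed

lemma of_ell1_eq_iff: "of_ell1 x = of_ell1 y \<longleftrightarrow> x = y"
  using isometric_copyD(5)[OF isometric_copy_l1] by (auto dest: injD)

text \<open>\<open>to_ell1\<close> respects differences, scaling and the norm on
  \<open>l1 w\<close>, so all values on \<open>J\<close> are required to lie there; the filter sees
  no others.\<close>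

lemma has_norm_derivative_iff:
  assumes "\<And>s. s \<in> J \<Longrightarrow> f s \<in> l1 w" "t \<in> J" "D \<in> l1 w"
  shows "has_norm_derivative seq_scale (l1_norm w) f D t J \<longleftrightarrow>
    ((\<lambda>s. to_ell1 (f s)) has_vector_derivative to_ell1 D) (at t within J)"
proof -
  have eq: "l1_norm w (seq_scale (complex_of_real (inverse (s - t))) (f s - f t) - D)
      = norm (inverse (s - t) *\<^sub>R (to_ell1 (f s) - to_ell1 (f t)) - to_ell1 D)" if "s \<in> J" for s
    using assms(1)[OF that] assms(1)[OF assms(2)] assms(3)
    by (simp add: norm_to_ell1[symmetric] l1_closed l1_scale scaleC_of_real del: of_real_inverse)
  show ?thesis
    unfolding has_norm_derivative_def has_vector_derivative_iff_quotient
    by (subst LIM_zero_iff[symmetric], subst tendsto_norm_zero_iff[symmetric], rule tendsto_cong)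
       (unfold eventually_at_filter, intro always_eventually allI impI eq)
qed

end

locale weighted_fragmentation = weight +
  fixes a :: "nat \<Rightarrow> real" and b :: "nat \<Rightarrow> nat \<Rightarrow> real" and \<kappa> :: real
  assumes a_nonneg: "1 \<le> i \<Longrightarrow> 0 \<le> a i"
    and b_nonneg: "1 \<le> i \<Longrightarrow> 1 \<le> j \<Longrightarrow> 0 \<le> b i j"
    and b_zero: "1 \<le> j \<Longrightarrow> j \<le> i \<Longrightarrow> b i j = 0"
    and kappa: "0 < \<kappa>" "\<kappa> < 1" "2 \<le> j \<Longrightarrow> (\<Sum>i=1..j-1. w i * b i j) \<le> \<kappa> * w j"
begin

sublocale fragmentation "\<lambda>i. a (Suc i)" "\<lambda>i j. w (Suc i) * b (Suc i) (Suc j) / w (Suc j)" \<kappa>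
proof
  fix i j
  show "0 \<le> a (Suc i)" by (rule a_nonneg) simp
  show "0 \<le> w (Suc i) * b (Suc i) (Suc j) / w (Suc j)"
    using w_Suc[of i] w_Suc[of j] b_nonneg[of "Suc i" "Suc j"] by simp
  show "w (Suc i) * b (Suc i) (Suc j) / w (Suc j) = 0" if "j \<le> i"
    using that b_zero[of "Suc j" "Suc i"] by simp
  show "(\<Sum>i<j. w (Suc i) * b (Suc i) (Suc j) / w (Suc j)) \<le> \<kappa>"
  \<comment> \<open>The mass condition starts with size 2. For size 1, which is index 0 here, the
    column is empty.\<close>
  proof (cases "j = 0")
    case False
    have "(\<Sum>i=1..j. w i * b i (Suc j)) \<le> \<kappa> * w (Suc j)"
      using kappa(3)[of "Suc j"] False by simp
    also have "(\<Sum>i=1..j. w i * b i (Suc j)) = (\<Sum>i<j. w (Suc i) * b (Suc i) (Suc j))"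
      by (rule sum.reindex_bij_witness[of _ Suc "\<lambda>i. i - 1"]) auto
    finally show ?thesis
      using w_Suc[of j] by (simp add: sum_divide_distrib[symmetric] pos_divide_le_eq)
  qed (use kappa in simp)
qed (use kappa in simp_all)

lemma A_dom_iff: "f \<in> A_dom w a \<longleftrightarrow> f \<in> l1 w \<and> to_ell1 f \<in> loss_domain"
  by (auto simp: A_dom_def loss_domain_def coord_to_ell1 l1_iff mult_ac)

lemma A_op_eq:
  assumes "f \<in> A_dom w a"
  shows "A_op a f = - of_ell1 (loss (to_ell1 f))"
proof
  fix n
  show "A_op a f n = (- of_ell1 (loss (to_ell1 f))) n"
    using assms w_Suc
    by (cases n) (auto simp: A_op_def A_dom_iff coord_loss coord_to_ell1 less_imp_neq[symmetric] l1_iff)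
qed

lemma B_term_sums:
  assumes "f \<in> A_dom w a"
  shows "(\<lambda>k. B_term a b f (Suc i) (Suc i + 1 + k)) sums of_ell1 (gain (loss (to_ell1 f))) (Suc i)"
proof -
  let ?l = "loss (to_ell1 f)"
  have f: "f \<in> l1 w" "to_ell1 f \<in> loss_domain" using assms by (simp_all add: A_dom_iff)
  have summand: "coord ?l j * coord (gain_column j) i / of_real (w (Suc i)) = B_term a b f (Suc i) (Suc j)" for j
    using w_Suc[of i] w_Suc[of j]
    by (simp add: coord_loss f coord_gain_column coord_to_ell1 B_term_def field_simps less_imp_neq[symmetric])
  have "(\<lambda>j. coord ?l j * coord (gain_column j) i / of_real (w (Suc i))) sums
      (coord (gain ?l) i / of_real (w (Suc i)))"
    unfolding gain_def by (intro sums_divide coord_of_columns[of _ \<kappa>] norm_gain_column)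
  then have "(\<lambda>j. B_term a b f (Suc i) (Suc j)) sums of_ell1 (gain ?l) (Suc i)"
    unfolding summand by simp
  \<comment> \<open>Triangularity removes the terms up to index \<open>i\<close>, so the series may
    start at size \<open>Suc i + 1\<close>, as in \<open>B_op\<close>.\<close>
  moreover have "B_term a b f (Suc i) (Suc j) = 0" if "j < Suc i" for j
    using that b_zero[of "Suc j" "Suc i"] by (simp add: B_term_def)
  ultimately have "(\<lambda>k. B_term a b f (Suc i) (Suc (k + Suc i))) sums of_ell1 (gain ?l) (Suc i)"
    by (subst sums_zero_iff_shift)
  then show ?thesis by (simp add: add_ac)
qed

text \<open>The gain is a bounded operator applied to the loss, so the domain of \<open>A\<close>
  lies in that of \<open>B\<close> and is the domain of the generator.\<close>

lemma B_op_eq: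
  assumes "f \<in> A_dom w a"
  shows "f \<in> B_dom w a b" "B_op a b f = of_ell1 (gain (loss (to_ell1 f)))"
proof -
  note B = B_term_sums[OF assms]
  show eq: "B_op a b f = of_ell1 (gain (loss (to_ell1 f)))"
  proof
    fix n
    show "B_op a b f n = of_ell1 (gain (loss (to_ell1 f))) n"
      using sums_unique[OF B] by (cases n) (simp_all add: B_op_def)
  qed
  have "summable (\<lambda>i. B_term a b f n (n + 1 + i))" if "n \<ge> 1" for n
    using sums_summable[OF B[of "n - 1"]] that by simp
  then show "f \<in> B_dom w a b"
    using assms by (simp add: B_dom_def eq A_dom_def)
qed

lemma G_dom_iff: "f \<in> G_dom w a b \<longleftrightarrow> f \<in> l1 w \<and> to_ell1 f \<in> loss_domain"
  using B_op_eq(1) by (auto simp: G_dom_def A_dom_iff)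

lemma G_op_eq:
  assumes "f \<in> G_dom w a b"
  shows "G_op a b f = of_ell1 (frag_gen (to_ell1 f))"
proof -
  have "f \<in> A_dom w a" using assms by (simp add: G_dom_def)
  then show ?thesis by (simp add: G_op_def A_op_eq B_op_eq frag_gen_def of_ell1_diff)
qed

section \<open>Identification of the chosen semigroup\<close>

text \<open>To be applied to whatever semigroup the choice in \<open>frag_semigroup\<close> selects:
  in coordinates it has the same generator as \<open>S\<close>, which forces equality.\<close>

lemma c0_semigroup_of_C0_semigroup:
  assumes U: "C0_semigroup seq_scale (l1 w) (l1_norm w) U"
    and gen: "is_generator seq_scale (l1 w) (l1_norm w) U (G_dom w a b) (G_op a b)"
  shows "c0_semigroup (\<lambda>t x. to_ell1 (U t (of_ell1 x))) loss_domain frag_gen"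
proof (rule c0_semigroup.intro)
  have U_l1: "U t f \<in> l1 w" if "0 \<le> t" "f \<in> l1 w" for t f
    using U that by (auto simp: C0_semigroup_def)
  fix t s :: real and x y :: ell1
  show "to_ell1 (U 0 (of_ell1 x)) = x"
    using U by (simp add: C0_semigroup_def)
  show "bounded_linear (\<lambda>x. to_ell1 (U t (of_ell1 x)))" if t: "0 \<le> t"
  proof -
    have lin: "linear_map_on seq_scale seq_scale (l1 w) (U t)"
      using U t by (simp add: C0_semigroup_def)
    obtain C where C: "\<And>f. f \<in> l1 w \<Longrightarrow> l1_norm w (U t f) \<le> C * l1_norm w f"
    proof -
      have "\<exists>C. \<forall>f\<in>l1 w. l1_norm w (U t f) \<le> C * l1_norm w f"
        using U t by (simp add: C0_semigroup_def)
      then show ?thesis using that by blast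
    qed
    show ?thesis
    proof (rule bounded_linear_intro[of _ C])
      fix x y r
      show "to_ell1 (U t (of_ell1 (x + y))) = to_ell1 (U t (of_ell1 x)) + to_ell1 (U t (of_ell1 y))"
        using lin t by (simp add: of_ell1_add linear_map_on_def l1_closed U_l1)
      show "to_ell1 (U t (of_ell1 (r *\<^sub>R x))) = r *\<^sub>R to_ell1 (U t (of_ell1 x))"
        using lin t by (simp add: scaleC_of_real[symmetric] of_ell1_scaleC linear_map_on_def l1_scale U_l1)
      show "norm (to_ell1 (U t (of_ell1 x))) \<le> norm x * C"
        using C[of "of_ell1 x"] t by (simp add: norm_to_ell1 U_l1 l1_norm_of_ell1 mult.commute)
    qed
  qed
  show "to_ell1 (U (s + t) (of_ell1 x)) = to_ell1 (U s (of_ell1 (to_ell1 (U t (of_ell1 x)))))"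
    if "0 \<le> s" "0 \<le> t"
    using U that by (simp add: C0_semigroup_def U_l1)
  show "((\<lambda>t. to_ell1 (U t (of_ell1 x))) \<longlongrightarrow> x) (at_right 0)"
  proof (subst LIM_zero_iff[symmetric], subst tendsto_norm_zero_iff[symmetric])
    have "((\<lambda>t. l1_norm w (U t (of_ell1 x) - of_ell1 x)) \<longlongrightarrow> 0) (at_right 0)"
      using U by (simp add: C0_semigroup_def)
    moreover have "eventually (\<lambda>t. l1_norm w (U t (of_ell1 x) - of_ell1 x)
        = norm (to_ell1 (U t (of_ell1 x)) - x)) (at_right 0)"
      using eventually_at_right_less[of "0::real"]
      by eventually_elim (simp add: norm_to_ell1[symmetric] l1_closed U_l1)
    ultimately show "((\<lambda>t. norm (to_ell1 (U t (of_ell1 x)) - x)) \<longlongrightarrow> 0) (at_right 0)"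
      by (rule Lim_transform_eventually)
  qed
  have "((\<lambda>t. to_ell1 (U t (of_ell1 x))) has_vector_derivative to_ell1 (of_ell1 y)) (at 0 within {0..})
      \<longleftrightarrow> of_ell1 x \<in> G_dom w a b \<and> of_ell1 y = G_op a b (of_ell1 x)"
    using gen has_norm_derivative_iff[of "{0..}" "\<lambda>t. U t (of_ell1 x)" 0 "of_ell1 y"]
    by (simp add: is_generator_def U_l1)
  moreover have "of_ell1 y = G_op a b (of_ell1 x) \<longleftrightarrow> y = frag_gen x" if "of_ell1 x \<in> G_dom w a b"
    by (simp add: G_op_eq[OF that] of_ell1_eq_iff)
  ultimately show "((\<lambda>t. to_ell1 (U t (of_ell1 x))) has_vector_derivative y) (at 0 within {0..})
      \<longleftrightarrow> x \<in> loss_domain \<and> y = frag_gen x"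
    by (auto simp: G_dom_iff)
qed

sublocale smoothing_semigroup S loss_domain frag_gen
  by (rule smoothing_semigroup_S)

lemma C0_semigroup_exists:
  "\<exists>U. C0_semigroup seq_scale (l1 w) (l1_norm w) U \<and>
    is_generator seq_scale (l1 w) (l1_norm w) U (G_dom w a b) (G_op a b)"
proof (intro exI conjI)
  let ?U = "\<lambda>t f. of_ell1 (S t (to_ell1 f))"
  show "C0_semigroup seq_scale (l1 w) (l1_norm w) ?U"
    unfolding C0_semigroup_def
  proof (intro conjI allI impI ballI)
    fix t :: real assume t: "0 \<le> t"
    show "?U t ` l1 w \<subseteq> l1 w" by auto
    show "linear_map_on seq_scale seq_scale (l1 w) (?U t)"
      using clin_S[OF t] t
      by (simp add: linear_map_on_def l1_closed l1_scale clin_def of_ell1_scaleC of_ell1_add T_linear_simps)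
    show "\<exists>C. \<forall>f\<in>l1 w. l1_norm w (?U t f) \<le> C * l1_norm w f"
      using norm_S[OF t] by (intro exI[of _ 1]) (simp add: l1_norm_of_ell1 norm_to_ell1[symmetric])
  next
    fix f assume f: "f \<in> l1 w"
    show "?U 0 f = f" using f by simp
    show "((\<lambda>t. l1_norm w (?U t f - f)) \<longlongrightarrow> 0) (at_right 0)"
      using right_continuous[of "to_ell1 f"] f
      by (subst (asm) LIM_zero_iff[symmetric], subst (asm) tendsto_norm_zero_iff[symmetric])
         (simp add: norm_to_ell1[symmetric] l1_closed)
    show "?U (s + t) f = ?U s (?U t f)" if "0 \<le> s" "0 \<le> t" for s t
      using that by (simp add: T_add)
  qed
  show "is_generator seq_scale (l1 w) (l1_norm w) ?U (G_dom w a b) (G_op a b)"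
    unfolding is_generator_def
  proof (intro ballI)
    fix f g assume f: "f \<in> l1 w" and g: "g \<in> l1 w"
    have "has_norm_derivative seq_scale (l1_norm w) (\<lambda>t. ?U t f) g 0 {0..} \<longleftrightarrow>
        to_ell1 f \<in> loss_domain \<and> to_ell1 g = frag_gen (to_ell1 f)"
      using g by (simp add: has_norm_derivative_iff generator)
    also have "to_ell1 g = frag_gen (to_ell1 f) \<longleftrightarrow> g = of_ell1 (frag_gen (to_ell1 f))"
      using g by (rule to_ell1_eq_iff)
    finally show "has_norm_derivative seq_scale (l1_norm w) (\<lambda>t. ?U t f) g 0 {0..} \<longleftrightarrow>
        f \<in> G_dom w a b \<and> g = G_op a b f"
      using f by (auto simp: G_dom_iff G_op_eq)
  qed
qed

lemma frag_semigroup_eq: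
  assumes "f \<in> l1 w" "0 \<le> t"
  shows "frag_semigroup w a b t f = of_ell1 (S t (to_ell1 f))"
proof -
  let ?U = "frag_semigroup w a b"
  have U: "C0_semigroup seq_scale (l1 w) (l1_norm w) ?U \<and>
      is_generator seq_scale (l1 w) (l1_norm w) ?U (G_dom w a b) (G_op a b)"
    using someI_ex[OF C0_semigroup_exists] unfolding frag_semigroup_def .
  then have "c0_semigroup (\<lambda>t x. to_ell1 (?U t (of_ell1 x))) loss_domain frag_gen"
    by (intro c0_semigroup_of_C0_semigroup) auto
  moreover have "\<exists>d. (\<forall>m. d m \<in> loss_domain) \<and> d \<longlonglongrightarrow> x" for x
    using iterated_domain_dense[where \<mu> = 0 and n = 1 and x = x] by simp
  ultimately have "to_ell1 (?U t (of_ell1 (to_ell1 f))) = S t (to_ell1 f)"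
    using c0_semigroup_unique c0_semigroup_axioms assms(2) by blast
  moreover have "?U t f \<in> l1 w" using U assms by (auto simp: C0_semigroup_def)
  ultimately show ?thesis using assms(1) by (metis of_to_ell1)
qed

text \<open>An infimum below \<open>\<mu>\<close> provides an exponential bound with a rate below
  \<open>\<mu>\<close>, the hypothesis of \<open>generator_shift_bij\<close>.\<close>

lemma resolvent_bij:
  assumes "growth_bound (l1 w) (l1_norm w) (frag_semigroup w a b) < ereal \<mu>"
  shows "bij_betw (\<lambda>x. frag_gen x - \<mu> *\<^sub>R x) loss_domain UNIV"
proof -
  obtain \<omega> M where M: "\<And>t f. 0 \<le> t \<Longrightarrow> f \<in> l1 w \<Longrightarrow>
      l1_norm w (frag_semigroup w a b t f) \<le> M * exp (\<omega> * t) * l1_norm w f" and "\<omega> < \<mu>"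
  proof -
    obtain \<omega> M where "\<forall>t\<ge>0. \<forall>f\<in>l1 w. l1_norm w (frag_semigroup w a b t f) \<le> M * exp (\<omega> * t) * l1_norm w f"
      "\<omega> < \<mu>"
      using assms unfolding growth_bound_def Inf_less_iff by auto
    then show ?thesis using that by blast
  qed
  show ?thesis
  proof (rule generator_shift_bij[OF _ \<open>\<omega> < \<mu>\<close>])
    fix t :: real and x assume "0 \<le> t"
    then show "norm (S t x) \<le> M * exp (\<omega> * t) * norm x"
      using M[of t "of_ell1 x"] by (simp add: frag_semigroup_eq l1_norm_of_ell1)
  qed
qed

lemma l1_cone_iff: "f \<in> l1_cone w \<longleftrightarrow> f \<in> l1 w \<and> (\<forall>i. coord (to_ell1 f) i \<in> \<real>\<^sub>\<ge>\<^sub>0)"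
proof -
  have "of_real (w (Suc i)) * z \<in> \<real>\<^sub>\<ge>\<^sub>0 \<longleftrightarrow> z \<in> \<real>\<^sub>\<ge>\<^sub>0" for z :: complex and i
    using w_Suc[of i] by (auto simp: complex_nonneg_Reals_iff zero_le_mult_iff)
  moreover have "f 0 = 0" if "f \<in> l1 w" using that by (simp add: l1_iff)
  ultimately show ?thesis
    by (auto simp: l1_cone_def coord_to_ell1) (metis not0_implies_Suc nonneg_Reals_zero_I)
qed

end


section \<open>The Sobolev tower\<close>

text \<open>On a new level the operator is known to be continuous, but additive and isometric only
  on a dense domain; both properties pass to limits. Surjectivity comes from completeness of the
  source: the preimages of approximants to \<open>y\<close> form a Cauchy sequence, as distances are
  preserved.\<close>

lemma isometric_copy_extend:
  fixes F :: "'e::banach \<Rightarrow> 'v::ab_group_add"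
  assumes normed: "normed_space_on sc Y M" "vector_space sc"
    and cont: "continuous_map euclidean (norm_topology Y M) F"
    and D_diff: "\<And>x y. x \<in> D \<Longrightarrow> y \<in> D \<Longrightarrow> x - y \<in> D \<and> F (x - y) = F x - F y"
    and D_norm: "\<And>x. x \<in> D \<Longrightarrow> M (F x) = norm x"
    and D_dense: "\<And>x \<epsilon>. 0 < \<epsilon> \<Longrightarrow> \<exists>d\<in>D. dist x d < \<epsilon>"
    and image_dense: "norm_topology Y M closure_of (F ` D) = Y"
  shows "isometric_copy F Y M"
proof -
  interpret vector_space sc by fact
  have metric: "Metric_space Y (norm_dist Y M)"
    by (rule normed_space_on_Metric_space[OF normed])
  interpret m: Metric_space Y "norm_dist Y M" by (rule metric)
  have "subspace Y" using normed(1) by (simp add: normed_space_on_def)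
  note diff = subspace_diff[OF this] and zero = subspace_0[OF this]
  have comm: "M (x - y) = M (y - x)" if "x \<in> Y" "y \<in> Y" for x y
    using m.commute[of x y] that by (simp add: norm_dist_def)
  have tri: "M (x - z) \<le> M (x - y) + M (y - z)" if "x \<in> Y" "y \<in> Y" "z \<in> Y" for x y z
    using m.triangle[of x y z] that by (simp add: norm_dist_def)
  have pos: "0 \<le> M x" "M x = 0 \<longleftrightarrow> x = 0" if "x \<in> Y" for x
    using normed(1) that by (auto simp: normed_space_on_def)
  have F: "\<And>x. F x \<in> Y"
    and F_cont: "\<And>x \<epsilon>. 0 < \<epsilon> \<Longrightarrow> \<exists>\<delta>>0. \<forall>y. dist x y < \<delta> \<longrightarrow> M (F x - F y) < \<epsilon>"
    using cont unfolding continuous_map_norm_topology_iff[OF metric] by auto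
  have approx: "\<exists>d\<in>D. norm (x - d) < \<epsilon> \<and> M (F x - F d) < \<epsilon>" if \<epsilon>: "0 < \<epsilon>" for x \<epsilon>
  proof -
    obtain \<delta> where \<delta>: "\<delta> > 0" "\<And>y. dist x y < \<delta> \<Longrightarrow> M (F x - F y) < \<epsilon>"
      using F_cont[OF \<epsilon>] by blast
    obtain d where "d \<in> D" "dist x d < min \<delta> \<epsilon>" using D_dense[of "min \<delta> \<epsilon>" x] \<delta>(1) \<epsilon> by auto
    then show ?thesis using \<delta>(2) by (auto simp: dist_norm)
  qed
  have D_norm_diff: "M (F x - F y) = norm (x - y)" if "x \<in> D" "y \<in> D" for x y
    using D_diff[OF that] D_norm[of "x - y"] by metis
  have norm: "M (F x) = norm x" for x
  proof -
    have "\<bar>M (F x) - norm x\<bar> \<le> 0 + \<epsilon>" if "0 < \<epsilon>" for \<epsilon>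
    proof -
      obtain d where d: "d \<in> D" "norm (x - d) < \<epsilon> / 2" "M (F x - F d) < \<epsilon> / 2"
        using approx[of "\<epsilon> / 2" x] \<open>0 < \<epsilon>\<close> by auto
      have "M (F x) \<le> M (F x - F d) + M (F d)" "M (F d) \<le> M (F d - F x) + M (F x)"
        using tri[OF F F zero, of x d] tri[OF F F zero, of d x] by auto
      then have "\<bar>M (F x) - M (F d)\<bar> < \<epsilon> / 2" using comm[OF F F, of d x] d(3) by linarith
      moreover have "\<bar>norm d - norm x\<bar> < \<epsilon> / 2"
        using norm_triangle_ineq3[of d x] d(2) by (simp add: norm_minus_commute)
      ultimately show ?thesis using D_norm[OF d(1)] by linarith
    qed
    then have "\<bar>M (F x) - norm x\<bar> \<le> 0" by (rule field_le_epsilon)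
    then show ?thesis by simp
  qed
  have additive: "F (x - y) = F x - F y" for x y
  proof -
    have "M (F (x - y) - (F x - F y)) \<le> 0 + \<epsilon>" if "0 < \<epsilon>" for \<epsilon>
    proof -
      \<comment> \<open>Six errors: the approximations of \<open>x\<close>, \<open>y\<close> and
        \<open>x - y\<close>, each in the source and in the target.\<close>
      have "0 < \<epsilon> / 6" using \<open>0 < \<epsilon>\<close> by simp
      note approx6 = approx[OF this]
      obtain d e g where d: "d \<in> D" "norm (x - d) < \<epsilon> / 6" "M (F x - F d) < \<epsilon> / 6"
        and e: "e \<in> D" "norm (y - e) < \<epsilon> / 6" "M (F y - F e) < \<epsilon> / 6"
        and g: "g \<in> D" "norm (x - y - g) < \<epsilon> / 6" "M (F (x - y) - F g) < \<epsilon> / 6"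
        using approx6[of x] approx6[of y] approx6[of "x - y"] by blast
      have de: "d - e \<in> D" "F (d - e) = F d - F e" using D_diff d e by auto
      have "M (F (x - y) - (F x - F y)) \<le> M (F (x - y) - F g) + M (F g - (F x - F y))"
        by (intro tri diff F)
      also have "M (F g - (F x - F y)) \<le> M (F g - F (d - e)) + M (F (d - e) - (F x - F y))"
        by (intro tri diff F)
      also have "M (F (d - e) - (F x - F y)) \<le> M (F d - F e - (F d - F y)) + M (F d - F y - (F x - F y))"
        unfolding de by (intro tri diff F)
      also have "M (F d - F e - (F d - F y)) = M (F y - F e)" by (simp add: algebra_simps)
      also have "M (F d - F y - (F x - F y)) = M (F x - F d)" using comm[OF F F, of d x] by simp
      also have "M (F g - F (d - e)) = norm (g - (d - e))" by (rule D_norm_diff[OF g(1) de(1)])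
      also have "g - (d - e) = (x - d) - (y - e) - (x - y - g)" by simp
      also have "norm ((x - d) - (y - e) - (x - y - g)) \<le> norm (x - d) + norm (y - e) + norm (x - y - g)"
        using norm_triangle_ineq4[of "(x - d) - (y - e)" "x - y - g"] norm_triangle_ineq4[of "x - d" "y - e"]
        by linarith
      finally show ?thesis using d e g by linarith
    qed
    then have "M (F (x - y) - (F x - F y)) \<le> 0" by (rule field_le_epsilon)
    then show ?thesis using pos[OF diff[OF F diff[OF F F]], of "x - y" x y] by simp
  qed
  have "\<exists>x. y = F x" if y: "y \<in> Y" for y
  proof -
    have "\<exists>d\<in>D. M (y - F d) < inverse (real (Suc n))" for n
      using closure_of_norm_topology[OF metric, of y "F ` D" "inverse (real (Suc n))"] y
      by (auto simp: image_dense)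
    then obtain d where d: "\<And>n. d n \<in> D" "\<And>n. M (y - F (d n)) < inverse (real (Suc n))" by metis
    have "Cauchy d"
    proof (rule CauchyI)
      fix e :: real assume "0 < e"
      then obtain k where k: "inverse (real (Suc k)) < e / 2" using reals_Archimedean[of "e / 2"] by auto
      have small: "M (y - F (d n)) < e / 2" if "n \<ge> k" for n
      proof -
        have "inverse (real (Suc n)) \<le> inverse (real (Suc k))"
          using that by (intro le_imp_inverse_le) auto
        then show ?thesis using d(2)[of n] k by linarith
      qed
      have "norm (d m - d n) < e" if "m \<ge> k" "n \<ge> k" for m n
        using tri[OF F y F, of "d m" "d n"] comm[OF F y, of "d m"] small[OF that(1)] small[OF that(2)]
          D_norm_diff[OF d(1) d(1), of m n] by linarith
      then show "\<exists>k. \<forall>m\<ge>k. \<forall>n\<ge>k. norm (d m - d n) < e" by blast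
    qed
    then obtain x where x: "d \<longlonglongrightarrow> x" using Cauchy_convergent convergentD by blast
    have "(\<lambda>n. inverse (real (Suc n)) + norm (d n - x)) \<longlonglongrightarrow> 0 + norm (x - x)"
      by (intro tendsto_intros LIMSEQ_inverse_real_of_nat x)
    moreover have "M (y - F x) \<le> inverse (real (Suc n)) + norm (d n - x)" for n
      using tri[OF y F F, of x "d n"] d(2)[of n] norm[of "d n - x"] by (simp add: additive)
    ultimately have "M (y - F x) \<le> 0" using LIMSEQ_le_const by fastforce
    then show ?thesis using pos[OF diff[OF y F], of x] by auto
  qed
  then show ?thesis unfolding isometric_copy_def using F norm additive by auto
qed

section \<open>Levels of the tower as copies of \<open>ell1\<close>\<close>

locale frag_tower = weighted_fragmentation w a b \<kappa> + sobolev_tower w a b \<mu> sc \<iota> X N \<G>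
  for w a :: "nat \<Rightarrow> real" and b :: "nat \<Rightarrow> nat \<Rightarrow> real" and \<kappa> \<mu> :: real
    and sc :: "complex \<Rightarrow> 'v::ab_group_add \<Rightarrow> 'v" and \<iota> X N \<G> +
  assumes mu: "growth_bound (l1 w) (l1_norm w) (frag_semigroup w a b) < ereal \<mu>"
begin

abbreviation H :: "ell1 \<Rightarrow> ell1" where
  "H \<equiv> \<lambda>x. frag_gen x - \<mu> *\<^sub>R x"

lemma H_bij: "bij_betw H loss_domain UNIV"
  by (rule resolvent_bij[OF mu])

text \<open>The composite of \<open>k\<close> operators of the tower. Each \<open>x\<close> names
  the element of level \<open>k\<close> that stands for \<open>(H ^^ k) x\<close>, whether or not
  \<open>x\<close> lies in the domain of that power.\<close>

primrec level :: "nat \<Rightarrow> ell1 \<Rightarrow> 'v" where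
  "level 0 = (\<lambda>x. \<iota> (of_ell1 x))"
| "level (Suc k) = (\<lambda>x. \<G> (Suc k) (level k x))"

text \<open>The three claims feed each other. On the domain,
  \<open>level (Suc k) x = level k (H x)\<close>. As \<open>H\<close> is onto, these values fill
  \<open>X k\<close>, which is dense in the next level; the norm there undoes \<open>\<G> k\<close>
  and returns \<open>norm x\<close>. Continuity of \<open>\<G> (Suc k)\<close> extends this to all
  of \<open>ell1\<close>.\<close>

lemma level_properties:
  "isometric_copy (level k) (X k) (N k) \<and>
    tower_dom (\<iota> ` G_dom w a b) X k = level k ` loss_domain \<and>
    (\<forall>x\<in>loss_domain. \<G> k (level k x) = level k (H x))"
proof (induction k)
  case 0
  have \<iota>_diff: "\<iota> (f - g) = \<iota> f - \<iota> g" if "f \<in> l1 w" "g \<in> l1 w" for f g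
  proof -
    have "\<iota> ((f - g) + g) = \<iota> (f - g) + \<iota> g"
      using embed(1) that l1_closed(2)[OF that] unfolding linear_map_on_def by blast
    then show ?thesis by simp
  qed
  have "range (level 0) = X 0"
    unfolding X_0 isometric_copyD(1)[OF isometric_copy_l1, symmetric] by auto
  then have "isometric_copy (level 0) (X 0) (N 0)"
    by (simp add: isometric_copy_def of_ell1_diff \<iota>_diff N_0 l1_norm_of_ell1)
  moreover have "G_dom w a b = of_ell1 ` loss_domain"
    using of_to_ell1 by (auto simp: G_dom_iff image_iff) (metis of_to_ell1)
  then have "tower_dom (\<iota> ` G_dom w a b) X 0 = level 0 ` loss_domain"
    by (auto simp: tower_dom_def)
  moreover have "\<G> 0 (level 0 x) = level 0 (H x)" if "x \<in> loss_domain" for x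
  proof -
    have "of_ell1 x \<in> G_dom w a b" using that by (simp add: G_dom_iff)
    then show ?thesis
      by (simp add: \<G>_0 G_op_eq of_ell1_diff of_ell1_scaleC[symmetric] scaleC_of_real)
  qed
  ultimately show ?case by blast
next
  case (Suc k)
  then have iso: "isometric_copy (level k) (X k) (N k)"
    and dom: "tower_dom (\<iota> ` G_dom w a b) X k = level k ` loss_domain"
    and \<G>: "\<And>x. x \<in> loss_domain \<Longrightarrow> \<G> k (level k x) = level k (H x)" by auto
  note I = isometric_copyD[OF iso]
  have level_Suc: "level (Suc k) x = level k (H x)" if "x \<in> loss_domain" for x
    using \<G>_extends[of "level k x" k] \<G>[OF that] that by (simp add: dom)
  \<comment> \<open>This identity gives both density of the image in the next level and the domain
    of the next operator.\<close>
  have image: "level (Suc k) ` loss_domain = X k"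
  proof -
    have "level (Suc k) ` loss_domain = level k ` H ` loss_domain"
      unfolding image_image using level_Suc by (intro image_cong) auto
    also have "\<dots> = X k" using H_bij I(1) by (simp add: bij_betw_def)
    finally show ?thesis .
  qed
  have inj: "inj_on (\<G> k) (tower_dom (\<iota> ` G_dom w a b) X k)"
    unfolding dom
  proof (rule inj_onI, clarify)
    fix x y assume xy: "x \<in> loss_domain" "y \<in> loss_domain" "\<G> k (level k x) = \<G> k (level k y)"
    then have "H x = H y" using I(5) by (simp only: \<G>) (blast dest: injD)
    then have "x = y" using H_bij xy unfolding bij_betw_def by (blast dest: inj_onD)
    then show "level k x = level k y" by simp
  qed
  from completion[of k] have XX: "X k \<subseteq> X (Suc k)"
    and N_Suc: "\<And>y. y \<in> X k \<Longrightarrow>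
      N (Suc k) y = N k (the_inv_into (tower_dom (\<iota> ` G_dom w a b) X k) (\<G> k) y)"
    and normed: "normed_space_on sc (X (Suc k)) (N (Suc k))"
    and dense: "norm_topology (X (Suc k)) (N (Suc k)) closure_of X k = X (Suc k)"
    unfolding is_completion_def banach_space_on_def by auto
  have "isometric_copy (level (Suc k)) (X (Suc k)) (N (Suc k))"
  proof (rule isometric_copy_extend[OF normed ambient, where D = loss_domain])
    have "continuous_map euclidean (norm_topology (X (Suc k)) (N (Suc k))) (\<G> (Suc k) \<circ> level k)"
      by (rule continuous_map_compose[OF homeomorphic_imp_continuous_map \<G>_continuous])
         (rule isometric_copy_homeomorphic[OF iso])
    then show "continuous_map euclidean (norm_topology (X (Suc k)) (N (Suc k))) (level (Suc k))"
      by (simp add: o_def)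
    fix x assume x: "x \<in> loss_domain"
    have "the_inv_into (tower_dom (\<iota> ` G_dom w a b) X k) (\<G> k) (level k (H x)) = level k x"
      by (rule the_inv_into_f_eq[OF inj \<G>[OF x]]) (use x dom in auto)
    then show "N (Suc k) (level (Suc k) x) = norm x"
      using N_Suc[of "level k (H x)"] I(1,3) by (simp only: level_Suc[OF x]) auto
    fix y assume y: "y \<in> loss_domain"
    have xy: "x - y \<in> loss_domain" "H (x - y) = H x - H y"
      using domain_diff[OF x y] by (simp_all add: algebra_simps)
    then show "x - y \<in> loss_domain \<and> level (Suc k) (x - y) = level (Suc k) x - level (Suc k) y"
      by (simp only: level_Suc x y I(2) simp_thms)
  next
    fix x and \<epsilon> :: real assume "0 < \<epsilon>"
    obtain d where "\<And>m. d m \<in> loss_domain" "d \<longlonglongrightarrow> x"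
      using iterated_domain_dense[where \<mu> = 0 and n = 1 and x = x] by auto
    then show "\<exists>d\<in>loss_domain. dist x d < \<epsilon>"
      using metric_LIMSEQ_D[of d x \<epsilon>] \<open>0 < \<epsilon>\<close> by (metis dist_commute order_refl)
  qed (use dense image in simp)
  moreover have "tower_dom (\<iota> ` G_dom w a b) X (Suc k) = level (Suc k) ` loss_domain"
    using image by (simp add: tower_dom_def)
  moreover have "\<G> (Suc k) (level (Suc k) x) = level (Suc k) (H x)" if "x \<in> loss_domain" for x
    by (subst level_Suc[OF that]) simp
  ultimately show ?case by blast
qed

lemma isometric_copy_level: "isometric_copy (level k) (X k) (N k)"
  using level_properties by blast

lemma level_Suc_eq: "x \<in> loss_domain \<Longrightarrow> level (Suc k) x = level k (H x)"
  using level_properties[of k] \<G>_extends[of "level k x" k] by simp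

text \<open>Where the power of \<open>H\<close> is defined, the abstract level meets the sequence
  space; this is how regular values are recognised as sequences.\<close>

lemma level_eq:
  assumes "x \<in> iterated_domain loss_domain H n"
  shows "level n x = level 0 ((H ^^ n) x)"
  using assms
proof (induction n arbitrary: x)
  case (Suc n)
  then have x: "x \<in> loss_domain" "H x \<in> iterated_domain loss_domain H n" by auto
  show ?case
    unfolding level_Suc_eq[OF x(1)] Suc.IH[OF x(2)] funpow_Suc_right by simp
qed simp

lemma level_0_eq: "f \<in> l1 w \<Longrightarrow> level 0 (to_ell1 f) = \<iota> f"
  by simp

text \<open>Since \<open>H\<close> is onto, every sequence has a preimage \<open>z\<close> under
  \<open>H ^^ n\<close>, and \<open>z\<close> is its coordinate at level \<open>n\<close>.\<close>

lemma embed_level: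
  assumes "f \<in> l1 w"
  obtains z where "z \<in> iterated_domain loss_domain H n" "(H ^^ n) z = to_ell1 f" "\<iota> f = level n z"
proof -
  obtain z where z: "z \<in> iterated_domain loss_domain H n" "(H ^^ n) z = to_ell1 f"
    using iterated_surj[OF H_bij] by blast
  then have "\<iota> f = level n z"
    using level_0_eq[OF assms] by (simp only: level_eq)
  then show ?thesis by (rule that[OF z])
qed

section \<open>The extended semigroup, solutions and positivity\<close>

definition extension :: "nat \<Rightarrow> real \<Rightarrow> 'v \<Rightarrow> 'v" where
  "extension n t y = level n (S t (inv (level n) y))"

lemma extension_level: "extension n t (level n x) = level n (S t x)"
  by (simp add: extension_def isometric_copyD(5)[OF isometric_copy_level])

lemma extension_continuous:
  assumes "0 \<le> t"
  shows "continuous_map (norm_topology (X n) (N n)) (norm_topology (X n) (N n)) (extension n t)"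
proof -
  note iso = isometric_copy_homeomorphic[OF isometric_copy_level[of n]]
  have "continuous_map euclidean euclidean (S t)"
    using bounded_linear.continuous_on[OF bounded_linear_T[OF assms] continuous_on_id] by simp
  from continuous_map_compose[OF continuous_map_compose[OF iso(2) this]
      homeomorphic_imp_continuous_map[OF iso(1)]]
  have "continuous_map (norm_topology (X n) (N n)) (norm_topology (X n) (N n)) (level n \<circ> (S t \<circ> inv (level n)))" .
  then show ?thesis by (simp add: o_def extension_def[abs_def])
qed

lemma level_orbit:
  assumes "0 \<le> t" "z \<in> iterated_domain loss_domain H n"
  shows "level n (S t z) = level 0 (S t ((H ^^ n) z))"
  unfolding level_eq[OF iterated_domain_invariant(1)[OF assms]] iterated_domain_invariant(2)[OF assms] ..

text \<open>\<open>extension\<close> is one admissible choice, and any other agrees with it: the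
  space is Hausdorff, and the sequences are dense because they contain the image of the dense set
  \<open>iterated_domain\<close>.\<close>

lemma extended_semigroup_eq:
  assumes "0 \<le> t" "y \<in> X n"
  shows "extended_semigroup w \<iota> (X n) (N n) (frag_semigroup w a b) t y = extension n t y"
proof -
  let ?top = "norm_topology (X n) (N n)"
  have iso: "isometric_copy (level n) (X n) (N n)" by (rule isometric_copy_level)
  let ?P = "\<lambda>T. continuous_map ?top ?top T \<and> (\<forall>f\<in>l1 w. T (\<iota> f) = \<iota> (frag_semigroup w a b t f))"
  have ext: "extension n t (\<iota> f) = \<iota> (frag_semigroup w a b t f)" if f: "f \<in> l1 w" for f
  proof -
    obtain z where z: "z \<in> iterated_domain loss_domain H n" "(H ^^ n) z = to_ell1 f" "\<iota> f = level n z"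
      using embed_level[OF f, of n] .
    show ?thesis
      unfolding z(3) extension_level level_orbit[OF assms(1) z(1)] z(2)
      using f assms(1) by (simp add: frag_semigroup_eq)
  qed
  have "?P (extended_semigroup w \<iota> (X n) (N n) (frag_semigroup w a b) t)"
    unfolding extended_semigroup_def
    by (rule someI[of ?P "extension n t"]) (use extension_continuous[OF assms(1)] ext in blast)
  moreover have "y \<in> ?top closure_of (\<iota> ` l1 w)"
  proof -
    obtain x where x: "y = level n x" using assms(2) isometric_copyD(1)[OF iso] by blast
    have "x \<in> closure (iterated_domain loss_domain H n)"
      using iterated_domain_dense[where \<mu> = \<mu> and n = n and x = x]
      unfolding closure_sequential by blast
    then have "y \<in> level n ` (euclidean closure_of iterated_domain loss_domain H n)" by (simp add: x)
    also have "\<dots> = ?top closure_of (level n ` iterated_domain loss_domain H n)"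
      by (rule homeomorphic_map_closure_of[OF isometric_copy_homeomorphic(1)[OF iso], symmetric]) simp
    also have "\<dots> \<subseteq> ?top closure_of (\<iota> ` l1 w)"
      by (rule closure_of_mono) (auto simp: level_eq)
    finally show ?thesis .
  qed
  ultimately show ?thesis
    using extension_continuous[OF assms(1)] Hausdorff_norm_topology[OF isometric_copy_Metric_space[OF iso]]
    by (elim forall_in_closure_of_eq conjE) (auto simp: ext)
qed

text \<open>For positive times smoothing places \<open>S t g\<close> in the domain of
  \<open>H ^^ n\<close>, so the value is the sequence \<open>h t\<close>. At time 0 only continuity
  at level \<open>n\<close> is claimed, and that is continuity of the orbit of
  \<open>g\<close>.\<close>

lemma level_is_solution:
  "acp_solution w a b \<iota> (X n) (N n) (level n g) (\<lambda>t. level n (S t g))"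
  unfolding acp_solution_def
proof (intro conjI exI)
  define h where "h t = (H ^^ n) (S t g)" for t
  let ?f = "\<lambda>t. of_ell1 (h t)"
  note smooth = iterated_smoothing(1)[where \<mu> = \<mu> and n = n]
  note deriv = iterated_orbit_derivative[where \<mu> = \<mu> and n = n and g = g, folded h_def]
  show "continuous_map (top_of_set {0..}) (norm_topology (X n) (N n)) (\<lambda>t. level n (S t g))"
    unfolding continuous_map_isometric_copy[OF isometric_copy_level] by (rule continuous_on_orbit)
  show "level n (S 0 g) = level n g" by simp
  show "\<forall>t>0. level n (S t g) = \<iota> (?f t)"
    using level_eq[OF smooth] by (simp add: h_def)
  have dom: "?f t \<in> G_dom w a b" if "0 < t" for t
    using deriv(1)[OF that] by (simp add: G_dom_iff)
  have norm_deriv: "has_norm_derivative seq_scale (l1_norm w) ?f (of_ell1 (frag_gen (h t))) t {0<..}"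
    if "0 < t" for t
    using deriv(2)[OF that] that by (simp add: has_norm_derivative_iff)
  show "C1_on seq_scale (l1 w) (l1_norm w) {0<..} ?f"
    unfolding C1_on_def
  proof (intro conjI ballI exI)
    show "continuous_map (top_of_set {0<..}) (norm_topology (l1 w) (l1_norm w)) (\<lambda>t. of_ell1 (frag_gen (h t)))"
      unfolding continuous_map_isometric_copy[OF isometric_copy_l1] h_def
      by (rule continuous_on_iterated_orbit(2))
  qed (use norm_deriv in auto)
  show "\<forall>t>0. ?f t \<in> A_dom w a \<inter> B_dom w a b \<and>
      has_norm_derivative seq_scale (l1_norm w) ?f (A_op a (?f t) + B_op a b (?f t)) t {0<..}"
  proof (intro allI impI conjI)
    fix t :: real assume t: "0 < t"
    show "?f t \<in> A_dom w a \<inter> B_dom w a b" using dom[OF t] by (simp add: G_dom_def)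
    have "A_op a (?f t) + B_op a b (?f t) = of_ell1 (frag_gen (h t))"
      using G_op_eq[OF dom[OF t]] by (simp add: G_op_def)
    then show "has_norm_derivative seq_scale (l1_norm w) ?f (A_op a (?f t) + B_op a b (?f t)) t {0<..}"
      using norm_deriv[OF t] by simp
  qed
qed

lemma solution_unique:
  assumes v: "acp_solution w a b \<iota> (X n) (N n) (level n g) v" and "0 \<le> t"
  shows "v t = level n (S t g)"
proof -
  note iso = isometric_copy_level[of n]
  from v obtain f where cont: "continuous_map (top_of_set {0..}) (norm_topology (X n) (N n)) v"
    and v0: "v 0 = level n g" and vf: "\<And>t. 0 < t \<Longrightarrow> v t = \<iota> (f t)"
    and f: "\<And>t. 0 < t \<Longrightarrow> f t \<in> A_dom w a \<inter> B_dom w a b"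
    and f': "\<And>t. 0 < t \<Longrightarrow> has_norm_derivative seq_scale (l1_norm w) f (A_op a (f t) + B_op a b (f t)) t {0<..}"
    unfolding acp_solution_def by blast
  have dom: "f t \<in> G_dom w a b" if "0 < t" for t using f[OF that] by (simp add: G_dom_def)
  have f_l1: "f t \<in> l1 w" "to_ell1 (f t) \<in> loss_domain" if "0 < t" for t
    using dom[OF that] by (simp_all add: G_dom_iff)
  have deriv: "((\<lambda>t. to_ell1 (f t)) has_vector_derivative frag_gen (to_ell1 (f t))) (at t within {0<..})"
    if "0 < t" for t
    using f'[OF that] G_op_eq[OF dom[OF that]] that f_l1(1)
      has_norm_derivative_iff[of "{0<..}" f t "of_ell1 (frag_gen (to_ell1 (f t)))"]
    by (simp add: G_op_def)
  have flow: "to_ell1 (f (\<epsilon> + t)) = S t (to_ell1 (f \<epsilon>))" if \<epsilon>: "0 < \<epsilon>" and t: "0 \<le> t" for \<epsilon> t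
  proof -
    have "((\<lambda>s. to_ell1 (f (\<epsilon> + s))) has_vector_derivative frag_gen (to_ell1 (f (\<epsilon> + s)))) (at s within {0..})"
      if "0 \<le> s" for s
    proof -
      have "((\<lambda>t. to_ell1 (f t)) has_vector_derivative frag_gen (to_ell1 (f (\<epsilon> + s)))) (at (\<epsilon> + s) within (\<lambda>s. \<epsilon> + s) ` {0..})"
        using deriv[of "\<epsilon> + s"] \<epsilon> that by (auto intro: has_vector_derivative_within_subset)
      moreover have "((\<lambda>s. \<epsilon> + s) has_vector_derivative 1) (at s within {0..})"
        by (auto intro!: derivative_eq_intros)
      ultimately have "((\<lambda>t. to_ell1 (f t)) \<circ> (\<lambda>s. \<epsilon> + s) has_vector_derivative 1 *\<^sub>R frag_gen (to_ell1 (f (\<epsilon> + s)))) (at s within {0..})"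
        by (intro vector_diff_chain_within)
      then show ?thesis by (simp add: o_def)
    qed
    then show ?thesis
      using classical_solution_unique[of "\<lambda>s. to_ell1 (f (\<epsilon> + s))" t] f_l1(2) \<epsilon> t by simp
  qed
  define V where "V t = inv (level n) (v t)" for t
  have v_V: "v t = level n (V t)" if "0 \<le> t" for t
  proof -
    have "v t \<in> X n"
      using continuous_map_funspace[OF cont] that
        topspace_norm_topology[OF isometric_copy_Metric_space[OF iso]] by (auto simp: Pi_iff)
    then show ?thesis
      using isometric_copyD(1)[OF iso] by (simp add: V_def f_inv_into_f)
  qed
  have V0: "V 0 = g" using v0 isometric_copyD(5)[OF iso] by (simp add: V_def)
  have V_cont: "continuous_on {0..} V"
  proof -
    have "continuous_map (top_of_set {0..}) (norm_topology (X n) (N n)) (\<lambda>t. level n (V t))"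
      using cont by (rule continuous_map_eq) (use v_V in auto)
    then show ?thesis by (simp add: continuous_map_isometric_copy[OF iso])
  qed
  \<comment> \<open>The flow identity is known for sequences. The preimage \<open>z\<close> under
    \<open>H ^^ n\<close> rewrites it in the coordinates of level \<open>n\<close>, in which
    \<open>V\<close> is continuous up to time 0.\<close>
  have V_flow: "V (\<epsilon> + t) = S t (V \<epsilon>)" if \<epsilon>: "0 < \<epsilon>" for \<epsilon>
  proof -
    obtain z where z: "z \<in> iterated_domain loss_domain H n" "(H ^^ n) z = to_ell1 (f \<epsilon>)" "\<iota> (f \<epsilon>) = level n z"
      using embed_level[OF f_l1(1)[OF \<epsilon>], of n] .
    have "v (\<epsilon> + t) = level 0 (to_ell1 (f (\<epsilon> + t)))"
      using vf[of "\<epsilon> + t"] level_0_eq[OF f_l1(1)[of "\<epsilon> + t"]] \<epsilon> \<open>0 \<le> t\<close> by simp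
    also have "\<dots> = level n (S t z)"
      using flow[OF \<epsilon> \<open>0 \<le> t\<close>] level_orbit[OF \<open>0 \<le> t\<close> z(1)] z(2) by simp
    finally have "level n (V (\<epsilon> + t)) = level n (S t z)" using v_V[of "\<epsilon> + t"] \<epsilon> \<open>0 \<le> t\<close> by simp
    moreover have "level n (V \<epsilon>) = level n z" using v_V[of \<epsilon>] vf[OF \<epsilon>] z(3) \<epsilon> by simp
    ultimately have "V (\<epsilon> + t) = S t z" "V \<epsilon> = z"
      using isometric_copyD(5)[OF iso] by (auto dest: injD)
    then show ?thesis by simp
  qed
  have "((\<lambda>\<epsilon>. \<epsilon> + t) \<longlongrightarrow> 0 + t) (at_right 0)"
    by (intro tendsto_add tendsto_ident_at tendsto_const)
  then have "((\<lambda>\<epsilon>. V (\<epsilon> + t)) \<longlongrightarrow> V (0 + t)) (at_right 0)"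
    by (rule continuous_on_tendsto_compose[OF V_cont])
       (use \<open>0 \<le> t\<close> eventually_at_right_less[of "0::real"] in \<open>auto elim: eventually_mono\<close>)
  moreover have "((\<lambda>\<epsilon>. V (\<epsilon> + t)) \<longlongrightarrow> S t (V 0)) (at_right 0)"
  proof (rule Lim_transform_eventually)
    have "(V \<longlongrightarrow> V 0) (at 0 within {0..})"
      using V_cont by (simp add: continuous_on_def)
    then show "((\<lambda>\<epsilon>. S t (V \<epsilon>)) \<longlongrightarrow> S t (V 0)) (at_right 0)"
      unfolding at_within_Ici_at_right
      by (rule bounded_linear.tendsto[OF bounded_linear_T[OF \<open>0 \<le> t\<close>]])
    show "eventually (\<lambda>\<epsilon>. S t (V \<epsilon>) = V (\<epsilon> + t)) (at_right 0)"
      using eventually_at_right_less[of "0::real"] by eventually_elim (simp add: V_flow)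
  qed
  ultimately have "V (0 + t) = S t (V 0)"
    by (rule tendsto_unique[OF trivial_limit_at_right_real])
  then have "V t = S t g" by (simp add: V0)
  then show ?thesis using v_V[OF \<open>0 \<le> t\<close>] by simp
qed

text \<open>At a positive time each coordinate of \<open>(H ^^ n) (S t g)\<close> depends
  continuously on \<open>g\<close>, so nonnegativity passes from sequences in the cone to its
  closure at level \<open>n\<close>.\<close>

lemma level_nonneg:
  assumes "level n g \<in> extended_cone w \<iota> (X n) (N n)"
  shows "nonneg_solution w \<iota> (\<lambda>t. level n (S t g))"
proof -
  let ?top = "norm_topology (X n) (N n)"
  note iso = isometric_copy_level[of n]
  define C where "C = {z \<in> iterated_domain loss_domain H n. \<forall>i. coord ((H ^^ n) z) i \<in> \<real>\<^sub>\<ge>\<^sub>0}"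
  have "\<iota> ` l1_cone w \<subseteq> level n ` C"
  proof clarify
    fix f assume f: "f \<in> l1_cone w"
    then have "f \<in> l1 w" by (simp add: l1_cone_iff)
    then obtain z where "z \<in> iterated_domain loss_domain H n" "(H ^^ n) z = to_ell1 f" "\<iota> f = level n z"
      by (rule embed_level)
    then show "\<iota> f \<in> level n ` C" using f by (auto simp: C_def l1_cone_iff)
  qed
  then have "level n g \<in> ?top closure_of (level n ` C)"
    using assms closure_of_mono unfolding extended_cone_def by blast
  also have "\<dots> = level n ` (euclidean closure_of C)"
    by (rule homeomorphic_map_closure_of[OF isometric_copy_homeomorphic(1)[OF iso]]) simp
  finally have "g \<in> closure C" using isometric_copyD(5)[OF iso] by (auto dest: injD)
  then obtain z where z: "\<And>m. z m \<in> C" "z \<longlonglongrightarrow> g" unfolding closure_sequential by metis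
  show ?thesis
    unfolding nonneg_solution_def
  proof (intro allI impI)
    fix t :: real assume t: "0 < t"
    have "coord ((H ^^ n) (S t g)) i \<in> \<real>\<^sub>\<ge>\<^sub>0" for i
    proof (rule closed_sequentially[OF closed_nonneg_Reals_complex])
      show "(\<lambda>m. coord ((H ^^ n) (S t (z m))) i) \<longlonglongrightarrow> coord ((H ^^ n) (S t g)) i"
        by (rule bounded_linear.tendsto[OF bounded_linear_coord
              bounded_linear.tendsto[OF iterated_smoothing(2)[OF t] z(2)]])
      fix m
      have "(H ^^ n) (S t (z m)) = S t ((H ^^ n) (z m))"
        using z(1)[of m] t by (intro iterated_domain_invariant) (auto simp: C_def)
      then show "coord ((H ^^ n) (S t (z m))) i \<in> \<real>\<^sub>\<ge>\<^sub>0"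
        using z(1)[of m] S_nonneg[of t] t by (simp add: C_def)
    qed
    then have "of_ell1 ((H ^^ n) (S t g)) \<in> l1_cone w" by (simp add: l1_cone_iff)
    moreover have "level n (S t g) = \<iota> (of_ell1 ((H ^^ n) (S t g)))"
      using level_eq[OF iterated_smoothing(1)[OF t]] by simp
    ultimately show "level n (S t g) \<in> \<iota> ` l1_cone w" by blast
  qed
qed

end

theorem theorem7p2:
  fixes w a :: "nat \<Rightarrow> real" and b :: "nat \<Rightarrow> nat \<Rightarrow> real" and \<mu> :: real
    and sc :: "complex \<Rightarrow> 'v::ab_group_add \<Rightarrow> 'v"
    and \<iota> :: "(nat \<Rightarrow> complex) \<Rightarrow> 'v"
    and X :: "nat \<Rightarrow> 'v set" and N :: "nat \<Rightarrow> 'v \<Rightarrow> real" and \<G> :: "nat \<Rightarrow> 'v \<Rightarrow> 'v"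
    and n :: nat and u0 :: 'v
  assumes a_nonneg: "\<And>i. 1 \<le> i \<Longrightarrow> 0 \<le> a i"
    and b_nonneg: "\<And>i j. 1 \<le> i \<Longrightarrow> 1 \<le> j \<Longrightarrow> 0 \<le> b i j"
    and b_zero: "\<And>i j. 1 \<le> j \<Longrightarrow> j \<le> i \<Longrightarrow> b i j = 0"
    and weight_pos: "\<And>i. 1 \<le> i \<Longrightarrow> 0 < w i"
    and weight_ge: "\<And>i. 1 \<le> i \<Longrightarrow> real i \<le> w i"
    and kappa: "\<exists>\<kappa>. 0 < \<kappa> \<and> \<kappa> < 1 \<and> (\<forall>j\<ge>2. (\<Sum>i=1..j-1. w i * b i j) \<le> \<kappa> * w j)"
    and mu: "growth_bound (l1 w) (l1_norm w) (frag_semigroup w a b) < ereal \<mu>"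
    and tower: "sobolev_tower w a b \<mu> sc \<iota> X N \<G>"
    and n: "1 \<le> n"
    and u0: "u0 \<in> extended_cone w \<iota> (X n) (N n)"
  shows "\<exists>u. acp_solution w a b \<iota> (X n) (N n) u0 u \<and> nonneg_solution w \<iota> u \<and>
             (\<forall>v. acp_solution w a b \<iota> (X n) (N n) u0 v \<longrightarrow> (\<forall>t\<ge>0. v t = u t)) \<and>
             (\<forall>t\<ge>0. u t = extended_semigroup w \<iota> (X n) (N n) (frag_semigroup w a b) t u0)"
proof -
  obtain \<kappa> where \<kappa>: "0 < \<kappa>" "\<kappa> < 1" "\<And>j. 2 \<le> j \<Longrightarrow> (\<Sum>i=1..j-1. w i * b i j) \<le> \<kappa> * w j"
    using kappa by blast
  interpret sobolev_tower w a b \<mu> sc \<iota> X N \<G> by (rule tower)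
  interpret frag_tower w a b \<kappa> \<mu> sc \<iota> X N \<G>
    by unfold_locales (use a_nonneg b_nonneg b_zero weight_pos \<kappa> mu in auto)
  have u0_X: "u0 \<in> X n"
    using u0 closure_of_subset_topspace[of "norm_topology (X n) (N n)"]
      topspace_norm_topology[OF isometric_copy_Metric_space[OF isometric_copy_level[of n]]]
    unfolding extended_cone_def by blast
  then obtain g where g: "u0 = level n g" using isometric_copyD(1)[OF isometric_copy_level[of n]] by blast
  show ?thesis
  proof (intro exI conjI allI impI)
    show "acp_solution w a b \<iota> (X n) (N n) u0 (\<lambda>t. level n (S t g))"
      unfolding g by (rule level_is_solution)
    show "nonneg_solution w \<iota> (\<lambda>t. level n (S t g))"
      using u0 unfolding g by (rule level_nonneg)
  next
    fix v and t :: real assume "acp_solution w a b \<iota> (X n) (N n) u0 v" "0 \<le> t"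
    then show "v t = level n (S t g)" unfolding g by (rule solution_unique)
  next
    fix t :: real assume "0 \<le> t"
    then show "level n (S t g) = extended_semigroup w \<iota> (X n) (N n) (frag_semigroup w a b) t u0"
      using extended_semigroup_eq[OF _ u0_X] by (simp add: g extension_level)
  qed
qed

end
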